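(* Let $n=1$ and let $H\in C(\mathbb R\times\mathbb R,\mathbb R)$ be $\mathbb Z$-periodic in its first variable and coercive in its second variable, with effective Hamiltonian $\overline H$. Then one can select, simultaneously for all $p\in\mathbb R$, periodic viscosity solutions $v(\cdot,p)$ of $$H\bigl(y,p+v_y(y,p)\bigr)=\overline H(p)\qquad\text{in }\mathbb T,$$ normalized by $v(0,p)=0$, so that for every $p<q$, $$p+v_y(\cdot,p)\le q+v_y(\cdot,q)\qquad\text{a.e. on }\mathbb T.$$ In particular, $$\|v(\cdot,p)-v(\cdot,q)\|_{L^\infty(\mathbb T)}\le |p-q|\qquad\text{for all }p,q\in\mathbb R.$$ Assume further that $H\in C^{0,1}(\mathbb R\times\mathbb R,\mathbb R)$, and let $g\in\mathrm{BUC}(\mathbb R)\cap\mathrm{Lip}(\mathbb R)$. Then, for every $T>0$, there exists a constant $C$ depending only on $H$, $\|Dg\|_{L^\infty}$ and $T$ such that for every $\varepsilon\in(0,1)$ the viscosity solutions $u^\varepsilon$ of $$u^\varepsilon_t+H\left(\tfrac{z}{\varepsilon},u^\varepsilon_z\right)=0\ \text{ in }\mathbb R\times(0,\infty),\qquad u^\varepsilon(z,0)=g(z)\ \text{ on }\mathbb R,$$ and $u$ of $$u_t+\overline H(u_z)=0\ \text{ in }\mathbb R\times(0,\infty),\qquad u(z,0)=g(z)\ \text{ on }\mathbb R,$$ satisfy $$\|u^\varepsilon-u\|_{L^\infty(\mathbb R\times[0,T])}\le C\varepsilon^{1/2}.$$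
   Context: $\mathbb T=\mathbb R/\mathbb Z$. $C^{0,1}$ denotes (globally) Lipschitz continuous functions, not required to be bounded. $\mathrm{BUC}$ denotes bounded uniformly continuous functions and $\mathrm{Lip}$ Lipschitz functions. $H=H(y,p)$ is coercive in its second variable if $H(y,p)\to+\infty$ as $|p|\to\infty$ uniformly in $y$. Effective Hamiltonian: for each $p\in\mathbb R$, $\overline H(p)$ is the unique real number such that the cell problem $H(y,p+v'(y))=\overline H(p)$ in $\mathbb T$ has a continuous ($\mathbb Z$-periodic) viscosity solution $v$; by coercivity such solutions are Lipschitz, so $v_y$ exists a.e. Solutions of the Cauchy problems are the unique viscosity solutions (bounded uniformly continuous on $\mathbb R\times[0,T]$ for each $T>0$). *)

theory Defs
  imports "HOL-Analysis.Analysis" "HOL-Probability.Essential_Supremum"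
begin

text \<open>
  First-order equations \<open>F (x, D u) = 0\<close> on an open set \<open>\<Omega>\<close>, with \<open>C\<^sup>1\<close> test functions
  \<open>\<phi>\<close> (gradient \<open>G\<close>) touching from above, respectively from below, at local extrema of
  \<open>u - \<phi>\<close>.
\<close>

definition C1_test :: "'a::real_inner set \<Rightarrow> ('a \<Rightarrow> real) \<Rightarrow> ('a \<Rightarrow> 'a) \<Rightarrow> bool" where
  "C1_test \<Omega> \<phi> G \<longleftrightarrow> (\<forall>x\<in>\<Omega>. GDERIV \<phi> x :> G x) \<and> continuous_on \<Omega> G"

definition viscosity_subsolution ::
  "'a::real_inner set \<Rightarrow> ('a \<Rightarrow> 'a \<Rightarrow> real) \<Rightarrow> ('a \<Rightarrow> real) \<Rightarrow> bool" where
  "viscosity_subsolution \<Omega> F u \<longleftrightarrow>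
     (\<forall>\<phi> G. C1_test \<Omega> \<phi> G \<longrightarrow>
        (\<forall>x\<in>\<Omega>. (\<forall>\<^sub>F y in nhds x. u y - \<phi> y \<le> u x - \<phi> x) \<longrightarrow> F x (G x) \<le> 0))"

definition viscosity_supersolution ::
  "'a::real_inner set \<Rightarrow> ('a \<Rightarrow> 'a \<Rightarrow> real) \<Rightarrow> ('a \<Rightarrow> real) \<Rightarrow> bool" where
  "viscosity_supersolution \<Omega> F u \<longleftrightarrow>
     (\<forall>\<phi> G. C1_test \<Omega> \<phi> G \<longrightarrow>
        (\<forall>x\<in>\<Omega>. (\<forall>\<^sub>F y in nhds x. u y - \<phi> y \<ge> u x - \<phi> x) \<longrightarrow> F x (G x) \<ge> 0))"

definition viscosity_solution ::
  "'a::real_inner set \<Rightarrow> ('a \<Rightarrow> 'a \<Rightarrow> real) \<Rightarrow> ('a \<Rightarrow> real) \<Rightarrow> bool" where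
  "viscosity_solution \<Omega> F u \<longleftrightarrow>
     continuous_on \<Omega> u \<and> viscosity_subsolution \<Omega> F u \<and> viscosity_supersolution \<Omega> F u"

definition coercive_snd :: "(real \<Rightarrow> real \<Rightarrow> real) \<Rightarrow> bool" where
  "coercive_snd H \<longleftrightarrow> (\<forall>M. \<forall>\<^sub>F p in at_infinity. \<forall>y. M \<le> H y p)"

text \<open>
  Functions on the torus \<open>\<real>/\<int>\<close> are represented by 1-periodic functions on the line; the torus
  carries the Lebesgue measure of the fundamental domain \<open>[0,1)\<close>.
\<close>

definition cell_solution ::
  "(real \<Rightarrow> real \<Rightarrow> real) \<Rightarrow> real \<Rightarrow> real \<Rightarrow> (real \<Rightarrow> real) \<Rightarrow> bool" where
  "cell_solution H p c v \<longleftrightarrow>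
     (\<forall>y. v (y + 1) = v y) \<and> viscosity_solution UNIV (\<lambda>y d. H y (p + d) - c) v"

definition effective_hamiltonian :: "(real \<Rightarrow> real \<Rightarrow> real) \<Rightarrow> real \<Rightarrow> real" where
  "effective_hamiltonian H p = (THE c. \<exists>v. cell_solution H p c v)"

definition Linf_norm :: "'a::euclidean_space set \<Rightarrow> ('a \<Rightarrow> real) \<Rightarrow> ereal" where
  "Linf_norm S f = esssup (lebesgue_on S) (\<lambda>x. ereal \<bar>f x\<bar>)"

definition BUC_on :: "'a::metric_space set \<Rightarrow> ('a \<Rightarrow> real) \<Rightarrow> bool" where
  "BUC_on S f \<longleftrightarrow> bounded (f ` S) \<and> uniformly_continuous_on S f"

text \<open>
  The solutions of \<open>u\<^sub>t + A (z, u\<^sub>z) = 0\<close> on \<open>\<real> \<times> (0,\<infinity>)\<close> with \<open>u (z, 0) = g z\<close>, in the class of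
  functions that are bounded and uniformly continuous on \<open>\<real> \<times> [0,T]\<close> for each \<open>T > 0\<close>.
  Points are pairs \<open>(z, t)\<close>; values of \<open>u\<close> at negative times are irrelevant.
\<close>

definition cauchy_solution ::
  "(real \<Rightarrow> real \<Rightarrow> real) \<Rightarrow> (real \<Rightarrow> real) \<Rightarrow> (real \<times> real \<Rightarrow> real) \<Rightarrow> bool" where
  "cauchy_solution A g u \<longleftrightarrow>
     (\<forall>T>0. BUC_on (UNIV \<times> {0..T}) u) \<and>
     viscosity_solution (UNIV \<times> {0<..}) (\<lambda>(z, t) (dz, dt). dt + A z dz) u \<and>
     (\<forall>z. u (z, 0) = g z)"

end

theory Submission
  imports Defs "HOL-Complex_Analysis.Great_Picard"
begin

text \<open>
  Monotone selection. For the discounted equation \<open>\<delta> v + H(y, p + v') = 0\<close>, whose periodic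
  solutions \<open>v\<^sub>p\<close> come from Perron's method (coercivity makes all subsolutions equi-Lipschitz), let
  \<open>p < q\<close> and \<open>D y = (q - p) y + v\<^sub>q y - v\<^sub>p y\<close>. Comparing the two equations at a local maximum
  \<open>y1\<close> of \<open>D\<close> gives \<open>D y1 \<le> (q - p) y1\<close>, at a local minimum \<open>y2\<close> it gives
  \<open>D y2 \<ge> (q - p) y2\<close>; hence \<open>D\<close> cannot decrease from a maximum to a later minimum and is
  nondecreasing. This survives the limit \<open>\<delta> \<rightarrow> 0\<close>, taken along one subsequence for all \<open>p\<close> at once
  because the normalized solutions are 1-Lipschitz in \<open>p\<close>.

  Rate. With \<open>\<eta> = sqrt \<epsilon>\<close> one maximizes
  \<open>u\<^sup>\<epsilon>(x,t) - u(y,s) - \<epsilon> v(\<xi>,p) - (x-y)\<^sup>2/(2\<eta>) - (x-y-\<eta>p)\<^sup>2/(2\<alpha>) - (x-\<epsilon>\<xi>)\<^sup>2/(2\<alpha>) - (t-s)\<^sup>2/(2\<alpha>)\<close>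
  up to localizing terms. Optimality in the extra variable \<open>p\<close> and the 1-Lipschitz dependence of
  \<open>v\<close> on \<open>p\<close> bound the slope \<open>(x-y-\<eta>p)/\<alpha>\<close> by \<open>\<eta>\<close>, so the three viscosity inequalities combine with
  an error of order \<open>\<eta>\<close>.
\<close>

text \<open>Cell solutions need not be unique, and comparing two of them at an extremum without
  discount only compares \<open>effective_hamiltonian H p\<close> with
  \<open>effective_hamiltonian H q\<close>; it says nothing about values of the solutions. The term
  \<delta> v supplies that information, and the resulting monotonicity of D no longer mentions
  \<delta>.

  In the rate, the obstacle is the corrector: it varies with p, and no bound on the maximizing p is
  known beforehand. Tying p to (x - y)/\<eta> by a separate penalty turns the first difficulty into
  a slope error of size \<epsilon>/\<eta> = \<eta>. For the second, the corrector at p is at most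
  the one at 0 plus |p|, and \<epsilon> |p| is absorbed by the penalties; so only the bound on v(.,
  0) enters the constant. The slopes (t - s)/\<alpha> and (x - \<epsilon> \<xi>)/\<alpha> are not
  bounded uniformly. Each occurs in two inequalities and cancels, the latter because H is globally
  Lipschitz.\<close>

subsection \<open>Almost everywhere differentiability of Lipschitz functions\<close>

text \<open>
  The image of Lebesgue measure under \<open>F\<^sup>-\<^sup>1\<close> gives \<open>{a..b}\<close> the mass \<open>F b - F a\<close>, and it is absolutely
  continuous because the Lipschitz map \<open>F\<close> preserves null sets; \<open>h\<close> is its Radon-Nikodym density.
\<close>
lemma lipschitz_homeo_density:
  fixes F :: "real \<Rightarrow> real"
  assumes K: "K > 0" and m: "m > 0"
    and up: "\<And>x y. x \<le> y \<Longrightarrow> F y - F x \<le> K * (y - x)"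
    and lo: "\<And>x y. x \<le> y \<Longrightarrow> m * (y - x) \<le> F y - F x"
  shows "\<exists>h. \<forall>a b. a \<le> b \<longrightarrow> (h has_integral F b - F a) {a..b}"
proof -
  have lip: "\<bar>F x - F y\<bar> \<le> K * \<bar>x - y\<bar>" for x y
  proof (cases "x \<le> y")
    case True
    then have "0 \<le> m * (y - x)" using m by simp
    then show ?thesis using up[of x y] lo[of x y] True by (simp add: abs_if)
  next
    case False
    then have "0 \<le> m * (x - y)" using m by simp
    then show ?thesis using up[of y x] lo[of y x] False by (simp add: abs_if)
  qed
  have smono: "F x < F y" if "x < y" for x y
  proof -
    have "0 < m * (y - x)" using that m by simp
    with lo[of x y] that show ?thesis by simp
  qed
  have le_iff: "F x \<le> F y \<longleftrightarrow> x \<le> y" for x y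
    using smono[of x y] smono[of y x] by (cases x y rule: linorder_cases) auto
  have contF: "continuous_on UNIV F"
    by (rule lipschitz_on_continuous_on[of K]) (use lip K in \<open>auto intro!: lipschitz_onI simp: dist_real_def\<close>)
  have surj: "\<exists>x. F x = y" for y
  proof -
    define r where "r = \<bar>y - F 0\<bar> / m"
    have r: "r \<ge> 0" "m * r = \<bar>y - F 0\<bar>" using m by (auto simp: r_def)
    have "F (-r) \<le> y" using lo[of "-r" 0] r by auto
    moreover have "y \<le> F r" using lo[of 0 r] r by auto
    moreover have "continuous_on {-r..r} F" using contF continuous_on_subset by blast
    ultimately show ?thesis using IVT'[of F "-r" y r] r by auto
  qed
  define G where "G = (\<lambda>y. THE x. F x = y)"
  have GF: "G (F x) = x" for x
    unfolding G_def using le_iff by (intro the_equality) (auto, metis order.antisym order.refl)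
  have FG: "F (G y) = y" for y
    using surj[of y] GF by metis
  have Gmono: "mono G"
    by (rule monoI) (metis FG le_iff)
  have Gm[measurable]: "G \<in> borel_measurable borel"
    by (rule borel_measurable_mono[OF Gmono])
  define N where "N = distr lborel borel G"
  have ac: "absolutely_continuous lborel N"
    unfolding absolutely_continuous_def
  proof
    fix A :: "real set" assume A: "A \<in> null_sets lborel"
    then have neg: "negligible A"
      by (simp add: negligible_iff_null_sets null_sets_completionI)
    have "negligible (F ` A)"
      by (rule negligible_locally_Lipschitz_image[OF _ neg])
        (use lip in \<open>auto intro!: exI[of _ UNIV] exI[of _ K]\<close>)
    moreover have eq: "G -` A = F ` A"
      using FG GF by (auto simp: image_iff) metis
    moreover have "A \<in> sets borel" using A by auto
    then have b: "G -` A \<in> sets borel"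
      using measurable_sets[OF Gm, of A] by simp
    ultimately have "emeasure lborel (G -` A) = 0"
      by (simp add: negligible_iff_null_sets null_sets_completion_iff null_setsD1)
    then show "A \<in> null_sets N"
      using A b unfolding N_def by (auto simp: null_sets_def emeasure_distr)
  qed
  obtain h where h[measurable]: "h \<in> borel_measurable lborel" and dens: "density lborel h = N"
    using sigma_finite_measure.Radon_Nikodym[OF sigma_finite_lborel ac] by (auto simp: N_def)
  have int: "(\<integral>\<^sup>+x. h x * indicator {a..b} x \<partial>lborel) = ennreal (F b - F a)" if "a \<le> b" for a b
  proof -
    have "(\<integral>\<^sup>+x. h x * indicator {a..b} x \<partial>lborel) = emeasure N {a..b}"
      by (subst dens[symmetric]) (simp add: emeasure_density)
    also have "\<dots> = emeasure lborel (G -` {a..b})"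
      unfolding N_def by (simp add: emeasure_distr)
    also have "G -` {a..b} = {F a..F b}"
      using FG le_iff by (auto simp: vimage_def) metis+
    finally show ?thesis using le_iff that by simp
  qed
  have "((\<lambda>x. enn2real (h x)) has_integral F b - F a) {a..b}" if "a \<le> b" for a b
  proof -
    have fin: "AE x in lborel. h x * indicator {a..b} x \<noteq> \<infinity>"
      by (rule nn_integral_PInf_AE) (use int[OF that] in auto)
    have "(\<integral>\<^sup>+x. ennreal (enn2real (h x) * indicator {a..b} x) \<partial>lborel)
        = (\<integral>\<^sup>+x. h x * indicator {a..b} x \<partial>lborel)"
      by (rule nn_integral_cong_AE) (use fin in eventually_elim,
          auto simp: indicator_def ennreal_enn2real_if)
    also have "\<dots> = ennreal (F b - F a)" by (rule int[OF that])
    finally have "((\<lambda>x. enn2real (h x) * indicator {a..b} x) has_integral F b - F a) UNIV"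
      using le_iff[of a b] that by (intro nn_integral_has_integral) auto
    moreover have "(\<lambda>x. enn2real (h x) * indicator {a..b} x) = (\<lambda>x. if x \<in> {a..b} then enn2real (h x) else 0)"
      by (auto simp: indicator_def)
    ultimately have "((\<lambda>x. if x \<in> {a..b} then enn2real (h x) else 0) has_integral F b - F a) UNIV"
      by simp
    then show ?thesis by (simp only: has_integral_restrict_UNIV)
  qed
  then show ?thesis by blast
qed

text \<open>Adding a steep linear function makes f increasing with slopes bounded below, so that it
  has a density; the Lebesgue differentiation theorem recovers f' from it. A single \<open>h\<close>
  serves both the pointwise statement and the fundamental theorem of calculus.\<close>

lemma lipschitz_ae_derivative:
  fixes f :: "real \<Rightarrow> real"
  assumes "K-lipschitz_on UNIV f"
  obtains h N where "negligible N" "\<And>x. x \<notin> N \<Longrightarrow> (f has_real_derivative h x) (at x)"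
    "\<And>a b. a \<le> b \<Longrightarrow> (h has_integral f b - f a) {a..b}"
proof -
  have K0: "K \<ge> 0" by (rule lipschitz_on_nonneg[OF assms])
  have lip: "\<bar>f x - f y\<bar> \<le> K * \<bar>x - y\<bar>" for x y
    using lipschitz_onD[OF assms, of x y] by (simp add: dist_real_def)
  \<comment> \<open>The slope K + 1 puts all difference quotients of \<open>F\<close> between 1 and
    2 K + 1.\<close>
  define F where "F = (\<lambda>x. f x + (K + 1) * x)"
  obtain H where H: "\<And>a b. a \<le> b \<Longrightarrow> (H has_integral F b - F a) {a..b}"
  proof (atomize_elim, rule lipschitz_homeo_density[of "2 * K + 1" 1])
    fix x y :: real assume "x \<le> y"
    then show "F y - F x \<le> (2 * K + 1) * (y - x)" "1 * (y - x) \<le> F y - F x"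
      using lip[of x y] by (auto simp: F_def algebra_simps abs_le_iff)
  qed (use K0 in auto)
  define h where "h = (\<lambda>x. H x - (K + 1))"
  have h: "(h has_integral f b - f a) {a..b}" if "a \<le> b" for a b
  proof -
    have "((\<lambda>x. H x - (K + 1)) has_integral (F b - F a) - (K + 1) * (b - a)) {a..b}"
      using has_integral_diff[OF H[OF that] has_integral_const_real[of "K + 1" a b]] that
      by (simp add: mult.commute)
    then show ?thesis by (simp add: h_def F_def algebra_simps)
  qed
  \<comment> \<open>The differentiation theorem averages over intervals that start at the point, so
    it controls right difference quotients only. Left ones are right ones for the reflected
    density.\<close>
  have h': "((\<lambda>x. h (-x)) has_integral f (-a) - f (-b)) {a..b}" if "a \<le> b" for a b
    using iffD2[OF has_integral_reflect_real[where f=h and a="- b" and b="- a" and i="f (- a) - f (- b)"]]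
      h[of "- b" "- a"] that by simp
  have ih: "h integrable_on {a..b}" for a b
    using h[of a b] by (cases "a \<le> b") (auto intro: has_integral_integrable)
  have ih': "(\<lambda>x. h (-x)) integrable_on {a..b}" for a b
    using h'[of a b] by (cases "a \<le> b") (auto intro: has_integral_integrable)
  obtain N1 where N1: "negligible N1" "\<And>x e. \<lbrakk>x \<notin> N1; 0 < e\<rbrakk> \<Longrightarrow>
       \<exists>d>0. \<forall>t. 0 < t \<and> t < d \<longrightarrow> norm (integral (cbox x (x + t *\<^sub>R One)) h /\<^sub>R t ^ DIM(real) - h x) < e"
    by (rule integrable_ccontinuous_explicit[of h])
      (use ih in auto)
  obtain N2 where N2: "negligible N2" "\<And>x e. \<lbrakk>x \<notin> N2; 0 < e\<rbrakk> \<Longrightarrow>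
       \<exists>d>0. \<forall>t. 0 < t \<and> t < d \<longrightarrow>
         norm (integral (cbox x (x + t *\<^sub>R One)) (\<lambda>x. h (-x)) /\<^sub>R t ^ DIM(real) - h (-x)) < e"
    by (rule integrable_ccontinuous_explicit[of "\<lambda>x. h (-x)"])
      (use ih' in auto)
  have neg: "negligible (uminus ` N2)"
    by (rule negligible_locally_Lipschitz_image[OF _ N2(1)])
      (auto intro!: exI[of _ "UNIV :: real set"] exI[of _ "1 :: real"])
  have der: "(f has_real_derivative h x) (at x)" if x: "x \<notin> N1 \<union> uminus ` N2" for x
    unfolding DERIV_def LIM_def
  proof (intro allI impI)
    fix e :: real assume e: "0 < e"
    have x1: "x \<notin> N1" and x2: "-x \<notin> N2" using x by (auto simp: image_iff)
    obtain d1 where d1: "d1 > 0" "\<And>t. 0 < t \<Longrightarrow> t < d1 \<Longrightarrow> \<bar>integral {x..x+t} h / t - h x\<bar> < e"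
      using N1(2)[OF x1 e] by (auto simp: divide_inverse mult.commute)
    obtain d2 where d2: "d2 > 0" "\<And>t. 0 < t \<Longrightarrow> t < d2 \<Longrightarrow>
        \<bar>integral {- x..- x+t} (\<lambda>x. h (-x)) / t - h x\<bar> < e"
      using N2(2)[OF x2 e] by (auto simp: divide_inverse mult.commute)
    show "\<exists>s>0. \<forall>t. t \<noteq> 0 \<and> dist t 0 < s \<longrightarrow> dist ((f (x + t) - f x) / t) (h x) < e"
    proof (intro exI[of _ "min d1 d2"] conjI allI impI)
      fix t :: real assume t: "t \<noteq> 0 \<and> dist t 0 < min d1 d2"
      show "dist ((f (x + t) - f x) / t) (h x) < e"
      proof (cases "t > 0")
        case True
        then show ?thesis using d1(2)[of t] t integral_unique[OF h[of x "x + t"]]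
          by (auto simp: dist_real_def)
      next
        case False
        with t have "0 < -t" "-t < d2" by (auto simp: dist_real_def)
        moreover have "integral {- x..- x + (-t)} (\<lambda>x. h (-x)) = f x - f (x + t)"
          using integral_unique[OF h'[of "-x" "-x + (-t)"]] False by (simp add: add.commute)
        moreover have "(f x - f (x + t)) / (- t) = (f (x + t) - f x) / t"
          using t by (simp add: field_simps)
        ultimately show ?thesis using d2(2)[of "-t"] by (auto simp: dist_real_def)
      qed
    qed (use d1 d2 in auto)
  qed
  show thesis
    by (rule that[OF negligible_Un[OF N1(1) neg] der h])
qed

lemma lipschitz_AE_differentiable:
  fixes f :: "real \<Rightarrow> real"
  assumes "K-lipschitz_on UNIV f"
  shows "AE x in lebesgue. f differentiable (at x)"
proof -
  obtain h N where "negligible N" and h: "\<And>x. x \<notin> N \<Longrightarrow> (f has_real_derivative h x) (at x)"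
    by (rule lipschitz_ae_derivative[OF assms]) blast
  then have "N \<in> null_sets lebesgue" by (simp add: negligible_iff_null_sets)
  then show ?thesis
    by (rule AE_I'[of N]) (use h real_differentiable_def in blast)
qed

lemma lipschitz_AE_deriv_bound:
  fixes f :: "real \<Rightarrow> real"
  assumes lip: "K-lipschitz_on UNIV f" and L: "AE x in lebesgue. \<bar>deriv f x\<bar> \<le> L"
  shows "\<bar>f x - f y\<bar> \<le> L * \<bar>x - y\<bar>"
proof -
  obtain h N where N: "negligible N" and der: "\<And>x. x \<notin> N \<Longrightarrow> (f has_real_derivative h x) (at x)"
    and h: "\<And>a b. a \<le> b \<Longrightarrow> (h has_integral f b - f a) {a..b}"
    by (rule lipschitz_ae_derivative[OF lip]) blast
  from L obtain M where M: "M \<in> null_sets lebesgue" "{x. \<not> \<bar>deriv f x\<bar> \<le> L} \<subseteq> M"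
    by (auto simp: eventually_ae_filter)
  have negM: "negligible (N \<union> M)" using N M by (auto simp: negligible_iff_null_sets)
  define k where "k = (\<lambda>x. if x \<in> N \<union> M then 0 else h x)"
  \<comment> \<open>A null set is not the whole line, so some point has |deriv f| \<le> L; hence L
    is nonnegative.\<close>
  have "negligible (UNIV :: real set) \<longleftrightarrow> False" by simp
  then obtain z where "z \<notin> N \<union> M" using negM by (metis UNIV_eq_I)
  then have L0: "0 \<le> L" using M by force
  have kL: "\<bar>k x\<bar> \<le> L" for x
  proof (cases "x \<in> N \<union> M")
    case False
    then have "\<bar>deriv f x\<bar> \<le> L" using M by auto
    then show ?thesis using False DERIV_imp_deriv[OF der[of x]] by (simp add: k_def)
  qed (use L0 in \<open>simp add: k_def\<close>)
  have k: "(k has_integral f b - f a) {a..b}" if "a \<le> b" for a b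
    by (rule has_integral_spike[OF negM _ h[OF that]]) (simp add: k_def)
  have "\<bar>f b - f a\<bar> \<le> L * (b - a)" if "a \<le> b" for a b
    using has_integral_bound[of L k "f b - f a" a b] L0 k[OF that] kL that by simp
  from this[of x y] this[of y x] show ?thesis by (cases "x \<le> y") (auto simp: abs_if algebra_simps split: if_splits)
qed

subsection \<open>Viscosity sub- and supersolutions on the line\<close>

lemma viscosity_subsolutionD_real:
  fixes u :: "real \<Rightarrow> real"
  assumes "viscosity_subsolution UNIV F u" "\<And>x. (\<phi> has_real_derivative G x) (at x)"
    "continuous_on UNIV G" "\<forall>\<^sub>F y in nhds x. u y - \<phi> y \<le> u x - \<phi> x"
  shows "F x (G x) \<le> 0"
  using assms unfolding viscosity_subsolution_def C1_test_def by auto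

lemma viscosity_supersolutionD_real:
  fixes u :: "real \<Rightarrow> real"
  assumes "viscosity_supersolution UNIV F u" "\<And>x. (\<phi> has_real_derivative G x) (at x)"
    "continuous_on UNIV G" "\<forall>\<^sub>F y in nhds x. u y - \<phi> y \<ge> u x - \<phi> x"
  shows "F x (G x) \<ge> 0"
  using assms unfolding viscosity_supersolution_def C1_test_def by auto

lemma C1_test_minus: "C1_test \<Omega> \<phi> G \<Longrightarrow> C1_test \<Omega> (\<lambda>x. - \<phi> x) (\<lambda>x. - G x)"
  unfolding C1_test_def by (auto intro: GDERIV_minus continuous_on_minus)

text \<open>Negation exchanges touching from above and from below. Results on supersolutions are
  read off from those on subsolutions, and the second half of the error estimate from the
  first.\<close>

lemma viscosity_supersolution_minus:
  "viscosity_supersolution \<Omega> F u \<longleftrightarrow> viscosity_subsolution \<Omega> (\<lambda>x d. - F x (- d)) (\<lambda>x. - u x)"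
proof
  assume *: "viscosity_supersolution \<Omega> F u"
  show "viscosity_subsolution \<Omega> (\<lambda>x d. - F x (- d)) (\<lambda>x. - u x)"
    unfolding viscosity_subsolution_def
  proof (intro allI impI ballI)
    fix \<phi> G x
    assume "C1_test \<Omega> \<phi> G" "x \<in> \<Omega>" "\<forall>\<^sub>F y in nhds x. - u y - \<phi> y \<le> - u x - \<phi> x"
    then have "C1_test \<Omega> (\<lambda>x. - \<phi> x) (\<lambda>x. - G x)" "x \<in> \<Omega>"
      "\<forall>\<^sub>F y in nhds x. u y - (- \<phi> y) \<ge> u x - (- \<phi> x)"
      by (auto intro: C1_test_minus elim!: eventually_mono)
    with * have "F x (- G x) \<ge> 0"
      unfolding viscosity_supersolution_def by blast
    then show "- F x (- G x) \<le> 0" by simp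
  qed
next
  assume *: "viscosity_subsolution \<Omega> (\<lambda>x d. - F x (- d)) (\<lambda>x. - u x)"
  show "viscosity_supersolution \<Omega> F u"
    unfolding viscosity_supersolution_def
  proof (intro allI impI ballI)
    fix \<phi> G x
    assume "C1_test \<Omega> \<phi> G" "x \<in> \<Omega>" "\<forall>\<^sub>F y in nhds x. u y - \<phi> y \<ge> u x - \<phi> x"
    then have "C1_test \<Omega> (\<lambda>x. - \<phi> x) (\<lambda>x. - G x)" "x \<in> \<Omega>"
      "\<forall>\<^sub>F y in nhds x. - u y - (- \<phi> y) \<le> - u x - (- \<phi> x)"
      by (auto intro: C1_test_minus elim!: eventually_mono)
    with * have "- F x (- (- G x)) \<le> 0"
      unfolding viscosity_subsolution_def by blast
    then show "F x (G x) \<ge> 0" by simp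
  qed
qed

lemma viscosity_subsolution_minus:
  "viscosity_subsolution \<Omega> F u \<longleftrightarrow> viscosity_supersolution \<Omega> (\<lambda>x d. - F x (- d)) (\<lambda>x. - u x)"
  by (simp add: viscosity_supersolution_minus)

section \<open>A priori slope bounds for coercive subsolutions\<close>

lemma viscosity_subsolution_reflect:
  fixes u :: "real \<Rightarrow> real"
  assumes "viscosity_subsolution UNIV F u"
  shows "viscosity_subsolution UNIV (\<lambda>x d. F (- x) (- d)) (\<lambda>x. u (- x))"
  unfolding viscosity_subsolution_def
proof (intro allI impI ballI)
  fix \<phi> G :: "real \<Rightarrow> real" and x :: real
  assume C: "C1_test UNIV \<phi> G" and m: "\<forall>\<^sub>F y in nhds x. u (- y) - \<phi> y \<le> u (- x) - \<phi> x"
  have 1: "((\<lambda>x. \<phi> (- x)) has_real_derivative - G (- x)) (at x)" for x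
  proof -
    have "((\<lambda>x. - x) has_real_derivative - 1) (at x)" by (auto intro!: derivative_eq_intros)
    from DERIV_chain'[OF this, of \<phi> "G (- x)"] C show ?thesis by (simp add: C1_test_def)
  qed
  have 2: "continuous_on UNIV (\<lambda>x. - G (- x))"
    using C unfolding C1_test_def
    by (auto intro!: continuous_intros continuous_on_compose2[of UNIV G])
  have "filterlim uminus (nhds x) (nhds (- x))"
    using tendsto_minus[OF filterlim_ident, of "- x"] by simp
  then have "\<forall>\<^sub>F y in nhds (- x). u (- (- y)) - \<phi> (- y) \<le> u (- x) - \<phi> x"
    using m by (rule eventually_compose_filterlim[rotated])
  then have "\<forall>\<^sub>F y in nhds (- x). u y - \<phi> (- y) \<le> u (- x) - \<phi> (- (- x))" by simp
  from viscosity_subsolutionD_real[OF assms 1 2 this]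
  show "F (- x) (- G x) \<le> 0" by simp
qed

text \<open>If the mean slope on [a, b] exceeded some R' > R, a line of slope R' plus an exponential
  barrier beyond b would leave w minus this function with an interior maximum on [a, b + 1]. The
  test slope there exceeds R, where F is positive.\<close>

lemma subsolution_increase_le:
  fixes w :: "real \<Rightarrow> real"
  assumes cont: "continuous_on UNIV w" and sub: "viscosity_subsolution UNIV F w"
    and R: "\<And>x d. R < d \<Longrightarrow> 0 < F x d" and ab: "a < b"
  shows "w b - w a \<le> R * (b - a)"
proof (rule ccontr)
  assume "\<not> ?thesis"
  then have neg: "R < (w b - w a) / (b - a)" using ab by (simp add: field_simps)
  obtain R' where R': "R < R'" "R' < (w b - w a) / (b - a)" using dense[OF neg] by blast
  define g where "g = w b - w a - R' * (b - a)"
  have g: "g > 0" using R'(2) ab by (simp add: g_def field_simps)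
  \<comment> \<open>The barrier exp(N (x - b - 1/2)) equals 1/(2M) at b, less than the excess
    \<open>g\<close>, which excludes a; at b + 1 it equals 2M, more than w can gain over the line
    there, which excludes b + 1.\<close>
  define M where "M = max 1 (max (1 / g) (w (b + 1) - R' - w b))"
  define N where "N = 2 * ln (2 * M)"
  have M: "M \<ge> 1" "M \<ge> 1 / g" "M \<ge> w (b + 1) - R' - w b" by (auto simp: M_def)
  have N0: "N > 0" using M by (simp add: N_def)
  have expN: "exp (N / 2) = 2 * M" using M by (simp add: N_def)
  have expN': "exp (- (N / 2)) < g"
  proof -
    have "exp (- (N / 2)) = 1 / (2 * M)" by (simp add: exp_minus expN inverse_eq_divide)
    also have "\<dots> < 1 / M" using M by (simp add: field_simps)
    also have "\<dots> \<le> g" using M g by (simp add: field_simps)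
    finally show ?thesis .
  qed
  define \<phi> where "\<phi> = (\<lambda>x. R' * x + exp (N * (x - b - 1 / 2)))"
  define G where "G = (\<lambda>x. R' + N * exp (N * (x - b - 1 / 2)))"
  have der: "(\<phi> has_real_derivative G x) (at x)" for x
    unfolding \<phi>_def G_def by (auto intro!: derivative_eq_intros)
  have contG: "continuous_on UNIV G" unfolding G_def by (intro continuous_intros)
  have "continuous_on {a..b+1} (\<lambda>x. w x - \<phi> x)"
    unfolding \<phi>_def using cont by (intro continuous_intros) (auto intro: continuous_on_subset)
  then obtain z where z: "z \<in> {a..b+1}" "\<And>x. x \<in> {a..b+1} \<Longrightarrow> w x - \<phi> x \<le> w z - \<phi> z"
    using continuous_attains_sup[of "{a..b+1}" "\<lambda>x. w x - \<phi> x"] ab by auto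
  have "w a - \<phi> a < w b - \<phi> b"
    using expN' g_def ab by (simp add: \<phi>_def algebra_simps) (smt (verit) exp_gt_zero)
  then have za: "z \<noteq> a" using z(2)[of b] ab by auto
  have "w (b + 1) - \<phi> (b + 1) < w b - \<phi> b"
  proof -
    have "\<phi> (b + 1) = R' * b + R' + 2 * M"
      unfolding \<phi>_def expN[symmetric] by (simp add: algebra_simps)
    moreover have "\<phi> b < R' * b + 1"
      unfolding \<phi>_def using N0 by simp
    ultimately show ?thesis using M by simp
  qed
  then have zb: "z \<noteq> b + 1" using z(2)[of b] ab by auto
  have "\<forall>\<^sub>F y in nhds z. y \<in> {a<..<b+1}"
    using z(1) za zb by (intro eventually_nhds_in_open) auto
  then have "\<forall>\<^sub>F y in nhds z. w y - \<phi> y \<le> w z - \<phi> z"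
    by (rule eventually_mono) (use z in auto)
  from viscosity_subsolutionD_real[OF sub der contG this]
  have "F z (G z) \<le> 0" .
  moreover have "N * exp (N * (z - b - 1 / 2)) > 0" using N0 by simp
  then have "G z > R" using R'(1) by (simp add: G_def)
  ultimately show False using R[of "G z" z] by simp
qed

text \<open>Decreases of w are increases of its reflection. \<open>R\<close> depends on F alone,
  which makes the estimate uniform over families of subsolutions.\<close>

lemma coercive_subsolution_lipschitz:
  fixes w :: "real \<Rightarrow> real"
  assumes cont: "continuous_on UNIV w" and sub: "viscosity_subsolution UNIV F w"
    and R: "\<And>x d. R < \<bar>d\<bar> \<Longrightarrow> 0 < F x d"
  shows "\<bar>w x - w y\<bar> \<le> R * \<bar>x - y\<bar>"
proof -
  have 1: "w b - w a \<le> R * (b - a)" if "a < b" for a b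
    by (rule subsolution_increase_le[OF cont sub _ that]) (use R in auto)
  have "w (- (- a)) - w (- (- b)) \<le> R * ((- a) - (- b))" if "a < b" for a b
    using that R
    by (intro subsolution_increase_le[OF _ viscosity_subsolution_reflect[OF sub]])
      (auto intro!: continuous_intros continuous_on_compose2[OF cont])
  then have 2: "w a - w b \<le> R * (b - a)" if "a < b" for a b
    using that by simp
  have "\<bar>w b - w a\<bar> \<le> R * (b - a)" if "a < b" for a b
    unfolding abs_le_iff using 1[OF that] 2[OF that] by simp
  from this[of x y] this[of y x] show ?thesis
    by (cases x y rule: linorder_cases) (auto simp: abs_minus_commute)
qed

section \<open>Comparison at a local maximum, and stability of subsolutions\<close>

lemma lipschitz_imp_continuous_on:
  fixes f :: "real \<Rightarrow> real"
  assumes "\<And>x y. \<bar>f x - f y\<bar> \<le> K * \<bar>x - y\<bar>"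
  shows "continuous_on S f"
proof (rule lipschitz_on_continuous_on[of K], rule lipschitz_onI)
  show "K \<ge> 0" using assms[of 0 1] by simp
qed (use assms in \<open>simp add: dist_real_def\<close>)

text \<open>Doubling of variables tests the two functions at nearby points with almost equal slopes
  N (x - y). Since w is Lipschitz these slopes stay bounded, and a limit point is a common slope at
  x0 itself, although u and w need not be differentiable there.\<close>

lemma local_max_comparison:
  fixes u w :: "real \<Rightarrow> real"
  assumes cF1: "continuous_on UNIV (\<lambda>(x, d). F1 x d)" and cF2: "continuous_on UNIV (\<lambda>(x, d). F2 x d)"
    and cu: "continuous_on UNIV u" and lip: "\<And>x y. \<bar>w x - w y\<bar> \<le> K * \<bar>x - y\<bar>"
    and sub: "viscosity_subsolution UNIV F1 u" and sup: "viscosity_supersolution UNIV F2 w"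
    and mx: "\<forall>\<^sub>F y in nhds x0. u y - w y \<le> u x0 - w x0"
  shows "\<exists>P. F1 x0 P \<le> 0 \<and> 0 \<le> F2 x0 P"
proof -
  have K0: "K \<ge> 0" using lip[of 0 1] by simp
  have cw: "continuous_on UNIV w" by (rule lipschitz_imp_continuous_on[OF lip])
  from mx obtain r0 where r0: "r0 > 0" "\<And>y. \<bar>y - x0\<bar> < r0 \<Longrightarrow> u y - w y \<le> u x0 - w x0"
    unfolding eventually_nhds_metric dist_real_def by blast
  define r where "r = r0 / 2"
  have r: "r > 0" "\<And>y. \<bar>y - x0\<bar> \<le> r \<Longrightarrow> u y - w y \<le> u x0 - w x0"
    using r0 by (auto simp: r_def)
  define I where "I = {x0 - r..x0 + r}"
  define N where "N = (\<lambda>n. real (Suc n))"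
  have N0: "N n > 0" for n by (simp add: N_def)
  \<comment> \<open>The term (x - x0)^2 singles out x0 among possibly many maxima of u - w; it
    changes the slope of u only by 2 (X - x0), which tends to zero.\<close>
  have "\<exists>x y. x \<in> I \<and> y \<in> I \<and> (\<forall>x'\<in>I. \<forall>y'\<in>I. u x' - w y' - N n * (x' - y')\<^sup>2 / 2 - (x' - x0)\<^sup>2
        \<le> u x - w y - N n * (x - y)\<^sup>2 / 2 - (x - x0)\<^sup>2)" for n
  proof -
    have "compact (I \<times> I)" "I \<times> I \<noteq> {}" using r by (auto simp: I_def intro: compact_Times)
    moreover have "continuous_on (I \<times> I) (\<lambda>z. u (fst z) - w (snd z) - N n * (fst z - snd z)\<^sup>2 / 2 - (fst z - x0)\<^sup>2)"
      by (intro continuous_intros continuous_on_compose2[OF cu] continuous_on_compose2[OF cw]) auto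
    ultimately obtain z where "z \<in> I \<times> I" "\<And>z'. z' \<in> I \<times> I \<Longrightarrow>
        u (fst z') - w (snd z') - N n * (fst z' - snd z')\<^sup>2 / 2 - (fst z' - x0)\<^sup>2
        \<le> u (fst z) - w (snd z) - N n * (fst z - snd z)\<^sup>2 / 2 - (fst z - x0)\<^sup>2"
      using continuous_attains_sup[of "I \<times> I"] by blast
    then show ?thesis
      by (intro exI[of _ "fst z"] exI[of _ "snd z"]) force
  qed
  then obtain X Y where XI: "\<And>n. X n \<in> I" and YI: "\<And>n. Y n \<in> I"
    and mxn: "\<And>n x' y'. x' \<in> I \<Longrightarrow> y' \<in> I \<Longrightarrow> u x' - w y' - N n * (x' - y')\<^sup>2 / 2 - (x' - x0)\<^sup>2
        \<le> u (X n) - w (Y n) - N n * (X n - Y n)\<^sup>2 / 2 - (X n - x0)\<^sup>2"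
    by metis
  define p where "p = (\<lambda>n. N n * (X n - Y n))"
  \<comment> \<open>Comparing (X, Y) with the competitor (X, X) bounds the quadratic penalty by K |X
    - Y|.\<close>
  have pb: "\<bar>p n\<bar> \<le> 2 * K" for n
  proof -
    have "N n * (X n - Y n)\<^sup>2 / 2 \<le> w (X n) - w (Y n)"
      using mxn[OF XI XI, of n n n] by simp
    also have "\<dots> \<le> K * \<bar>X n - Y n\<bar>" using lip[of "X n" "Y n"] by simp
    finally have "\<bar>X n - Y n\<bar> * (N n * \<bar>X n - Y n\<bar>) \<le> \<bar>X n - Y n\<bar> * (2 * K)"
      by (simp add: power2_eq_square algebra_simps abs_mult_self_eq)
    then have "X n \<noteq> Y n \<Longrightarrow> N n * \<bar>X n - Y n\<bar> \<le> 2 * K"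
      by (subst (asm) mult_le_cancel_left) auto
    then show ?thesis using K0 by (cases "X n = Y n") (use N0[of n] in \<open>auto simp: p_def abs_mult\<close>)
  qed
  have XY: "\<bar>X n - Y n\<bar> \<le> 2 * K * inverse (N n)" for n
  proof -
    have "N n * \<bar>X n - Y n\<bar> \<le> 2 * K" using pb[of n] N0[of n] by (simp add: p_def abs_mult)
    then show ?thesis using N0[of n] by (simp add: field_simps)
  qed
  have X0: "(X n - x0)\<^sup>2 \<le> K * \<bar>X n - Y n\<bar>" for n
  proof -
    have "u x0 - w x0 \<le> u (X n) - w (Y n) - N n * (X n - Y n)\<^sup>2 / 2 - (X n - x0)\<^sup>2"
      using mxn[of x0 x0 n] r by (simp add: I_def)
    moreover have "N n * (X n - Y n)\<^sup>2 / 2 \<ge> 0" using N0[of n] by simp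
    moreover have "u (X n) - w (X n) \<le> u x0 - w x0"
      using r(2)[of "X n"] XI[of n] by (simp add: I_def abs_le_iff)
    moreover have "w (X n) - w (Y n) \<le> K * \<bar>X n - Y n\<bar>" using lip[of "X n" "Y n"] by simp
    ultimately show ?thesis by linarith
  qed
  have "(\<lambda>n. 2 * K * inverse (N n)) \<longlonglongrightarrow> 0"
    unfolding N_def by (rule tendsto_mult_right_zero[OF LIMSEQ_inverse_real_of_nat])
  then have lXY: "(\<lambda>n. X n - Y n) \<longlonglongrightarrow> 0"
    by (rule Lim_null_comparison[rotated]) (use XY in auto)
  then have "(\<lambda>n. K * \<bar>X n - Y n\<bar>) \<longlonglongrightarrow> 0"
    by (intro tendsto_mult_right_zero tendsto_rabs_zero)
  then have "(\<lambda>n. (X n - x0)\<^sup>2) \<longlonglongrightarrow> 0"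
    by (rule Lim_null_comparison[rotated]) (use X0 in auto)
  then have "(\<lambda>n. X n - x0) \<longlonglongrightarrow> 0" by simp
  then have lX: "X \<longlonglongrightarrow> x0" by (simp add: LIM_zero_iff)
  have lY: "Y \<longlonglongrightarrow> x0"
    using tendsto_diff[OF lX lXY] by simp
  have "bounded (range p)" using pb by (auto simp: bounded_iff)
  then obtain P s where s: "strict_mono s" "(p \<circ> s) \<longlonglongrightarrow> P"
    using bounded_imp_convergent_subsequence[of p] by blast
  have ev: "\<forall>\<^sub>F n in sequentially. X n \<in> {x0 - r<..<x0 + r} \<and> Y n \<in> {x0 - r<..<x0 + r}"
    using r(1) by (intro eventually_conj topological_tendstoD[OF lX] topological_tendstoD[OF lY]) auto
  have F1n: "F1 (X n) (p n + 2 * (X n - x0)) \<le> 0" if "X n \<in> {x0 - r<..<x0 + r}" for n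
  proof -
    have "\<forall>\<^sub>F y in nhds (X n). y \<in> {x0 - r<..<x0 + r}"
      using that by (intro eventually_nhds_in_open) auto
    then have ev: "\<forall>\<^sub>F y in nhds (X n). u y - (N n * (y - Y n)\<^sup>2 / 2 + (y - x0)\<^sup>2)
        \<le> u (X n) - (N n * (X n - Y n)\<^sup>2 / 2 + (X n - x0)\<^sup>2)"
    proof (rule eventually_mono)
      fix y assume "y \<in> {x0 - r<..<x0 + r}"
      then have "y \<in> I" by (auto simp: I_def)
      from mxn[OF this YI, of n n] show "u y - (N n * (y - Y n)\<^sup>2 / 2 + (y - x0)\<^sup>2)
        \<le> u (X n) - (N n * (X n - Y n)\<^sup>2 / 2 + (X n - x0)\<^sup>2)" by simp
    qed
    have dv: "((\<lambda>y. N n * (y - Y n)\<^sup>2 / 2 + (y - x0)\<^sup>2) has_real_derivative N n * (y - Y n) + 2 * (y - x0)) (at y)" for y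
      by (auto intro!: derivative_eq_intros)
    have cv: "continuous_on UNIV (\<lambda>y. N n * (y - Y n) + 2 * (y - x0))" by (intro continuous_intros)
    show ?thesis
      unfolding p_def using viscosity_subsolutionD_real[OF sub dv cv ev] .
  qed
  have F2n: "0 \<le> F2 (Y n) (p n)" if "Y n \<in> {x0 - r<..<x0 + r}" for n
  proof -
    have "\<forall>\<^sub>F y in nhds (Y n). y \<in> {x0 - r<..<x0 + r}"
      using that by (intro eventually_nhds_in_open) auto
    then have ev: "\<forall>\<^sub>F y in nhds (Y n). w y - (- (N n * (X n - y)\<^sup>2 / 2))
        \<ge> w (Y n) - (- (N n * (X n - Y n)\<^sup>2 / 2))"
    proof (rule eventually_mono)
      fix y assume "y \<in> {x0 - r<..<x0 + r}"
      then have "y \<in> I" by (auto simp: I_def)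
      from mxn[OF XI this, of n n] show "w y - (- (N n * (X n - y)\<^sup>2 / 2))
        \<ge> w (Y n) - (- (N n * (X n - Y n)\<^sup>2 / 2))" by simp
    qed
    have dv: "((\<lambda>y. - (N n * (X n - y)\<^sup>2 / 2)) has_real_derivative N n * (X n - y)) (at y)" for y
      by (auto intro!: derivative_eq_intros simp: field_simps)
    have cv: "continuous_on UNIV (\<lambda>y. N n * (X n - y))" by (intro continuous_intros)
    show ?thesis
      unfolding p_def using viscosity_supersolutionD_real[OF sup dv cv ev] .
  qed
  have evs: "\<forall>\<^sub>F n in sequentially. X (s n) \<in> {x0 - r<..<x0 + r} \<and> Y (s n) \<in> {x0 - r<..<x0 + r}"
    using eventually_subseq[OF s(1) ev] .
  have lXs: "(\<lambda>n. X (s n)) \<longlonglongrightarrow> x0" and lYs: "(\<lambda>n. Y (s n)) \<longlonglongrightarrow> x0"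
    using LIMSEQ_subseq_LIMSEQ[OF lX s(1)] LIMSEQ_subseq_LIMSEQ[OF lY s(1)] by (auto simp: o_def)
  have lp: "(\<lambda>n. p (s n)) \<longlonglongrightarrow> P" using s(2) by (simp add: o_def)
  have "(\<lambda>n. p (s n) + 2 * (X (s n) - x0)) \<longlonglongrightarrow> P + 2 * (x0 - x0)"
    by (intro tendsto_intros lp lXs)
  then have "(\<lambda>n. p (s n) + 2 * (X (s n) - x0)) \<longlonglongrightarrow> P" by simp
  then have l1: "(\<lambda>n. F1 (X (s n)) (p (s n) + 2 * (X (s n) - x0))) \<longlonglongrightarrow> F1 x0 P"
    using continuous_on_tendsto_compose[OF cF1 tendsto_Pair[OF lXs]] by auto
  have l2: "(\<lambda>n. F2 (Y (s n)) (p (s n))) \<longlonglongrightarrow> F2 x0 P"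
    using continuous_on_tendsto_compose[OF cF2 tendsto_Pair[OF lYs lp]] by auto
  have "F1 x0 P \<le> 0"
    by (rule tendsto_upperbound[OF l1]) (use evs F1n in \<open>auto elim!: eventually_mono\<close>)
  moreover have "0 \<le> F2 x0 P"
    by (rule tendsto_lowerbound[OF l2]) (use evs F2n in \<open>auto elim!: eventually_mono\<close>)
  ultimately show ?thesis by blast
qed

text \<open>The approximation \<open>w\<close> may depend on x0: it has to be almost as large as u
  at x0 only, and the inequality may degrade linearly away from x0, because the perturbed maximum
  points converge to x0. A supremum of subsolutions needs this form, its members being close to it
  at one point only; uniform limits are the case K = 0.\<close>

lemma viscosity_subsolution_stable:
  fixes u :: "real \<Rightarrow> real"
  assumes cF: "continuous_on UNIV (\<lambda>(x, d). F x d)"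
    and approx: "\<And>x0 e. 0 < e \<Longrightarrow> \<exists>w F'. continuous_on UNIV w \<and> viscosity_subsolution UNIV F' w \<and>
        w x0 \<ge> u x0 - e \<and>
        (\<forall>x. \<bar>x - x0\<bar> \<le> 1 \<longrightarrow> w x \<le> u x + e \<and> (\<forall>d. F x d \<le> F' x d + e + K * \<bar>x - x0\<bar>))"
  shows "viscosity_subsolution UNIV F u"
  unfolding viscosity_subsolution_def
proof (intro allI impI ballI)
  fix \<phi> G :: "real \<Rightarrow> real" and x0 :: real
  assume C: "C1_test UNIV \<phi> G" and m: "\<forall>\<^sub>F y in nhds x0. u y - \<phi> y \<le> u x0 - \<phi> x0"
  have der: "(\<phi> has_real_derivative G x) (at x)" for x using C by (auto simp: C1_test_def)
  have cG: "continuous_on UNIV G" using C by (auto simp: C1_test_def)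
  have c\<phi>: "continuous_on UNIV \<phi>"
    using der by (meson DERIV_continuous_on UNIV_I has_field_derivative_at_within)
  from m obtain r0 where r0: "r0 > 0" "\<And>y. \<bar>y - x0\<bar> < r0 \<Longrightarrow> u y - \<phi> y \<le> u x0 - \<phi> x0"
    unfolding eventually_nhds_metric dist_real_def by blast
  define r where "r = min 1 (r0 / 2)"
  have r: "0 < r" "r \<le> 1" "\<And>y. \<bar>y - x0\<bar> \<le> r \<Longrightarrow> u y - \<phi> y \<le> u x0 - \<phi> x0"
    using r0 by (auto simp: r_def)
  define e where "e = (\<lambda>n. inverse (real (Suc n)))"
  have e0: "e n > 0" for n by (simp add: e_def)
  have le: "e \<longlonglongrightarrow> 0" unfolding e_def by (rule LIMSEQ_inverse_real_of_nat)
  have "\<forall>n. \<exists>w F'. continuous_on UNIV w \<and> viscosity_subsolution UNIV F' w \<and> w x0 \<ge> u x0 - e n \<and>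
        (\<forall>x. \<bar>x - x0\<bar> \<le> 1 \<longrightarrow> w x \<le> u x + e n \<and> (\<forall>d. F x d \<le> F' x d + e n + K * \<bar>x - x0\<bar>))"
    using approx e0 by blast
  then obtain w F' where cw: "\<And>n. continuous_on UNIV (w n)"
    and sub: "\<And>n. viscosity_subsolution UNIV (F' n) (w n)"
    and wx0: "\<And>n. w n x0 \<ge> u x0 - e n"
    and wu: "\<And>n x. \<bar>x - x0\<bar> \<le> 1 \<Longrightarrow> w n x \<le> u x + e n"
    and FF: "\<And>n x d. \<bar>x - x0\<bar> \<le> 1 \<Longrightarrow> F x d \<le> F' n x d + e n + K * \<bar>x - x0\<bar>"
    by metis
  have "\<exists>x\<in>{x0-r..x0+r}. \<forall>y\<in>{x0-r..x0+r}. w n y - \<phi> y - (y - x0)\<^sup>2 \<le> w n x - \<phi> x - (x - x0)\<^sup>2" for n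
    by (rule continuous_attains_sup)
      (use r in \<open>auto intro!: continuous_intros continuous_on_subset[OF cw] continuous_on_subset[OF c\<phi>]\<close>)
  then obtain X where XI: "\<And>n. X n \<in> {x0-r..x0+r}"
    and mxn: "\<And>n y. y \<in> {x0-r..x0+r} \<Longrightarrow> w n y - \<phi> y - (y - x0)\<^sup>2 \<le> w n (X n) - \<phi> (X n) - (X n - x0)\<^sup>2"
    by metis
  have Xr: "\<bar>X n - x0\<bar> \<le> r" for n using XI[of n] by auto
  \<comment> \<open>The penalty (y - x0)^2 makes the maximum strict, so errors \<open>e n\<close> in
    the values at x0 and \<open>X n\<close> move the maximum point by at most the square root of 2
    \<open>e n\<close>.\<close>
  have X0: "(X n - x0)\<^sup>2 \<le> 2 * e n" for n
    using mxn[of x0 n] r(1,2) wx0[of n] wu[of "X n" n] r(3)[OF Xr[of n]] Xr[of n] by simp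
  have "(\<lambda>n. 2 * e n) \<longlonglongrightarrow> 0" using tendsto_mult_right_zero[OF le] .
  then have "(\<lambda>n. (X n - x0)\<^sup>2) \<longlonglongrightarrow> 0"
    by (rule Lim_null_comparison[rotated]) (use X0 in auto)
  then have "(\<lambda>n. X n - x0) \<longlonglongrightarrow> 0" by simp
  then have lX: "X \<longlonglongrightarrow> x0" by (simp add: LIM_zero_iff)
  have ev: "\<forall>\<^sub>F n in sequentially. X n \<in> {x0 - r<..<x0 + r}"
    using r(1) by (intro topological_tendstoD[OF lX]) auto
  have Fn: "F (X n) (G (X n) + 2 * (X n - x0)) \<le> e n + K * \<bar>X n - x0\<bar>" if "X n \<in> {x0 - r<..<x0 + r}" for n
  proof -
    have "\<forall>\<^sub>F y in nhds (X n). y \<in> {x0 - r<..<x0 + r}"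
      using that by (intro eventually_nhds_in_open) auto
    then have ev: "\<forall>\<^sub>F y in nhds (X n). w n y - (\<phi> y + (y - x0)\<^sup>2) \<le> w n (X n) - (\<phi> (X n) + (X n - x0)\<^sup>2)"
    proof (rule eventually_mono)
      fix y assume "y \<in> {x0 - r<..<x0 + r}"
      then have "y \<in> {x0-r..x0+r}" by auto
      from mxn[OF this, of n] show "w n y - (\<phi> y + (y - x0)\<^sup>2) \<le> w n (X n) - (\<phi> (X n) + (X n - x0)\<^sup>2)" by simp
    qed
    have dv: "((\<lambda>y. \<phi> y + (y - x0)\<^sup>2) has_real_derivative G y + 2 * (y - x0)) (at y)" for y
      by (auto intro!: derivative_eq_intros der)
    have cv: "continuous_on UNIV (\<lambda>y. G y + 2 * (y - x0))" by (intro continuous_intros cG)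
    have "F' n (X n) (G (X n) + 2 * (X n - x0)) \<le> 0"
      using viscosity_subsolutionD_real[OF sub dv cv ev] .
    with FF[of "X n" "G (X n) + 2 * (X n - x0)" n] Xr[of n] r show ?thesis by simp
  qed
  have lG: "(\<lambda>n. G (X n)) \<longlonglongrightarrow> G x0"
    using continuous_on_tendsto_compose[OF cG lX] by auto
  have "(\<lambda>n. G (X n) + 2 * (X n - x0)) \<longlonglongrightarrow> G x0 + 2 * (x0 - x0)"
    by (intro tendsto_intros lG lX)
  then have "(\<lambda>n. G (X n) + 2 * (X n - x0)) \<longlonglongrightarrow> G x0" by simp
  then have "(\<lambda>n. F (X n) (G (X n) + 2 * (X n - x0))) \<longlonglongrightarrow> F x0 (G x0)"
    using continuous_on_tendsto_compose[OF cF tendsto_Pair[OF lX]] by auto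
  moreover have "(\<lambda>n. e n + K * \<bar>X n - x0\<bar>) \<longlonglongrightarrow> 0 + K * \<bar>x0 - x0\<bar>"
    by (intro tendsto_intros le lX)
  ultimately have "F x0 (G x0) \<le> 0 + K * \<bar>x0 - x0\<bar>"
    by (intro tendsto_le[OF sequentially_bot]) (use ev Fn in \<open>auto elim!: eventually_mono\<close>)
  then show "F x0 (G x0) \<le> 0" by simp
qed

subsection \<open>The discounted problem\<close>

lemma has_derivative_eq_0_eventually_max:
  fixes f :: "real \<Rightarrow> real"
  assumes "(f has_real_derivative l) (at x)" "\<forall>\<^sub>F y in nhds x. f y \<le> f x"
  shows "l = 0"
proof -
  obtain d where "d > 0" "\<And>y. dist y x < d \<Longrightarrow> f y \<le> f x"
    using assms(2) unfolding eventually_nhds_metric by blast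
  then show ?thesis
    by (intro DERIV_local_max[OF assms(1), of d]) (auto simp: dist_real_def abs_minus_commute)
qed

lemma viscosity_subsolution_const:
  fixes F :: "real \<Rightarrow> real \<Rightarrow> real"
  assumes "\<And>x. F x 0 \<le> 0"
  shows "viscosity_subsolution UNIV F (\<lambda>_. c)"
  unfolding viscosity_subsolution_def C1_test_def
proof (intro allI impI ballI)
  fix \<phi> G :: "real \<Rightarrow> real" and x :: real
  assume "(\<forall>x\<in>UNIV. GDERIV \<phi> x :> G x) \<and> continuous_on UNIV G"
    and "\<forall>\<^sub>F y in nhds x. c - \<phi> y \<le> c - \<phi> x"
  then have "- G x = 0"
    by (intro has_derivative_eq_0_eventually_max[of "\<lambda>x. - \<phi> x"]) (auto intro!: derivative_eq_intros)
  then show "F x (G x) \<le> 0" using assms by simp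
qed

text \<open>Passing from v to the primitive p y + v y removes p from the Hamiltonian, so solutions
  for different p can be compared at a common slope.\<close>

lemma viscosity_subsolution_add_linear:
  fixes F :: "real \<Rightarrow> real \<Rightarrow> real"
  assumes "viscosity_subsolution UNIV (\<lambda>y d. F y (p + d)) v"
  shows "viscosity_subsolution UNIV F (\<lambda>y. p * y + v y)"
  unfolding viscosity_subsolution_def C1_test_def
proof (intro allI impI ballI)
  fix \<phi> G :: "real \<Rightarrow> real" and x :: real
  assume C: "(\<forall>x\<in>UNIV. GDERIV \<phi> x :> G x) \<and> continuous_on UNIV G"
    and m: "\<forall>\<^sub>F y in nhds x. p * y + v y - \<phi> y \<le> p * x + v x - \<phi> x"
  have "\<forall>\<^sub>F y in nhds x. v y - (\<phi> y - p * y) \<le> v x - (\<phi> x - p * x)"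
    using m by (rule eventually_mono) simp
  moreover have "((\<lambda>y. \<phi> y - p * y) has_real_derivative G y - p) (at y)" for y
    using C by (auto intro!: derivative_eq_intros)
  ultimately have "F x (p + (G x - p)) \<le> 0"
    using C by (intro viscosity_subsolutionD_real[OF assms]) (auto intro!: continuous_intros)
  then show "F x (G x) \<le> 0" by simp
qed

lemma viscosity_supersolution_add_linear:
  fixes F :: "real \<Rightarrow> real \<Rightarrow> real"
  assumes "viscosity_supersolution UNIV (\<lambda>y d. F y (p + d)) v"
  shows "viscosity_supersolution UNIV F (\<lambda>y. p * y + v y)"
  using viscosity_subsolution_add_linear[of "\<lambda>x d. - F x (- d)" "- p" "\<lambda>y. - v y"] assms
  by (simp add: viscosity_supersolution_minus)

text \<open>Applied with shifts by 1 and -1 to the class in Perron's method, whose supremum is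
  periodic for this reason.\<close>

lemma viscosity_subsolution_translate:
  fixes F :: "real \<Rightarrow> real \<Rightarrow> real"
  assumes "viscosity_subsolution UNIV F w"
  shows "viscosity_subsolution UNIV (\<lambda>y d. F (y + a) d) (\<lambda>y. w (y + a))"
  unfolding viscosity_subsolution_def C1_test_def
proof (intro allI impI ballI)
  fix \<phi> G :: "real \<Rightarrow> real" and x :: real
  assume C: "(\<forall>x\<in>UNIV. GDERIV \<phi> x :> G x) \<and> continuous_on UNIV G"
    and m: "\<forall>\<^sub>F y in nhds x. w (y + a) - \<phi> y \<le> w (x + a) - \<phi> x"
  have "filterlim (\<lambda>y. y - a) (nhds (x + a - a)) (nhds (x + a))"
    by (intro tendsto_diff filterlim_ident tendsto_const)
  then have "\<forall>\<^sub>F y in nhds (x + a). w (y - a + a) - \<phi> (y - a) \<le> w (x + a) - \<phi> x"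
    using eventually_compose_filterlim[OF m, of "\<lambda>y. y - a" "nhds (x + a)"] by simp
  then have "\<forall>\<^sub>F y in nhds (x + a). w y - \<phi> (y - a) \<le> w (x + a) - \<phi> (x + a - a)" by simp
  moreover have "((\<lambda>y. \<phi> (y - a)) has_real_derivative G (y - a)) (at y)" for y
  proof -
    have "((\<lambda>y. y - a) has_real_derivative 1) (at y)" by (auto intro!: derivative_eq_intros)
    from DERIV_chain'[OF this, of \<phi> "G (y - a)"] C show ?thesis by simp
  qed
  ultimately have "F (x + a) (G (x + a - a)) \<le> 0"
    using C by (intro viscosity_subsolutionD_real[OF assms, where G="\<lambda>y. G (y - a)" and \<phi>="\<lambda>y. \<phi> (y - a)"])
      (auto intro!: continuous_intros continuous_on_compose2[of UNIV G])
  then show "F (x + a) (G x) \<le> 0" by simp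
qed

section \<open>One-periodic functions on the line\<close>

lemma periodic_int:
  fixes f :: "real \<Rightarrow> 'b"
  assumes "\<And>y. f (y + 1) = f y"
  shows "f (y + of_int k) = f y"
proof -
  have nat: "f (y + real n) = f y" for y n
  proof (induction n)
    case (Suc n)
    then show ?case using assms[of "y + real n"] by (simp add: algebra_simps)
  qed simp
  show ?thesis
  proof (cases "k \<ge> 0")
    case True
    then show ?thesis using nat[of y "nat k"] by simp
  next
    case False
    then show ?thesis using nat[of "y + of_int k" "nat (- k)"] by simp
  qed
qed

lemma periodic_frac:
  fixes f :: "real \<Rightarrow> 'b"
  assumes "\<And>y. f (y + 1) = f y"
  shows "f (frac y) = f y"
  using periodic_int[of f "frac y" "\<lfloor>y\<rfloor>"] assms by (simp add: frac_def)

lemma periodic_attains_max: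
  fixes f :: "real \<Rightarrow> real"
  assumes "\<And>y. f (y + 1) = f y" "continuous_on UNIV f"
  obtains x where "\<And>y. f y \<le> f x"
proof -
  have "continuous_on {0..1} f" by (rule continuous_on_subset[OF assms(2)]) simp
  moreover have "{0..1::real} \<noteq> {}" by simp
  ultimately obtain x where x: "\<And>y. y \<in> {0..1} \<Longrightarrow> f y \<le> f x"
    using continuous_attains_sup[OF compact_Icc] by blast
  show thesis
  proof (rule that)
    fix y :: real
    have "frac y \<in> {0..1}" by (simp add: less_imp_le frac_lt_1)
    from x[OF this] show "f y \<le> f x" by (simp only: periodic_frac[of f, OF assms(1)])
  qed
qed

section \<open>Perron's method and monotonicity for the discounted equation\<close>

locale periodic_coercive_hamiltonian =
  fixes H :: "real \<Rightarrow> real \<Rightarrow> real"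
  assumes H_continuous: "continuous_on UNIV (\<lambda>(y, p). H y p)"
    and H_periodic: "\<And>y p. H (y + 1) p = H y p"
    and H_coercive: "coercive_snd H"
begin

lemma continuous_on_H [continuous_intros]:
  assumes "continuous_on S f" "continuous_on S g"
  shows "continuous_on S (\<lambda>x. H (f x) (g x))"
  using continuous_on_compose2[OF H_continuous continuous_on_Pair[OF assms]] by auto

lemma H_bounded:
  obtains M where "\<And>y. \<bar>H y p\<bar> \<le> M"
proof -
  have "continuous_on UNIV (\<lambda>y. \<bar>H y p\<bar>)" by (intro continuous_intros)
  moreover have "\<bar>H (y + 1) p\<bar> = \<bar>H y p\<bar>" for y by (simp add: H_periodic)
  ultimately show thesis using periodic_attains_max[of "\<lambda>y. \<bar>H y p\<bar>"] that by blast
qed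

lemma H_large:
  obtains R where "R \<ge> 0" "\<And>y d. R < \<bar>d\<bar> \<Longrightarrow> M < H y (p + d)"
proof -
  obtain b where b: "\<And>d y. b \<le> \<bar>d\<bar> \<Longrightarrow> M + 1 \<le> H y d"
    using H_coercive unfolding coercive_snd_def eventually_at_infinity real_norm_def by blast
  have "M < H y (p + d)" if "\<bar>b\<bar> + \<bar>p\<bar> < \<bar>d\<bar>" for y d
    using b[of "p + d" y] that by linarith
  then show thesis using that[of "\<bar>b\<bar> + \<bar>p\<bar>"] by simp
qed

text \<open>A test function that touches u from below at x0 and violates the inequality there is
  lowered by a parabola, raised by a small \<open>e\<close> and joined to u by a maximum. Near x0 it
  still satisfies the subsolution inequality, farther out nothing changes, and at x0 the value
  grows.\<close>

lemma discounted_bump: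
  fixes u :: "real \<Rightarrow> real"
  assumes \<delta>: "\<delta> > 0" and M: "\<And>y. \<bar>H y p\<bar> \<le> \<delta> * M"
    and cu: "continuous_on UNIV u" and uM: "\<And>y. \<bar>u y\<bar> \<le> M"
    and sub: "viscosity_subsolution UNIV (\<lambda>y d. \<delta> * u y + H y (p + d)) u"
    and nsup: "\<not> viscosity_supersolution UNIV (\<lambda>y d. \<delta> * u y + H y (p + d)) u"
  obtains w x0 where "continuous_on UNIV w" "\<And>y. \<bar>w y\<bar> \<le> M" "u x0 < w x0"
    "viscosity_subsolution UNIV (\<lambda>y d. \<delta> * w y + H y (p + d)) w"
proof -
  from nsup obtain \<phi> G x0 where C: "C1_test UNIV \<phi> G"
    and m: "\<forall>\<^sub>F y in nhds x0. u y - \<phi> y \<ge> u x0 - \<phi> x0"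
    and neg: "\<delta> * u x0 + H x0 (p + G x0) < 0"
    unfolding viscosity_supersolution_def by (auto simp: not_le)
  have der: "(\<phi> has_real_derivative G x) (at x)" for x using C by (auto simp: C1_test_def)
  have cG: "continuous_on UNIV G" using C by (auto simp: C1_test_def)
  have c\<phi>: "continuous_on UNIV \<phi>"
    using der by (meson DERIV_continuous_on UNIV_I has_field_derivative_at_within)
  \<comment> \<open>If u reached M at x0, then \<phi> would have a local maximum there, its slope
    would vanish, and the bound on H would contradict the violated inequality. So there is room to
    raise u.\<close>
  have uM0: "u x0 < M"
  proof (rule ccontr)
    assume "\<not> u x0 < M"
    then have eq: "u x0 = M" using uM[of x0] by simp
    have "\<forall>\<^sub>F y in nhds x0. \<phi> y \<le> \<phi> x0"
      using m
    proof (rule eventually_mono)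
      fix y assume "u x0 - \<phi> x0 \<le> u y - \<phi> y"
      then show "\<phi> y \<le> \<phi> x0" using uM[of y] eq by simp
    qed
    then have "G x0 = 0" by (rule has_derivative_eq_0_eventually_max[OF der])
    then show False using neg M[of x0] eq by simp
  qed
  define \<psi>0 where "\<psi>0 = (\<lambda>y. u x0 + \<phi> y - \<phi> x0 - (y - x0)\<^sup>2)"
  define A where "A = (\<lambda>y. \<delta> * \<psi>0 y + H y (p + (G y - 2 * (y - x0))))"
  have A0: "A x0 < 0" using neg by (simp add: A_def \<psi>0_def)
  have c\<psi>: "continuous_on UNIV \<psi>0" unfolding \<psi>0_def by (intro continuous_intros c\<phi>)
  have cA: "continuous_on UNIV A" unfolding A_def by (intro continuous_intros c\<psi> cG)
  have tA: "(A \<longlongrightarrow> A x0) (nhds x0)" and t\<psi>: "(\<psi>0 \<longlongrightarrow> \<psi>0 x0) (nhds x0)"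
    using cA c\<psi> by (simp_all add: continuous_on_eq_continuous_at isCont_def tendsto_at_iff_tendsto_nhds)
  have "\<forall>\<^sub>F y in nhds x0. A y < A x0 / 2"
    using A0 by (intro order_tendstoD(2)[OF tA]) simp
  moreover have "\<forall>\<^sub>F y in nhds x0. \<psi>0 y < (u x0 + M) / 2"
    using uM0 by (intro order_tendstoD(2)[OF t\<psi>]) (simp add: \<psi>0_def)
  ultimately have "\<forall>\<^sub>F y in nhds x0. u x0 - \<phi> x0 \<le> u y - \<phi> y \<and> A y < A x0 / 2 \<and> \<psi>0 y < (u x0 + M) / 2"
    using m by (intro eventually_conj)
  then obtain s where s: "s > 0" and near: "\<And>y. \<bar>y - x0\<bar> < s \<Longrightarrow>
      u x0 - \<phi> x0 \<le> u y - \<phi> y \<and> A y < A x0 / 2 \<and> \<psi>0 y < (u x0 + M) / 2"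
    unfolding eventually_nhds_metric dist_real_def by blast
  \<comment> \<open>The three entries put the raised function below u at distances between s/2 and s
    from x0, keep its residual \<open>A\<close> + \<delta> e negative, and keep it below M.\<close>
  define e where "e = min (s\<^sup>2 / 4) (min (- A x0 / (2 * \<delta>)) ((M - u x0) / 2))"
  have e: "e > 0" "e \<le> s\<^sup>2 / 4" "e \<le> - A x0 / (2 * \<delta>)" "e \<le> (M - u x0) / 2"
  proof -
    show "e > 0" unfolding e_def using s A0 \<delta> uM0 by (simp add: divide_neg_pos)
    show "e \<le> s\<^sup>2 / 4" "e \<le> - A x0 / (2 * \<delta>)" "e \<le> (M - u x0) / 2"
      unfolding e_def by linarith+
  qed
  have e\<delta>: "\<delta> * e \<le> - A x0 / 2" using e(3) \<delta> by (simp add: field_simps)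
  define \<psi> where "\<psi> = (\<lambda>y. \<psi>0 y + e)"
  have der\<psi>: "(\<psi> has_real_derivative G x - 2 * (x - x0)) (at x)" for x
    unfolding \<psi>_def \<psi>0_def by (auto intro!: derivative_eq_intros der)
  define w where "w = (\<lambda>y. if \<bar>y - x0\<bar> < s then max (u y) (\<psi> y) else u y)"
  have wu: "w y = u y" if "s / 2 \<le> \<bar>y - x0\<bar>" for y
  proof (cases "\<bar>y - x0\<bar> < s")
    case True
    have "(s / 2)\<^sup>2 \<le> \<bar>y - x0\<bar>\<^sup>2" using that s by (intro power_mono) auto
    then have "s\<^sup>2 / 4 \<le> (y - x0)\<^sup>2" by (simp add: power2_eq_square)
    then have "\<psi> y \<le> u y" using near[OF True] e(2) by (simp add: \<psi>_def \<psi>0_def)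
    then show ?thesis by (simp add: w_def)
  qed (simp add: w_def)
  have uw: "u y \<le> w y" for y by (simp add: w_def)
  have wM: "\<bar>w y\<bar> \<le> M" for y
    using uM[of y] near[of y] e(4) by (auto simp: w_def \<psi>_def abs_le_iff)
  have cw: "continuous_on UNIV w"
  proof -
    have "continuous_on ({y. \<bar>y - x0\<bar> < s} \<union> {y. s / 2 < \<bar>y - x0\<bar>}) w"
    proof (rule continuous_on_open_Un)
      have "continuous_on {y. \<bar>y - x0\<bar> < s} (\<lambda>y. max (u y) (\<psi> y))"
        unfolding \<psi>_def by (intro continuous_intros continuous_on_subset[OF cu] continuous_on_subset[OF c\<psi>]) auto
      then show "continuous_on {y. \<bar>y - x0\<bar> < s} w"
        by (rule continuous_on_eq) (simp add: w_def)
      show "continuous_on {y. s / 2 < \<bar>y - x0\<bar>} w"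
        by (rule continuous_on_eq[OF continuous_on_subset[OF cu]]) (auto simp: wu)
    qed (auto intro!: open_Collect_less continuous_intros)
    moreover have "{y. \<bar>y - x0\<bar> < s} \<union> {y. s / 2 < \<bar>y - x0\<bar>} = UNIV" using s by auto
    ultimately show ?thesis by simp
  qed
  have subw: "viscosity_subsolution UNIV (\<lambda>y d. \<delta> * w y + H y (p + d)) w"
    unfolding viscosity_subsolution_def C1_test_def
  proof (intro allI impI ballI)
    fix \<theta> G' :: "real \<Rightarrow> real" and x :: real
    assume C': "(\<forall>x\<in>UNIV. GDERIV \<theta> x :> G' x) \<and> continuous_on UNIV G'"
      and m': "\<forall>\<^sub>F y in nhds x. w y - \<theta> y \<le> w x - \<theta> x"
    show "\<delta> * w x + H x (p + G' x) \<le> 0"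
    proof (cases "w x = u x")
      case True
      have "\<forall>\<^sub>F y in nhds x. u y - \<theta> y \<le> u x - \<theta> x"
        using m'
      proof (rule eventually_mono)
        fix y assume "w y - \<theta> y \<le> w x - \<theta> x"
        then show "u y - \<theta> y \<le> u x - \<theta> x" using uw[of y] True by simp
      qed
      then have "\<delta> * u x + H x (p + G' x) \<le> 0"
        using C' by (intro viscosity_subsolutionD_real[OF sub]) auto
      then show ?thesis using True by simp
    next
      case False
      \<comment> \<open>Here w equals the smooth bump at x and lies above it nearby, so the test
        function has the slope of the bump and the residual of the bump decides.\<close>
      then have xs: "\<bar>x - x0\<bar> < s" and wx: "w x = \<psi> x"
        by (auto simp: w_def max_def split: if_splits)
      have "\<forall>\<^sub>F y in nhds x. y \<in> {y. \<bar>y - x0\<bar> < s}"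
        using xs by (intro eventually_nhds_in_open) (auto intro!: open_Collect_less continuous_intros)
      then have "\<forall>\<^sub>F y in nhds x. \<psi> y - \<theta> y \<le> \<psi> x - \<theta> x"
        using m'
      proof eventually_elim
        case (elim y)
        then have "\<psi> y \<le> w y" by (simp add: w_def)
        then show ?case using elim wx by simp
      qed
      moreover have "((\<lambda>y. \<psi> y - \<theta> y) has_real_derivative (G x - 2 * (x - x0)) - G' x) (at x)"
        using C' by (intro DERIV_diff der\<psi>) auto
      ultimately have "(G x - 2 * (x - x0)) - G' x = 0"
        using has_derivative_eq_0_eventually_max by blast
      then have "\<delta> * w x + H x (p + G' x) = A x + \<delta> * e"
        by (simp add: wx \<psi>_def A_def algebra_simps)
      also have "\<dots> \<le> 0" using near[OF xs] e\<delta> by simp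
      finally show ?thesis .
    qed
  qed
  have "u x0 < w x0" using s e(1) by (simp add: w_def \<psi>_def \<psi>0_def)
  then show thesis using that cw wM subw by blast
qed

text \<open>The bound by \<open>M\<close> is part of the class \<open>S\<close>: from below it makes
  one Lipschitz constant valid for all members, from above it makes the supremum finite. A bump
  would yield a larger member, so the supremum is also a supersolution.\<close>

lemma discounted_solution_exists:
  assumes \<delta>: "\<delta> > 0" and M: "\<And>y. \<bar>H y p\<bar> \<le> \<delta> * M"
  obtains v where "\<And>y. v (y + 1) = v y" "\<And>y. \<bar>v y\<bar> \<le> M" "continuous_on UNIV v"
    "viscosity_subsolution UNIV (\<lambda>y d. \<delta> * v y + H y (p + d)) v"
    "viscosity_supersolution UNIV (\<lambda>y d. \<delta> * v y + H y (p + d)) v"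
proof -
  define S where "S = {w. continuous_on UNIV w \<and> (\<forall>y. \<bar>w y\<bar> \<le> M) \<and>
      viscosity_subsolution UNIV (\<lambda>y d. \<delta> * w y + H y (p + d)) w}"
  have M0: "0 \<le> M"
  proof -
    have "0 \<le> \<delta> * M" using M[of 0] by linarith
    then show ?thesis using \<delta> by (simp add: zero_le_mult_iff)
  qed
  have "(\<lambda>_. - M) \<in> S"
    unfolding S_def using M M0 \<delta>
    by (auto intro!: viscosity_subsolution_const simp: abs_le_iff algebra_simps)
  then have S0: "S \<noteq> {}" by auto
  obtain R where R0: "R \<ge> 0" and R: "\<And>y d. R < \<bar>d\<bar> \<Longrightarrow> \<delta> * M < H y (p + d)"
    using H_large by blast
  have lip: "\<bar>w x - w y\<bar> \<le> R * \<bar>x - y\<bar>" if "w \<in> S" for w x y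
  proof (rule coercive_subsolution_lipschitz)
    show "continuous_on UNIV w" "viscosity_subsolution UNIV (\<lambda>y d. \<delta> * w y + H y (p + d)) w"
      using that by (auto simp: S_def)
    fix x d :: real assume "R < \<bar>d\<bar>"
    moreover have "\<delta> * w x \<ge> \<delta> * (- M)"
      using that \<delta> by (intro mult_left_mono) (auto simp: S_def abs_le_iff minus_le_iff)
    ultimately show "0 < \<delta> * w x + H x (p + d)" using R[of d x] by simp
  qed
  define u where "u = (\<lambda>y. SUP w\<in>S. w y)"
  have bdd: "bdd_above ((\<lambda>w. w y) ` S)" for y
    by (rule bdd_aboveI[of _ M]) (auto simp: S_def abs_le_iff)
  have wu: "w y \<le> u y" if "w \<in> S" for w y
    unfolding u_def by (rule cSUP_upper[OF that bdd])
  have ul: "u y \<le> c" if "\<And>w. w \<in> S \<Longrightarrow> w y \<le> c" for y c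
    unfolding u_def by (rule cSUP_least[OF S0 that])
  have uM: "\<bar>u y\<bar> \<le> M" for y
  proof -
    have "u y \<le> M" by (rule ul) (auto simp: S_def abs_le_iff)
    moreover have "- M \<le> u y" using wu[OF \<open>(\<lambda>_. - M) \<in> S\<close>] by simp
    ultimately show ?thesis by (simp add: abs_le_iff)
  qed
  have u1: "u x \<le> u y + R * \<bar>x - y\<bar>" for x y
  proof (rule ul)
    fix w assume w: "w \<in> S"
    show "w x \<le> u y + R * \<bar>x - y\<bar>" using lip[OF w, of x y] wu[OF w, of y] by simp
  qed
  have cu: "continuous_on UNIV u"
  proof (rule lipschitz_imp_continuous_on)
    show "\<bar>u x - u y\<bar> \<le> R * \<bar>x - y\<bar>" for x y
      using u1[of x y] u1[of y x] by (simp add: abs_le_iff abs_minus_commute)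
  qed
  have per: "u (y + 1) = u y" for y
  proof (rule antisym)
    have "(\<lambda>y. w (y + a)) \<in> S" if "w \<in> S" "a = 1 \<or> a = - 1" for w a
    proof -
      have "H (y + a) = H y" for y
        using that(2) H_periodic[of y] H_periodic[of "y - 1"] by auto
      then show ?thesis
        using that viscosity_subsolution_translate[of "\<lambda>y d. \<delta> * w y + H y (p + d)" w a]
        unfolding S_def by (auto intro!: continuous_on_compose2[of UNIV w] continuous_intros)
    qed
    note tr = this
    show "u (y + 1) \<le> u y"
      by (rule ul) (use wu[OF tr, of _ 1 y] in auto)
    show "u y \<le> u (y + 1)"
      by (rule ul) (use wu[OF tr, of _ "-1" "y + 1"] in auto)
  qed
  have cF: "continuous_on UNIV (\<lambda>(y, d). \<delta> * u y + H y (p + d))"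
    unfolding case_prod_beta by (intro continuous_intros continuous_on_compose2[OF cu]) auto
  have sub: "viscosity_subsolution UNIV (\<lambda>y d. \<delta> * u y + H y (p + d)) u"
  proof (rule viscosity_subsolution_stable[OF cF, where K="2 * \<delta> * R"])
    fix x0 e :: real assume e: "0 < e"
    \<comment> \<open>A member of \<open>S\<close> that is e'-close to u at x0 is within e' + 2 R |x
      - x0| of it elsewhere, both being R-Lipschitz; hence the constant 2 \<delta> R. Dividing by 1
      + \<delta> makes e' and \<delta> e' at most e.\<close>
    define e' where "e' = e / (1 + \<delta>)"
    have e': "e' > 0" "e' \<le> e" "\<delta> * e' \<le> e"
      using e \<delta> by (auto simp: e'_def field_simps)
    obtain w where w: "w \<in> S" "u x0 - e' < w x0"
    proof (atomize_elim, rule ccontr)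
      assume "\<nexists>w. w \<in> S \<and> u x0 - e' < w x0"
      then have "u x0 \<le> u x0 - e'" by (intro ul) (auto simp: not_less)
      then show False using e' by simp
    qed
    show "\<exists>w F'. continuous_on UNIV w \<and> viscosity_subsolution UNIV F' w \<and> u x0 - e \<le> w x0 \<and>
       (\<forall>x. \<bar>x - x0\<bar> \<le> 1 \<longrightarrow> w x \<le> u x + e \<and>
          (\<forall>d. \<delta> * u x + H x (p + d) \<le> F' x d + e + 2 * \<delta> * R * \<bar>x - x0\<bar>))"
    proof (intro exI conjI allI impI)
      show "continuous_on UNIV w" "viscosity_subsolution UNIV (\<lambda>y d. \<delta> * w y + H y (p + d)) w"
        using w(1) by (auto simp: S_def)
      show "u x0 - e \<le> w x0" using w(2) e' by simp
      fix x
      show "w x \<le> u x + e" using wu[OF w(1), of x] e by simp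
      have "u x - w x \<le> e' + 2 * R * \<bar>x - x0\<bar>"
        using u1[of x x0] lip[OF w(1), of x x0] w(2) by (simp add: abs_le_iff)
      then have "\<delta> * (u x - w x) \<le> \<delta> * (e' + 2 * R * \<bar>x - x0\<bar>)"
        using \<delta> by (intro mult_left_mono) auto
      then show "\<delta> * u x + H x (p + d) \<le> \<delta> * w x + H x (p + d) + e + 2 * \<delta> * R * \<bar>x - x0\<bar>" for d
        using e'(3) by (simp add: algebra_simps)
    qed
  qed
  have sup: "viscosity_supersolution UNIV (\<lambda>y d. \<delta> * u y + H y (p + d)) u"
  proof (rule ccontr)
    assume "\<not> ?thesis"
    from discounted_bump[OF \<delta> M cu uM sub this] obtain w x0 where
      "continuous_on UNIV w" "\<And>y. \<bar>w y\<bar> \<le> M" and lt: "u x0 < w x0"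
      and "viscosity_subsolution UNIV (\<lambda>y d. \<delta> * w y + H y (p + d)) w" by blast
    then have "w \<in> S" by (auto simp: S_def)
    from wu[OF this, of x0] lt show False by simp
  qed
  show thesis using that per uM cu sub sup by blast
qed

text \<open>D is not periodic but satisfies D (y + 1) = D y + (q - p). If D b < D a, this strict
  growth forces the maximum on [a - 1, b], and then the minimum on [y1, b + 1], into the
  interior.\<close>

lemma discounted_monotone:
  assumes \<delta>: "\<delta> > 0" and pq: "p < q"
    and per: "\<And>y. vp (y + 1) = vp y" "\<And>y. vq (y + 1) = vq y"
    and lipp: "\<And>x y. \<bar>vp x - vp y\<bar> \<le> K * \<bar>x - y\<bar>"
    and lipq: "\<And>x y. \<bar>vq x - vq y\<bar> \<le> K' * \<bar>x - y\<bar>"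
    and subp: "viscosity_subsolution UNIV (\<lambda>y d. \<delta> * vp y + H y (p + d)) vp"
    and supp: "viscosity_supersolution UNIV (\<lambda>y d. \<delta> * vp y + H y (p + d)) vp"
    and subq: "viscosity_subsolution UNIV (\<lambda>y d. \<delta> * vq y + H y (q + d)) vq"
    and supq: "viscosity_supersolution UNIV (\<lambda>y d. \<delta> * vq y + H y (q + d)) vq"
    and ab: "a \<le> b"
  shows "p * a + vp a - (q * a + vq a) \<ge> p * b + vp b - (q * b + vq b)"
proof (rule ccontr)
  assume nle: "\<not> ?thesis"
  define D where "D = (\<lambda>y. q * y + vq y - (p * y + vp y))"
  have cp: "continuous_on UNIV vp" and cq: "continuous_on UNIV vq"
    using lipschitz_imp_continuous_on lipp lipq by blast+
  have cD: "continuous_on S D" for S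
    unfolding D_def by (intro continuous_intros continuous_on_subset[OF cp] continuous_on_subset[OF cq]) auto
  have Dba: "D b < D a" using nle by (simp add: D_def)
  have "a < b" using ab Dba by (cases "a = b") auto
  have Dint: "D (y + of_int k) = D y + (q - p) * of_int k" for y k
    using periodic_int[of vp y k] periodic_int[of vq y k] per by (simp add: D_def algebra_simps)
  have lipWp: "\<bar>(p * x + vp x) - (p * y + vp y)\<bar> \<le> (\<bar>p\<bar> + K) * \<bar>x - y\<bar>" for x y
  proof -
    have "\<bar>p * (x - y)\<bar> = \<bar>p\<bar> * \<bar>x - y\<bar>" by (rule abs_mult)
    then show ?thesis using lipp[of x y] by (simp add: algebra_simps)
  qed
  have lipWq: "\<bar>(q * x + vq x) - (q * y + vq y)\<bar> \<le> (\<bar>q\<bar> + K') * \<bar>x - y\<bar>" for x y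
  proof -
    have "\<bar>q * (x - y)\<bar> = \<bar>q\<bar> * \<bar>x - y\<bar>" by (rule abs_mult)
    then show ?thesis using lipq[of x y] by (simp add: algebra_simps)
  qed
  have cF: "continuous_on UNIV (\<lambda>(y, d). \<delta> * vp y + H y d)" "continuous_on UNIV (\<lambda>(y, d). \<delta> * vq y + H y d)"
    unfolding case_prod_beta
    by (intro continuous_intros continuous_on_compose2[OF cp] continuous_on_compose2[OF cq]; simp)+
  have cW: "continuous_on UNIV (\<lambda>y. p * y + vp y)" "continuous_on UNIV (\<lambda>y. q * y + vq y)"
    by (intro continuous_intros cp cq)+
  have subWp: "viscosity_subsolution UNIV (\<lambda>y d. \<delta> * vp y + H y d) (\<lambda>y. p * y + vp y)"
    using subp by (rule viscosity_subsolution_add_linear)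
  have supWp: "viscosity_supersolution UNIV (\<lambda>y d. \<delta> * vp y + H y d) (\<lambda>y. p * y + vp y)"
    using supp by (rule viscosity_supersolution_add_linear)
  have subWq: "viscosity_subsolution UNIV (\<lambda>y d. \<delta> * vq y + H y d) (\<lambda>y. q * y + vq y)"
    using subq by (rule viscosity_subsolution_add_linear)
  have supWq: "viscosity_supersolution UNIV (\<lambda>y d. \<delta> * vq y + H y d) (\<lambda>y. q * y + vq y)"
    using supq by (rule viscosity_supersolution_add_linear)
  \<comment> \<open>The primitive for q acts as subsolution and the one for p as supersolution; at a
    common slope the values of H cancel and the discount terms decide.\<close>
  have atmax: "vq x \<le> vp x" if "\<forall>\<^sub>F y in nhds x. D y \<le> D x" for x
  proof -
    have "\<exists>P. \<delta> * vq x + H x P \<le> 0 \<and> 0 \<le> \<delta> * vp x + H x P"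
      by (rule local_max_comparison[OF cF(2,1) cW(2) lipWp subWq supWp])
        (use that in \<open>simp add: D_def\<close>)
    then have "\<delta> * vq x \<le> \<delta> * vp x" by auto
    then show ?thesis using \<delta> by simp
  qed
  have atmin: "vp x \<le> vq x" if "\<forall>\<^sub>F y in nhds x. D x \<le> D y" for x
  proof -
    have "\<forall>\<^sub>F y in nhds x. p * y + vp y - (q * y + vq y) \<le> p * x + vp x - (q * x + vq x)"
      using that by (rule eventually_mono) (simp add: D_def)
    then have "\<exists>P. \<delta> * vp x + H x P \<le> 0 \<and> 0 \<le> \<delta> * vq x + H x P"
      by (rule local_max_comparison[OF cF(1,2) cW(1) lipWq subWp supWq])
    then have "\<delta> * vp x \<le> \<delta> * vq x" by auto
    then show ?thesis using \<delta> by simp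
  qed
  have Da: "D (a - 1) < D a" and Db: "D b < D (b + 1)"
    using Dint[of a "-1"] Dint[of b 1] pq by auto
  have "{a - 1..b} \<noteq> {}" using ab by simp
  from continuous_attains_sup[OF compact_Icc this cD]
  obtain y1 where y1: "y1 \<in> {a - 1..b}" "\<And>y. y \<in> {a - 1..b} \<Longrightarrow> D y \<le> D y1"
    by blast
  have Day1: "D a \<le> D y1" using y1(2)[of a] ab by simp
  then have i1: "y1 \<in> {a - 1<..<b}"
  proof -
    have "y1 \<noteq> a - 1" "y1 \<noteq> b" using Da Dba Day1 by auto
    then show ?thesis using y1(1) by simp
  qed
  then have "\<forall>\<^sub>F y in nhds y1. y \<in> {a - 1<..<b}" by (intro eventually_nhds_in_open) auto
  then have "\<forall>\<^sub>F y in nhds y1. D y \<le> D y1" by (rule eventually_mono) (use y1(2) in auto)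
  then have le1: "D y1 \<le> (q - p) * y1" using atmax[of y1] by (simp add: D_def algebra_simps)
  have "{y1..b + 1} \<noteq> {}" using i1 by simp
  from continuous_attains_inf[OF compact_Icc this cD]
  obtain y2 where y2: "y2 \<in> {y1..b + 1}" "\<And>y. y \<in> {y1..b + 1} \<Longrightarrow> D y2 \<le> D y"
    by blast
  have Dy2b: "D y2 \<le> D b" using y2(2)[of b] i1 by simp
  then have i2: "y2 \<in> {y1<..<b + 1}"
  proof -
    have "y2 \<noteq> y1" "y2 \<noteq> b + 1" using Db Day1 Dba Dy2b by auto
    then show ?thesis using y2(1) by simp
  qed
  then have "\<forall>\<^sub>F y in nhds y2. y \<in> {y1<..<b + 1}" by (intro eventually_nhds_in_open) auto
  then have "\<forall>\<^sub>F y in nhds y2. D y2 \<le> D y" by (rule eventually_mono) (use y2(2) in auto)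
  then have le2: "(q - p) * y2 \<le> D y2" using atmin[of y2] by (simp add: D_def algebra_simps)
  \<comment> \<open>The contradiction is D y1 \<le> (q - p) y1 < (q - p) y2 \<le> D y2 \<le> D b < D
    a \<le> D y1.\<close>
  have "(q - p) * y1 < (q - p) * y2" using i2 pq by simp
  then show False using le1 le2 Dy2b Dba Day1 by linarith
qed

end

subsection \<open>The cell problem\<close>

lemma viscosity_subsolution_add_const:
  "viscosity_subsolution \<Omega> F u \<Longrightarrow> viscosity_subsolution \<Omega> F (\<lambda>x. u x + c)"
  unfolding viscosity_subsolution_def by simp

lemma viscosity_supersolution_add_const:
  "viscosity_supersolution \<Omega> F u \<Longrightarrow> viscosity_supersolution \<Omega> F (\<lambda>x. u x + c)"
  unfolding viscosity_supersolution_def by simp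

lemma viscosity_subsolution_uniform_limit:
  fixes u :: "real \<Rightarrow> real"
  assumes cF: "continuous_on UNIV (\<lambda>(x, d). F x d)"
    and approx: "\<And>e. 0 < e \<Longrightarrow> \<exists>w F'. continuous_on UNIV w \<and> viscosity_subsolution UNIV F' w \<and>
        (\<forall>x. \<bar>w x - u x\<bar> \<le> e) \<and> (\<forall>x d. \<bar>F' x d - F x d\<bar> \<le> e)"
  shows "viscosity_subsolution UNIV F u"
proof (rule viscosity_subsolution_stable[OF cF, where K=0])
  fix x0 e :: real assume "0 < e"
  from approx[OF this] obtain w F' where w: "continuous_on UNIV w" "viscosity_subsolution UNIV F' w"
    "\<And>x. \<bar>w x - u x\<bar> \<le> e" "\<And>x d. \<bar>F' x d - F x d\<bar> \<le> e" by blast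
  have "u x0 - e \<le> w x0" using w(3)[of x0] by linarith
  moreover have "w x \<le> u x + e" for x using w(3)[of x] by linarith
  moreover have "F x d \<le> F' x d + e + 0 * \<bar>x - x0\<bar>" for x d using w(4)[of x d] by linarith
  ultimately show "\<exists>w F'. continuous_on UNIV w \<and> viscosity_subsolution UNIV F' w \<and> u x0 - e \<le> w x0 \<and>
       (\<forall>x. \<bar>x - x0\<bar> \<le> 1 \<longrightarrow> w x \<le> u x + e \<and> (\<forall>d. F x d \<le> F' x d + e + 0 * \<bar>x - x0\<bar>))"
    using w(1,2) by blast
qed

lemma viscosity_supersolution_uniform_limit:
  fixes u :: "real \<Rightarrow> real"
  assumes cF: "continuous_on UNIV (\<lambda>(x, d). F x d)"
    and approx: "\<And>e. 0 < e \<Longrightarrow> \<exists>w F'. continuous_on UNIV w \<and> viscosity_supersolution UNIV F' w \<and>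
        (\<forall>x. \<bar>w x - u x\<bar> \<le> e) \<and> (\<forall>x d. \<bar>F' x d - F x d\<bar> \<le> e)"
  shows "viscosity_supersolution UNIV F u"
  unfolding viscosity_supersolution_minus
proof (rule viscosity_subsolution_uniform_limit)
  show "continuous_on UNIV (\<lambda>(x, d). - F x (- d))"
    unfolding case_prod_beta
    using continuous_on_compose2[OF cF, of UNIV "\<lambda>z. (fst z, - snd z)"]
    by (simp add: continuous_on_minus continuous_on_Pair continuous_on_fst continuous_on_snd continuous_on_id)
  fix e :: real assume "0 < e"
  from approx[OF this] obtain w F' where w: "continuous_on UNIV w" "viscosity_supersolution UNIV F' w"
    "\<And>x. \<bar>w x - u x\<bar> \<le> e" "\<And>x d. \<bar>F' x d - F x d\<bar> \<le> e" by blast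
  show "\<exists>w F'. continuous_on UNIV w \<and> viscosity_subsolution UNIV F' w \<and>
        (\<forall>x. \<bar>w x - - u x\<bar> \<le> e) \<and> (\<forall>x d. \<bar>F' x d - - F x (- d)\<bar> \<le> e)"
  proof (intro exI conjI allI)
    show "continuous_on UNIV (\<lambda>x. - w x)" by (intro continuous_intros w(1))
    show "viscosity_subsolution UNIV (\<lambda>x d. - F' x (- d)) (\<lambda>x. - w x)"
      using w(2) by (simp add: viscosity_supersolution_minus)
    show "\<bar>- w x - - u x\<bar> \<le> e" for x using w(3)[of x] by (simp add: abs_minus_commute)
    show "\<bar>- F' x (- d) - - F x (- d)\<bar> \<le> e" for x d using w(4)[of x "- d"] by (simp add: abs_minus_commute)
  qed
qed

text \<open>On the finite grid i/m convergence is uniform; the Lipschitz bounds extend it to [0, 1)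
  and periodicity to the line. Three errors below e/4 occur: the grid value of f - g, and the change
  of f and of g from the grid point on the left.\<close>

lemma equilipschitz_periodic_uniform:
  fixes f :: "nat \<Rightarrow> real \<Rightarrow> real"
  assumes lim: "\<And>y. (\<lambda>n. f n y) \<longlonglongrightarrow> g y"
    and lipf: "\<And>n x y. \<bar>f n x - f n y\<bar> \<le> R * \<bar>x - y\<bar>" and lipg: "\<And>x y. \<bar>g x - g y\<bar> \<le> R * \<bar>x - y\<bar>"
    and perf: "\<And>n y. f n (y + 1) = f n y" and perg: "\<And>y. g (y + 1) = g y"
    and e: "0 < e"
  shows "\<forall>\<^sub>F n in sequentially. \<forall>y. \<bar>f n y - g y\<bar> \<le> e"
proof -
  have R0: "R \<ge> 0" using lipg[of 0 1] by simp
  obtain m :: nat where m: "m > 0" "R / real m < e / 4"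
  proof -
    obtain m :: nat where "4 * R / e < real m" using reals_Archimedean2 by blast
    then have "4 * R / e < real (Suc m)" by simp
    then have "R / real (Suc m) < e / 4" using e by (simp add: field_simps)
    then show thesis using that[of "Suc m"] by blast
  qed
  have "\<forall>\<^sub>F n in sequentially. \<forall>i\<in>{..m}. \<bar>f n (real i / real m) - g (real i / real m)\<bar> < e / 4"
  proof (rule eventually_ball_finite)
    show "\<forall>i\<in>{..m}. \<forall>\<^sub>F n in sequentially. \<bar>f n (real i / real m) - g (real i / real m)\<bar> < e / 4"
      using tendstoD[OF lim, of "e / 4"] e by (simp add: dist_real_def)
  qed simp
  then show ?thesis
  proof (rule eventually_mono, intro allI)
    fix n and y :: real assume *: "\<forall>i\<in>{..m}. \<bar>f n (real i / real m) - g (real i / real m)\<bar> < e / 4"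
    define x where "x = frac y"
    have x: "0 \<le> x" "x < 1" by (auto simp: x_def frac_lt_1)
    define i where "i = nat \<lfloor>real m * x\<rfloor>"
    have i: "real i \<le> real m * x" "real m * x < real i + 1"
      using x m(1) by (auto simp: i_def)
    have "real i < real m" using i(1) x m(1) by (smt (verit) mult_less_cancel_left2 of_nat_0_less_iff)
    then have "i \<in> {..m}" by simp
    then have "\<bar>f n (real i / real m) - g (real i / real m)\<bar> < e / 4" using * by blast
    moreover have "R * \<bar>x - real i / real m\<bar> < e / 4"
    proof -
      have "x - real i / real m = (real m * x - real i) / real m" using m(1) by (simp add: field_simps)
      also have "\<bar>\<dots>\<bar> \<le> 1 / real m" using i by (simp add: divide_right_mono)
      finally have "R * \<bar>x - real i / real m\<bar> \<le> R * (1 / real m)" using R0 by (rule mult_left_mono)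
      also have "\<dots> < e / 4" using m(2) by simp
      finally show ?thesis .
    qed
    ultimately have "\<bar>f n x - g x\<bar> \<le> e"
      using lipf[of n x "real i / real m"] lipg[of x "real i / real m"] by linarith
    moreover have "f n x = f n y" "g x = g y"
      unfolding x_def by (intro periodic_frac perf perg)+
    ultimately show "\<bar>f n y - g y\<bar> \<le> e" by simp
  qed
qed

text \<open>D y = (q - p) y + b y - a y is nondecreasing with D 0 = 0 and D 1 = q - p. On [0, 1] it
  stays between these values, so b - a lies between -(q - p) y and (q - p) (1 - y).\<close>

lemma periodic_antimono_gap:
  fixes a b :: "real \<Rightarrow> real"
  assumes pq: "p < q" and a: "\<And>y. a (y + 1) = a y" "a 0 = 0" and b: "\<And>y. b (y + 1) = b y" "b 0 = 0"
    and anti: "\<And>x y. x \<le> y \<Longrightarrow> p * x + a x - (q * x + b x) \<ge> p * y + a y - (q * y + b y)"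
  shows "\<bar>a y - b y\<bar> \<le> q - p"
proof -
  define x where "x = frac y"
  have x: "0 \<le> x" "x \<le> 1" by (auto simp: x_def frac_lt_1 less_imp_le)
  have "a 1 = 0" "b 1 = 0" using a(1)[of 0] b(1)[of 0] a(2) b(2) by auto
  then have "(q - p) * x - (q - p) \<le> a x - b x" "a x - b x \<le> (q - p) * x"
    using anti[of 0 x] anti[of x 1] x a(2) b(2) by (auto simp: algebra_simps)
  moreover have "0 \<le> (q - p) * x" using pq x by simp
  moreover have "(q - p) * x \<le> (q - p) * 1" using pq x by (intro mult_left_mono) auto
  then have "(q - p) * x \<le> q - p" by simp
  ultimately have "\<bar>a x - b x\<bar> \<le> q - p" unfolding abs_le_iff by simp
  moreover have "a x = a y" "b x = b y" unfolding x_def by (intro periodic_frac a b)+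
  ultimately show ?thesis by simp
qed

section \<open>Correctors and the effective Hamiltonian\<close>

context periodic_coercive_hamiltonian
begin

lemma cell_solution_lipschitz:
  assumes "cell_solution H p c v"
  obtains R where "R \<ge> 0" "\<And>x y. \<bar>v x - v y\<bar> \<le> R * \<bar>x - y\<bar>"
proof -
  obtain R where R: "R \<ge> 0" "\<And>y d. R < \<bar>d\<bar> \<Longrightarrow> c < H y (p + d)"
    using H_large[of c p] by blast
  have "\<bar>v x - v y\<bar> \<le> R * \<bar>x - y\<bar>" for x y
    by (rule coercive_subsolution_lipschitz[where F="\<lambda>y d. H y (p + d) - c"])
      (use assms R in \<open>auto simp: cell_solution_def viscosity_solution_def\<close>)
  then show thesis using that R(1) by blast
qed

text \<open>At a maximum of v - v', which exists by periodicity, the two equations share the slope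
  \<open>P\<close>. With p = q this makes the constant unique; in general it bounds the difference
  of two effective constants by that of H at slopes q - p apart.\<close>

lemma cell_solutions_touch:
  assumes v: "cell_solution H p c v" and v': "cell_solution H q c' v'"
  obtains x P where "H x (p + P) \<le> c" "c' \<le> H x (q + P)"
proof -
  obtain R where R: "\<And>x y. \<bar>v' x - v' y\<bar> \<le> R * \<bar>x - y\<bar>"
    by (rule cell_solution_lipschitz[OF v'], rule that)
  have cv: "continuous_on UNIV v" "continuous_on UNIV v'"
    and per: "\<And>y. v (y + 1) = v y" "\<And>y. v' (y + 1) = v' y"
    and sub: "viscosity_subsolution UNIV (\<lambda>y d. H y (p + d) - c) v"
    and sup: "viscosity_supersolution UNIV (\<lambda>y d. H y (q + d) - c') v'"
    using v v' by (auto simp: cell_solution_def viscosity_solution_def)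
  have cd: "continuous_on UNIV (\<lambda>y. v y - v' y)" by (intro continuous_intros cv)
  have pd: "v (y + 1) - v' (y + 1) = v y - v' y" for y by (simp add: per)
  obtain x where x: "\<And>y. v y - v' y \<le> v x - v' x"
    by (rule periodic_attains_max[of "\<lambda>y. v y - v' y", OF pd cd], rule that)
  have cF: "continuous_on UNIV (\<lambda>(y, d). H y (r + d) - k)" for r k
    unfolding case_prod_beta by (intro continuous_intros)
  have "\<exists>P. H x (p + P) - c \<le> 0 \<and> 0 \<le> H x (q + P) - c'"
    by (rule local_max_comparison[OF cF cF cv(1) R sub sup]) (simp add: x)
  then show thesis using that by auto
qed

lemma cell_constant_unique:
  assumes "cell_solution H p c v" "cell_solution H p c' v'"
  shows "c = c'"
proof (rule antisym)
  obtain x P where "H x (p + P) \<le> c'" "c \<le> H x (p + P)"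
    by (rule cell_solutions_touch[OF assms(2,1)], rule that)
  then show "c \<le> c'" by simp
  obtain x P where "H x (p + P) \<le> c" "c' \<le> H x (p + P)"
    by (rule cell_solutions_touch[OF assms], rule that)
  then show "c' \<le> c" by simp
qed

lemma effective_hamiltonian_eq:
  assumes "cell_solution H p c v"
  shows "effective_hamiltonian H p = c"
  unfolding effective_hamiltonian_def
  using assms cell_constant_unique by (intro the_equality) blast+

text \<open>\<open>M p\<close> and \<open>R p\<close> are uniform in the discount:
  \<open>M p\<close> is chosen to bound |H(., p)| and with it \<delta> v, and coercivity turns this
  into a slope bound. So v may grow like 1/\<delta> while its oscillation stays bounded.\<close>

lemma discounted_family:
  obtains R M :: "real \<Rightarrow> real" and v :: "nat \<Rightarrow> real \<Rightarrow> real \<Rightarrow> real" where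
    "\<And>p. R p \<ge> 0" "\<And>n p y. v n p (y + 1) = v n p y"
    "\<And>n p y. \<bar>inverse (real (Suc n)) * v n p y\<bar> \<le> M p"
    "\<And>n p x y. \<bar>v n p x - v n p y\<bar> \<le> R p * \<bar>x - y\<bar>"
    "\<And>n p. viscosity_subsolution UNIV (\<lambda>y d. inverse (real (Suc n)) * v n p y + H y (p + d)) (v n p)"
    "\<And>n p. viscosity_supersolution UNIV (\<lambda>y d. inverse (real (Suc n)) * v n p y + H y (p + d)) (v n p)"
proof -
  have "\<exists>M. \<forall>y. \<bar>H y p\<bar> \<le> M" for p
    by (rule H_bounded[of p]) blast
  then obtain M where M: "\<And>p y. \<bar>H y p\<bar> \<le> M p" by metis
  have "\<exists>R. R \<ge> 0 \<and> (\<forall>y d. R < \<bar>d\<bar> \<longrightarrow> M p < H y (p + d))" for p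
    by (rule H_large[of "M p" p]) blast
  then obtain R where R0: "\<And>p. R p \<ge> 0" and R: "\<And>p y d. R p < \<bar>d\<bar> \<Longrightarrow> M p < H y (p + d)" by metis
  define \<delta> where "\<delta> n = inverse (real (Suc n))" for n
  have \<delta>: "\<delta> n > 0" for n by (simp add: \<delta>_def)
  define good where "good n p v \<longleftrightarrow> (\<forall>y. v (y + 1) = v y) \<and> (\<forall>y. \<bar>v y\<bar> \<le> M p / \<delta> n) \<and> continuous_on UNIV v \<and>
     viscosity_subsolution UNIV (\<lambda>y d. \<delta> n * v y + H y (p + d)) v \<and>
     viscosity_supersolution UNIV (\<lambda>y d. \<delta> n * v y + H y (p + d)) v" for n p v
  define v where "v n p = (SOME v. good n p v)" for n p
  have "good n p (v n p)" for n p
  proof -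
    have Mn: "\<bar>H y p\<bar> \<le> \<delta> n * (M p / \<delta> n)" for y using M[of _ p] \<delta>[of n] by simp
    obtain w where "\<And>y. w (y + 1) = w y" "\<And>y. \<bar>w y\<bar> \<le> M p / \<delta> n" "continuous_on UNIV w"
      "viscosity_subsolution UNIV (\<lambda>y d. \<delta> n * w y + H y (p + d)) w"
      "viscosity_supersolution UNIV (\<lambda>y d. \<delta> n * w y + H y (p + d)) w"
      by (rule discounted_solution_exists[OF \<delta>[of n] Mn], rule that)
    then have "good n p w" by (simp add: good_def)
    then show ?thesis unfolding v_def by (rule someI[of "good n p"])
  qed
  note g = this[unfolded good_def]
  have per: "v n p (y + 1) = v n p y" for n p y using g[of n p] by simp
  have b: "\<bar>v n p y\<bar> \<le> M p / \<delta> n" for n p y using g[of n p] by simp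
  have cv: "continuous_on UNIV (v n p)" for n p using g[of n p] by simp
  have sub: "viscosity_subsolution UNIV (\<lambda>y d. \<delta> n * v n p y + H y (p + d)) (v n p)" for n p
    using g[of n p] by simp
  have sup: "viscosity_supersolution UNIV (\<lambda>y d. \<delta> n * v n p y + H y (p + d)) (v n p)" for n p
    using g[of n p] by simp
  have b': "\<bar>\<delta> n * v n p y\<bar> \<le> M p" for n p y
    using b[of n p y] \<delta>[of n] by (simp add: abs_mult field_simps)
  have lip: "\<bar>v n p x - v n p y\<bar> \<le> R p * \<bar>x - y\<bar>" for n p x y
  proof (rule coercive_subsolution_lipschitz[OF cv sub])
    fix x d :: real assume "R p < \<bar>d\<bar>"
    then show "0 < \<delta> n * v n p x + H x (p + d)"
      using R[of p d x] b'[of n p x] by linarith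
  qed
  show thesis
    by (rule that[of R v M, OF R0 per b'[unfolded \<delta>_def] lip sub[unfolded \<delta>_def] sup[unfolded \<delta>_def]])
qed

text \<open>Monotonicity compares p and q at the same discount, which is why the subsequence for the
  solutions must not depend on p. The constants may use further subsequences that do:
  \<open>v p\<close> is fixed by then, and its constant is unique.\<close>

lemma monotone_cell_solutions:
  obtains v where "\<And>p. cell_solution H p (effective_hamiltonian H p) (v p)" "\<And>p. v p 0 = 0"
    "\<And>p q x y. p < q \<Longrightarrow> x \<le> y \<Longrightarrow> p * x + v p x - (q * x + v q x) \<ge> p * y + v p y - (q * y + v q y)"
proof -
  obtain R M V where R0: "\<And>p. R p \<ge> 0" and perV: "\<And>n p y. V n p (y + 1) = V n p y"
    and bV: "\<And>n p y. \<bar>inverse (real (Suc n)) * V n p y\<bar> \<le> M p"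
    and lipV: "\<And>n p x y. \<bar>V n p x - V n p y\<bar> \<le> R p * \<bar>x - y\<bar>"
    and subV: "\<And>n p. viscosity_subsolution UNIV (\<lambda>y d. inverse (real (Suc n)) * V n p y + H y (p + d)) (V n p)"
    and supV: "\<And>n p. viscosity_supersolution UNIV (\<lambda>y d. inverse (real (Suc n)) * V n p y + H y (p + d)) (V n p)"
    by (rule discounted_family, rule that)
  define \<delta> where "\<delta> n = inverse (real (Suc n))" for n
  have \<delta>: "\<delta> n > 0" for n by (simp add: \<delta>_def)
  note bV = bV[folded \<delta>_def] and subV = subV[folded \<delta>_def] and supV = supV[folded \<delta>_def]
  define W where "W = (\<lambda>n p y. V n p y - V n p 0)"
  have W0: "W n p 0 = 0" for n p by (simp add: W_def)
  have perW: "W n p (y + 1) = W n p y" for n p y by (simp add: W_def perV)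
  have lipW: "\<bar>W n p x - W n p y\<bar> \<le> R p * \<bar>x - y\<bar>" for n p x y using lipV by (simp add: W_def)
  have antiW: "p * x + W n p x - (q * x + W n q x) \<ge> p * y + W n p y - (q * y + W n q y)"
    if "p < q" "x \<le> y" for n p q x y
    using discounted_monotone[OF \<delta>[of n] that(1) perV perV lipV lipV subV supV subV supV that(2)]
    by (simp add: W_def)
  have gapW: "\<bar>W n p y - W n q y\<bar> \<le> \<bar>p - q\<bar>" for n p q y
  proof (cases p q rule: linorder_cases)
    case less
    then show ?thesis
      using periodic_antimono_gap[OF less perW W0 perW W0 antiW[OF less]] by simp
  next
    case greater
    then show ?thesis
      using periodic_antimono_gap[OF greater perW W0 perW W0 antiW[OF greater]]
      by (simp add: abs_minus_commute)
  qed simp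
  have bW: "\<bar>W n p y\<bar> \<le> R p" for n p y
  proof -
    have "\<bar>W n p (frac y)\<bar> \<le> R p * frac y" using lipW[of n p "frac y" 0] by (simp add: W0)
    also have "\<dots> \<le> R p * 1" by (intro mult_left_mono R0) (simp add: frac_lt_1 less_imp_le)
    finally show ?thesis by (simp add: periodic_frac[of "W n p", OF perW])
  qed
  \<comment> \<open>A diagonal argument over rational pairs (p, y). Dividing by 1 + R p gives the
    common bound 1, although no bound on \<open>W n p\<close> uniform in p is available.\<close>
  obtain k :: "nat \<Rightarrow> nat" where k: "strict_mono k"
    and lk: "\<And>z. z \<in> \<rat> \<times> \<rat> \<Longrightarrow> \<exists>l. (\<lambda>n. W (k n) (fst z) (snd z) / (1 + R (fst z))) \<longlonglongrightarrow> l"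
  proof (rule function_convergent_subsequence[of "\<rat> \<times> \<rat> :: (real \<times> real) set"
        "\<lambda>n z. W n (fst z) (snd z) / (1 + R (fst z))" 1])
    show "countable (\<rat> \<times> \<rat> :: (real \<times> real) set)" by (intro countable_SIGMA countable_rat)
    fix n and z :: "real \<times> real"
    show "norm (W n (fst z) (snd z) / (1 + R (fst z))) \<le> 1"
      using bW[of n "fst z" "snd z"] R0[of "fst z"] by (simp add: field_simps)
  qed blast
  have lk': "convergent (\<lambda>n. W (k n) p y)" if "p \<in> \<rat>" "y \<in> \<rat>" for p y
  proof -
    obtain l where "(\<lambda>n. W (k n) p y / (1 + R p)) \<longlonglongrightarrow> l" using lk[of "(p, y)"] \<open>p \<in> \<rat>\<close> \<open>y \<in> \<rat>\<close> by auto
    from tendsto_mult_right[OF this, of "1 + R p"] show ?thesis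
      using R0[of p] by (auto simp: convergent_def intro: exI)
  qed
  have conv: "convergent (\<lambda>n. W (k n) p y)" for p y
    unfolding Cauchy_convergent_iff[symmetric]
  proof (rule metric_CauchyI)
    fix e :: real assume e: "0 < e"
    obtain p' where p': "p' \<in> \<rat>" "\<bar>p - p'\<bar> < e / 6"
      using Rats_dense_in_real[of "p - e / 6" p] e by force
    \<comment> \<open>\<open>W n p'\<close> has slope at most R p', so this distance costs less than
      e/6, as does replacing p by p'. Two such replacements leave e/3 for the Cauchy property at the
      rational pair.\<close>
    obtain y' where y': "y' \<in> \<rat>" "\<bar>y - y'\<bar> < e / (6 * (1 + R p'))"
      using Rats_dense_in_real[of "y - e / (6 * (1 + R p'))" y] e R0[of p'] by force
    have "R p' * \<bar>y - y'\<bar> \<le> (1 + R p') * \<bar>y - y'\<bar>" by (intro mult_right_mono) auto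
    also have "\<dots> < e / 6" using y'(2) R0[of p'] by (simp add: field_simps)
    finally have Ry: "R p' * \<bar>y - y'\<bar> < e / 6" .
    have close: "\<bar>W n p y - W n p' y'\<bar> < e / 3" for n
      using gapW[of n p y p'] lipW[of n p' y y'] p'(2) Ry by linarith
    have "Cauchy (\<lambda>n. W (k n) p' y')"
      using lk'[OF p'(1) y'(1)] by (simp add: Cauchy_convergent_iff)
    from metric_CauchyD[OF this, of "e / 3"] e obtain N where
      N: "\<And>m n. m \<ge> N \<Longrightarrow> n \<ge> N \<Longrightarrow> \<bar>W (k m) p' y' - W (k n) p' y'\<bar> < e / 3"
      by (auto simp: dist_real_def)
    show "\<exists>N. \<forall>m\<ge>N. \<forall>n\<ge>N. dist (W (k m) p y) (W (k n) p y) < e"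
    proof (intro exI[of _ N] allI impI)
      fix m n assume "N \<le> m" "N \<le> n"
      then show "dist (W (k m) p y) (W (k n) p y) < e"
        using N[of m n] close[of "k m"] close[of "k n"] unfolding dist_real_def by linarith
    qed
  qed
  then obtain v where v: "\<And>p y. (\<lambda>n. W (k n) p y) \<longlonglongrightarrow> v p y"
    unfolding convergent_def by metis
  have v0: "v p 0 = 0" for p using v[of p 0] by (simp add: W0 LIMSEQ_const_iff)
  have perv: "v p (y + 1) = v p y" for p y
    using v[of p "y + 1"] v[of p y] by (simp add: perW LIMSEQ_unique)
  have lipv: "\<bar>v p x - v p y\<bar> \<le> R p * \<bar>x - y\<bar>" for p x y
    by (rule LIMSEQ_le_const2[OF tendsto_rabs[OF tendsto_diff[OF v v]]]) (use lipW in auto)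
  have antiv: "p * x + v p x - (q * x + v q x) \<ge> p * y + v p y - (q * y + v q y)"
    if "p < q" "x \<le> y" for p q x y
  proof (rule LIMSEQ_le)
    show "(\<lambda>n. p * x + W (k n) p x - (q * x + W (k n) q x)) \<longlonglongrightarrow> p * x + v p x - (q * x + v q x)"
      "(\<lambda>n. p * y + W (k n) p y - (q * y + W (k n) q y)) \<longlonglongrightarrow> p * y + v p y - (q * y + v q y)"
      by (intro tendsto_intros v)+
  qed (use antiW[OF that] in auto)
  have "\<exists>c. cell_solution H p c (v p)" for p
  proof -
    \<comment> \<open>\<delta> V is \<delta> W + \<delta> V(0). The first term vanishes with
      \<delta>, and the limit of -\<delta> V(0) is the constant of the cell problem.\<close>
    define c where "c = (\<lambda>n. - \<delta> (k n) * V (k n) p 0)"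
    have "\<bar>c n\<bar> \<le> M p" for n using bV[of "k n" p 0] by (simp add: c_def)
    then have "bounded (range c)" by (auto simp: bounded_iff)
    then obtain c0 s where s: "strict_mono s" "(c \<circ> s) \<longlonglongrightarrow> c0"
      using bounded_imp_convergent_subsequence[of c] by blast
    have ks: "strict_mono (k \<circ> s)" using k s(1) by (rule strict_mono_o)
    have l\<delta>: "(\<lambda>n. \<delta> (k (s n))) \<longlonglongrightarrow> 0"
      using LIMSEQ_subseq_LIMSEQ[OF LIMSEQ_inverse_real_of_nat ks] by (simp add: \<delta>_def o_def)
    have lW: "(\<lambda>n. W (k (s n)) p y) \<longlonglongrightarrow> v p y" for y
      using LIMSEQ_subseq_LIMSEQ[OF v s(1)] by (simp add: o_def)
    have approx: "\<exists>n. (\<forall>y. \<bar>W n p y - v p y\<bar> \<le> e) \<and> (\<forall>y. \<bar>\<delta> n * V n p y + c0\<bar> \<le> e)" if e: "0 < e" for e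
    proof -
      have "\<forall>\<^sub>F n in sequentially. \<forall>y. \<bar>W (k (s n)) p y - v p y\<bar> \<le> e"
        by (rule equilipschitz_periodic_uniform[OF lW lipW lipv perW perv e])
      moreover have "\<forall>\<^sub>F n in sequentially. \<bar>c (s n) - c0\<bar> < e / 2"
        using tendstoD[OF s(2), of "e / 2"] e by (simp add: dist_real_def)
      moreover have "(\<lambda>n. \<delta> (k (s n)) * R p) \<longlonglongrightarrow> 0" using tendsto_mult_left_zero[OF l\<delta>] .
      then have "\<forall>\<^sub>F n in sequentially. \<delta> (k (s n)) * R p < e / 2"
        using e by (intro order_tendstoD(2)) auto
      ultimately have "\<forall>\<^sub>F n in sequentially. (\<forall>y. \<bar>W (k (s n)) p y - v p y\<bar> \<le> e) \<and>
          \<bar>c (s n) - c0\<bar> < e / 2 \<and> \<delta> (k (s n)) * R p < e / 2"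
        by (intro eventually_conj)
      from eventually_happens'[OF sequentially_bot this]
      obtain n where n: "\<forall>y. \<bar>W (k (s n)) p y - v p y\<bar> \<le> e" "\<bar>c (s n) - c0\<bar> < e / 2"
        "\<delta> (k (s n)) * R p < e / 2"
        by (elim exE conjE)
      have "\<bar>\<delta> (k (s n)) * V (k (s n)) p y + c0\<bar> \<le> e" for y
      proof -
        have "\<bar>\<delta> (k (s n)) * W (k (s n)) p y\<bar> \<le> \<delta> (k (s n)) * R p"
          using bW \<delta>[of "k (s n)"] by (simp add: abs_mult)
        moreover have "\<delta> (k (s n)) * V (k (s n)) p y = \<delta> (k (s n)) * W (k (s n)) p y - c (s n)"
          by (simp add: W_def c_def algebra_simps)
        ultimately show ?thesis using n(2,3) by linarith
      qed
      with n(1) show ?thesis by (intro exI[of _ "k (s n)"] conjI allI) auto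
    qed
    have cF: "continuous_on UNIV (\<lambda>(y, d). H y (p + d) - c0)"
      unfolding case_prod_beta by (intro continuous_intros)
    have cW: "continuous_on UNIV (W n p)" for n by (rule lipschitz_imp_continuous_on[OF lipW])
    have subW: "viscosity_subsolution UNIV (\<lambda>y d. \<delta> n * V n p y + H y (p + d)) (W n p)" for n
      using viscosity_subsolution_add_const[OF subV[of n p], of "- V n p 0"] unfolding W_def by simp
    have supW: "viscosity_supersolution UNIV (\<lambda>y d. \<delta> n * V n p y + H y (p + d)) (W n p)" for n
      using viscosity_supersolution_add_const[OF supV[of n p], of "- V n p 0"] unfolding W_def by simp
    have "viscosity_subsolution UNIV (\<lambda>y d. H y (p + d) - c0) (v p)"
    proof (rule viscosity_subsolution_uniform_limit[OF cF])
      fix e :: real assume "0 < e"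
      from approx[OF this]
      obtain n where n: "\<forall>y. \<bar>W n p y - v p y\<bar> \<le> e" "\<forall>y. \<bar>\<delta> n * V n p y + c0\<bar> \<le> e" by (elim exE conjE)
      show "\<exists>w F'. continuous_on UNIV w \<and> viscosity_subsolution UNIV F' w \<and> (\<forall>x. \<bar>w x - v p x\<bar> \<le> e) \<and>
          (\<forall>x d. \<bar>F' x d - (H x (p + d) - c0)\<bar> \<le> e)"
        by (rule exI[of _ "W n p"], rule exI[of _ "\<lambda>y d. \<delta> n * V n p y + H y (p + d)"])
          (use n cW subW in simp)
    qed
    moreover have "viscosity_supersolution UNIV (\<lambda>y d. H y (p + d) - c0) (v p)"
    proof (rule viscosity_supersolution_uniform_limit[OF cF])
      fix e :: real assume "0 < e"
      from approx[OF this]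
      obtain n where n: "\<forall>y. \<bar>W n p y - v p y\<bar> \<le> e" "\<forall>y. \<bar>\<delta> n * V n p y + c0\<bar> \<le> e" by (elim exE conjE)
      show "\<exists>w F'. continuous_on UNIV w \<and> viscosity_supersolution UNIV F' w \<and> (\<forall>x. \<bar>w x - v p x\<bar> \<le> e) \<and>
          (\<forall>x d. \<bar>F' x d - (H x (p + d) - c0)\<bar> \<le> e)"
        by (rule exI[of _ "W n p"], rule exI[of _ "\<lambda>y d. \<delta> n * V n p y + H y (p + d)"])
          (use n cW supW in simp)
    qed
    ultimately have "cell_solution H p c0 (v p)"
      unfolding cell_solution_def viscosity_solution_def
      using perv lipschitz_imp_continuous_on[OF lipv] by simp
    then show ?thesis by blast
  qed
  then have "cell_solution H p (effective_hamiltonian H p) (v p)" for p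
    using effective_hamiltonian_eq by metis
  then show thesis by (rule that[OF _ v0 antiv])
qed

lemma effective_hamiltonian_lipschitz:
  assumes K: "\<And>y d e. \<bar>H y d - H y e\<bar> \<le> K * \<bar>d - e\<bar>"
  shows "\<bar>effective_hamiltonian H p - effective_hamiltonian H q\<bar> \<le> K * \<bar>p - q\<bar>"
proof -
  obtain v where v: "\<And>p. cell_solution H p (effective_hamiltonian H p) (v p)"
    by (rule monotone_cell_solutions, rule that)
  have 1: "effective_hamiltonian H q - effective_hamiltonian H p \<le> K * \<bar>p - q\<bar>" for p q
  proof -
    obtain x P where "H x (p + P) \<le> effective_hamiltonian H p" "effective_hamiltonian H q \<le> H x (q + P)"
      by (rule cell_solutions_touch[OF v v], rule that)
    then show ?thesis using K[of x "p + P" "q + P"] by simp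
  qed
  show ?thesis using 1[of p q] 1[of q p] by (simp add: abs_le_iff abs_minus_commute)
qed

end

subsection \<open>The rate of convergence\<close>

lemma C1_test_separate:
  fixes a b :: "real \<Rightarrow> real"
  assumes a: "\<And>x. (a has_real_derivative a' x) (at x)" "continuous_on UNIV a'"
    and b: "\<And>x. (b has_real_derivative b' x) (at x)" "continuous_on UNIV b'"
  shows "C1_test \<Omega> (\<lambda>z. a (fst z) + b (snd z)) (\<lambda>z. (a' (fst z), b' (snd z)))"
  unfolding C1_test_def gderiv_def
proof (intro conjI ballI)
  fix z :: "real \<times> real"
  have "((\<lambda>z. a (fst z)) has_derivative (\<lambda>h. a' (fst z) * fst h)) (at z)"
    by (rule has_derivative_compose[of fst fst z UNIV a "(*) (a' (fst z))"])
      (use a(1)[of "fst z"] in \<open>auto simp: has_field_derivative_def intro!: derivative_eq_intros\<close>)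
  moreover have "((\<lambda>z. b (snd z)) has_derivative (\<lambda>h. b' (snd z) * snd h)) (at z)"
    by (rule has_derivative_compose[of snd snd z UNIV b "(*) (b' (snd z))"])
      (use b(1)[of "snd z"] in \<open>auto simp: has_field_derivative_def intro!: derivative_eq_intros\<close>)
  ultimately have "((\<lambda>z. a (fst z) + b (snd z)) has_derivative (\<lambda>h. a' (fst z) * fst h + b' (snd z) * snd h)) (at z)"
    by (rule has_derivative_add)
  then show "((\<lambda>z. a (fst z) + b (snd z)) has_derivative (\<lambda>h. inner h (a' (fst z), b' (snd z)))) (at z)"
    by (simp add: inner_prod_def mult.commute)
next
  show "continuous_on \<Omega> (\<lambda>z. (a' (fst z), b' (snd z)))"
    by (intro continuous_intros continuous_on_compose2[OF a(2)] continuous_on_compose2[OF b(2)]) auto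
qed

text \<open>Joint continuity matters because p is one of the variables over which the doubled
  functional is maximized.\<close>

lemma continuous_on_lipschitz_parameter:
  fixes v :: "real \<Rightarrow> real \<Rightarrow> real"
  assumes cv: "\<And>p. continuous_on UNIV (v p)" and v1: "\<And>p q y. \<bar>v p y - v q y\<bar> \<le> \<bar>p - q\<bar>"
  shows "continuous_on UNIV (\<lambda>(p, y). v p y)"
  unfolding continuous_on_eq_continuous_at[OF open_UNIV] isCont_def
proof
  fix z :: "real \<times> real"
  have "((\<lambda>y. \<bar>fst y - fst z\<bar> + \<bar>v (fst z) (snd y) - v (fst z) (snd z)\<bar>) \<longlongrightarrow>
      \<bar>fst z - fst z\<bar> + \<bar>v (fst z) (snd z) - v (fst z) (snd z)\<bar>) (at z)"
    using cv[of "fst z"]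
    by (intro tendsto_intros isCont_tendsto_compose[of "snd z" "v (fst z)"])
      (simp_all add: continuous_on_eq_continuous_at)
  then have "((\<lambda>y. \<bar>fst y - fst z\<bar> + \<bar>v (fst z) (snd y) - v (fst z) (snd z)\<bar>) \<longlongrightarrow> 0) (at z)" by simp
  then have "((\<lambda>y. v (fst y) (snd y) - v (fst z) (snd z)) \<longlongrightarrow> 0) (at z)"
  proof (rule Lim_null_comparison[rotated], intro always_eventually allI)
    fix y :: "real \<times> real"
    show "norm (v (fst y) (snd y) - v (fst z) (snd z)) \<le>
        \<bar>fst y - fst z\<bar> + \<bar>v (fst z) (snd y) - v (fst z) (snd z)\<bar>"
      using v1[of "fst y" "snd y" "fst z"] by simp
  qed
  then show "((\<lambda>(p, y). v p y) \<longlongrightarrow> (case z of (p, y) \<Rightarrow> v p y)) (at z)"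
    by (simp add: case_prod_unfold LIM_zero_iff)
qed

section \<open>Inequalities for the penalization\<close>

lemma abs_le_1_plus_square: "\<bar>a\<bar> \<le> 1 + (a :: real)\<^sup>2"
proof -
  have "0 \<le> (\<bar>a\<bar> - 1)\<^sup>2" by simp
  then have "2 * \<bar>a\<bar> \<le> 1 + a\<^sup>2" by (simp add: power2_eq_square algebra_simps)
  then show ?thesis by linarith
qed

lemma mult_le_square_young:
  fixes a :: real
  assumes "c > 0"
  shows "b * a \<le> a\<^sup>2 / (4 * c) + c * b\<^sup>2"
proof -
  have "0 \<le> (a - 2 * c * b)\<^sup>2 / (4 * c)" using assms by simp
  also have "(a - 2 * c * b)\<^sup>2 / (4 * c) = a\<^sup>2 / (4 * c) + c * b\<^sup>2 - b * a"
    using assms by (simp add: power2_eq_square field_simps)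
  finally show ?thesis by simp
qed

text \<open>By hypothesis \<eta>^2 |h| + (m - \<eta> h)^2/(2 \<alpha>) is minimal at h = 0. The
  parabola has slope -\<eta> m/\<alpha> there and the kink balances slopes up to \<eta>^2. The
  witness \<open>h\<close> moves m to the nearest end of [-\<alpha>\<eta>, \<alpha>\<eta>].\<close>

lemma parabola_kink_slope:
  fixes m :: real
  assumes \<alpha>: "\<alpha> > 0" and \<eta>: "\<eta> > 0"
    and opt: "\<And>h. m\<^sup>2 / (2 * \<alpha>) \<le> \<eta>\<^sup>2 * \<bar>h\<bar> + (m - \<eta> * h)\<^sup>2 / (2 * \<alpha>)"
  shows "\<bar>m\<bar> \<le> \<alpha> * \<eta>"
proof (rule ccontr)
  assume neg: "\<not> \<bar>m\<bar> \<le> \<alpha> * \<eta>"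
  define r where "r = \<bar>m\<bar> - \<alpha> * \<eta>"
  have r: "r > 0" using neg by (simp add: r_def)
  define h where "h = r / \<eta> * sgn m"
  have "0 < \<alpha> * \<eta>" using \<alpha> \<eta> by simp
  then have "m \<noteq> 0" using neg by auto
  then have h1: "\<eta> * \<bar>h\<bar> = r" using r \<eta> by (simp add: h_def abs_mult sgn_if)
  have "\<eta> * h = r * sgn m" using \<eta> by (simp add: h_def)
  then have "m - \<eta> * h = sgn m * (\<alpha> * \<eta>)" by (simp add: r_def sgn_if algebra_simps)
  then have "(m - \<eta> * h)\<^sup>2 = (\<alpha> * \<eta>)\<^sup>2"
    using \<open>m \<noteq> 0\<close> by (simp add: power_mult_distrib sgn_if)
  moreover have "m\<^sup>2 = (r + \<alpha> * \<eta>)\<^sup>2" by (simp add: r_def)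
  moreover have "\<eta>\<^sup>2 * \<bar>h\<bar> = \<eta> * r" using h1 by (simp add: power2_eq_square mult.assoc)
  ultimately have "(r + \<alpha> * \<eta>)\<^sup>2 / (2 * \<alpha>) \<le> \<eta> * r + (\<alpha> * \<eta>)\<^sup>2 / (2 * \<alpha>)"
    using opt[of h] by simp
  then have "(r + \<alpha> * \<eta>)\<^sup>2 \<le> 2 * \<alpha> * (\<eta> * r) + (\<alpha> * \<eta>)\<^sup>2"
    using \<alpha> by (simp add: field_simps)
  then have "r * r \<le> 0" by (simp add: power2_eq_square algebra_simps)
  then show False using r by (simp add: mult_le_0_iff)
qed

text \<open>\<theta> is an accuracy to be sent to zero, \<delta> confines x, N builds a barrier in
  time, \<alpha> enforces the couplings, and \<open>Q\<close> bounds the penalties at a maximum.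
  \<sigma> is just larger than the sum of all errors in the Hamiltonians, which rules out a maximum
  at positive times and costs T \<sigma>; a maximum at t = 0 or s = 0 is decided by the initial
  data.\<close>

lemma doubling_core:
  fixes H :: "real \<Rightarrow> real \<Rightarrow> real" and U W :: "real \<times> real \<Rightarrow> real"
  assumes K: "\<And>x y d e. \<bar>H x d - H y e\<bar> \<le> K * (\<bar>x - y\<bar> + \<bar>d - e\<bar>)"
    and Hb: "\<And>d e. \<bar>Hb d - Hb e\<bar> \<le> K * \<bar>d - e\<bar>"
    and vsup: "\<And>p. viscosity_supersolution UNIV (\<lambda>y d. H y (p + d) - Hb p) (v p)"
    and cv: "\<And>p. continuous_on UNIV (v p)"
    and v1: "\<And>p q y. \<bar>v p y - v q y\<bar> \<le> \<bar>p - q\<bar>" and v0: "\<And>y. \<bar>v 0 y\<bar> \<le> M0"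
    and gL: "\<And>x y. \<bar>g x - g y\<bar> \<le> L * \<bar>x - y\<bar>"
    and \<eta>: "0 < \<eta>" "\<eta> < 1" and \<epsilon>: "\<epsilon> = \<eta>\<^sup>2" and T: "0 < T"
    and U: "viscosity_subsolution (UNIV \<times> {0<..}) (\<lambda>(z, t) (dz, dt). dt + H (z / \<epsilon>) dz) U"
    and W: "viscosity_supersolution (UNIV \<times> {0<..}) (\<lambda>(z, t) (dz, dt). dt + Hb dz) W"
    and cU: "continuous_on (UNIV \<times> {0..T+2}) U" and cW: "continuous_on (UNIV \<times> {0..T+2}) W"
    and B: "\<And>z t. 0 \<le> t \<Longrightarrow> t \<le> T + 2 \<Longrightarrow> \<bar>U (z, t)\<bar> \<le> B" "\<And>z t. 0 \<le> t \<Longrightarrow> t \<le> T + 2 \<Longrightarrow> \<bar>W (z, t)\<bar> \<le> B"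
    and init: "\<And>z. U (z, 0) = g z" "\<And>z. W (z, 0) = g z"
    and t0: "0 \<le> t0" "t0 \<le> T"
    and \<theta>: "0 < \<theta>" "\<theta> < 1" and \<alpha>: "0 < \<alpha>" "\<alpha> \<le> \<theta>" and \<delta>: "0 < \<delta>" and N: "0 < N"
    and Q: "Q = 2 * B + 2 * M0 + 3"
    and e1: "Q < exp (N / 2)" and e2: "exp (- (N / 2)) \<le> \<theta>"
    and d1: "\<delta> * z0\<^sup>2 \<le> \<theta>" and d2: "4 * \<delta> * Q \<le> \<theta>\<^sup>2"
    and a1: "2 * \<alpha> * Q \<le> (\<epsilon> * \<theta>)\<^sup>2" and a2: "2 * \<alpha> * Q < 1"
    and a3: "\<And>z s. 0 \<le> s \<Longrightarrow> s \<le> T + 2 \<Longrightarrow> s\<^sup>2 \<le> 2 * \<alpha> * Q \<Longrightarrow> \<bar>U (z, s) - g z\<bar> \<le> \<theta>"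
      "\<And>z s. 0 \<le> s \<Longrightarrow> s \<le> T + 2 \<Longrightarrow> s\<^sup>2 \<le> 2 * \<alpha> * Q \<Longrightarrow> \<bar>W (z, s) - g z\<bar> \<le> \<theta>"
    and \<sigma>: "\<sigma> = K * (2 * \<eta> + 4 * \<theta>) + \<theta>"
  shows "U (z0, t0) - W (z0, t0) \<le> \<eta> * (L\<^sup>2 + 2 * M0 + 1) + T * \<sigma> + 4 * \<theta>"
proof -
  have K0: "K \<ge> 0" using Hb[of 0 1] by simp
  have M00: "M0 \<ge> 0" using v0[of 0] by linarith
  have B0: "B \<ge> 0" using B(1)[of 0 0] T by simp
  have Q3: "Q \<ge> 3" using Q B0 M00 by simp
  have \<epsilon>0: "0 < \<epsilon>" using \<eta> \<epsilon> by simp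
  have \<epsilon>\<eta>: "\<epsilon> \<le> \<eta>" using \<eta> \<epsilon> by (simp add: power2_eq_square)
  have \<sigma>0: "0 < \<sigma>" using \<sigma> K0 \<eta> \<theta> by (simp add: add_nonneg_pos)
  \<comment> \<open>Up to time T the barrier is at most exp(-N/2) \<le> \<theta>; at T + 1 it is
    exp(N/2) > Q, which keeps t below T + 1. As |t - s| < 1, the range up to T + 2 keeps s inside
    too. Being increasing, it enters the subsolution inequality with the favourable sign.\<close>
  define E where "E t = exp (N * (t - T - 1 / 2))" for t
  have E0: "E t > 0" for t by (simp add: E_def)
  define \<Phi> where "\<Phi> x t y s \<xi> p = U (x, t) - W (y, s) - \<epsilon> * v p \<xi> - (x - y)\<^sup>2 / (2 * \<eta>)
      - (x - y - \<eta> * p)\<^sup>2 / (2 * \<alpha>) - (x - \<epsilon> * \<xi>)\<^sup>2 / (2 * \<alpha>) - (t - s)\<^sup>2 / (2 * \<alpha>)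
      - \<sigma> * t - E t - \<delta> * x\<^sup>2" for x t y s \<xi> p
  \<comment> \<open>|v p| \<le> M0 + |p| is unbounded in p, but \<epsilon> |p| \<le> \<eta> |x - y|
    + \<eta> |m|. Half of the penalties for x - y and m absorbs both terms at the price \<eta> +
    \<alpha>.\<close>
  have upper: "\<Phi> x t y s \<xi> p \<le> U (x, t) - W (y, s) + (\<eta> * M0 + \<eta> + \<alpha>) - (x - y)\<^sup>2 / (4 * \<eta>)
      - (x - y - \<eta> * p)\<^sup>2 / (4 * \<alpha>) - (x - \<epsilon> * \<xi>)\<^sup>2 / (2 * \<alpha>) - (t - s)\<^sup>2 / (2 * \<alpha>)
      - \<sigma> * t - E t - \<delta> * x\<^sup>2" for x t y s \<xi> p
  proof -
    define m where "m = x - y - \<eta> * p"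
    have "\<bar>v p \<xi>\<bar> \<le> M0 + \<bar>p\<bar>" using v1[of p \<xi> 0] v0[of \<xi>] by simp
    then have "- v p \<xi> \<le> M0 + \<bar>p\<bar>" by linarith
    then have "\<epsilon> * (- v p \<xi>) \<le> \<epsilon> * (M0 + \<bar>p\<bar>)" using \<epsilon>0 by (intro mult_left_mono) auto
    moreover have "\<epsilon> * M0 \<le> \<eta> * M0" using \<epsilon>\<eta> M00 by (rule mult_right_mono)
    moreover have "\<epsilon> * \<bar>p\<bar> \<le> \<eta> * \<bar>x - y\<bar> + \<eta> * \<bar>m\<bar>"
    proof -
      have "\<eta> * \<bar>p\<bar> = \<bar>(x - y) - m\<bar>" using \<eta> by (simp add: m_def abs_mult)
      also have "\<dots> \<le> \<bar>x - y\<bar> + \<bar>m\<bar>" by (rule abs_triangle_ineq4)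
      finally have "\<eta> * (\<eta> * \<bar>p\<bar>) \<le> \<eta> * (\<bar>x - y\<bar> + \<bar>m\<bar>)" using \<eta> by (intro mult_left_mono) auto
      then show ?thesis by (simp add: \<epsilon> power2_eq_square algebra_simps)
    qed
    moreover have "\<eta> * \<bar>x - y\<bar> \<le> (x - y)\<^sup>2 / (4 * \<eta>) + \<eta> * \<eta>\<^sup>2"
      using mult_le_square_young[OF \<eta>(1), of \<eta> "\<bar>x - y\<bar>"] by simp
    moreover have "\<eta> * \<bar>m\<bar> \<le> m\<^sup>2 / (4 * \<alpha>) + \<alpha> * \<eta>\<^sup>2"
      using mult_le_square_young[OF \<alpha>(1), of \<eta> "\<bar>m\<bar>"] by simp
    moreover have "\<eta>\<^sup>2 \<le> 1" using \<eta> by (simp add: power_le_one)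
    then have "\<eta> * \<eta>\<^sup>2 \<le> \<eta> * 1" "\<alpha> * \<eta>\<^sup>2 \<le> \<alpha> * 1" using \<eta> \<alpha> by (intro mult_left_mono; simp)+
    moreover have "(x - y)\<^sup>2 / (2 * \<eta>) = (x - y)\<^sup>2 / (4 * \<eta>) + (x - y)\<^sup>2 / (4 * \<eta>)"
      "m\<^sup>2 / (2 * \<alpha>) = m\<^sup>2 / (4 * \<alpha>) + m\<^sup>2 / (4 * \<alpha>)"
      by (simp_all add: field_simps)
    ultimately have "- (\<epsilon> * v p \<xi>) - (x - y)\<^sup>2 / (2 * \<eta>) - m\<^sup>2 / (2 * \<alpha>)
        \<le> \<eta> * M0 + \<eta> + \<alpha> - (x - y)\<^sup>2 / (4 * \<eta>) - m\<^sup>2 / (4 * \<alpha>)"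
      by (simp add: algebra_simps)
    then show ?thesis unfolding \<Phi>_def m_def by linarith
  qed
  \<comment> \<open>Origin of Q = 2 B + 2 M0 + 3: 2 B from U - W, M0 + 2 from \<eta> M0 + \<eta> +
    \<alpha>, and M0 + 1 from the lower bound on \<Phi>.\<close>
  have small: "(x - y)\<^sup>2 / (4 * \<eta>) \<le> Q \<and> (x - y - \<eta> * p)\<^sup>2 / (4 * \<alpha>) \<le> Q \<and>
      (x - \<epsilon> * \<xi>)\<^sup>2 / (2 * \<alpha>) \<le> Q \<and> (t - s)\<^sup>2 / (2 * \<alpha>) \<le> Q \<and> E t \<le> Q \<and> \<delta> * x\<^sup>2 \<le> Q"
    if t: "0 \<le> t" "t \<le> T + 1" and s: "0 \<le> s" "s \<le> T + 2" and low: "- M0 - 1 \<le> \<Phi> x t y s \<xi> p"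
    for x t y s \<xi> p
  proof -
    have "U (x, t) \<le> B" "- W (y, s) \<le> B" using B(1)[of t x] B(2)[of s y] t s by (auto simp: abs_le_iff)
    moreover have "\<eta> * M0 \<le> M0" using \<eta> M00 by (simp add: mult_left_le_one_le)
    moreover have "0 \<le> (x - y)\<^sup>2 / (4 * \<eta>)" "0 \<le> (x - y - \<eta> * p)\<^sup>2 / (4 * \<alpha>)"
      "0 \<le> (x - \<epsilon> * \<xi>)\<^sup>2 / (2 * \<alpha>)" "0 \<le> (t - s)\<^sup>2 / (2 * \<alpha>)" "0 \<le> \<sigma> * t" "0 \<le> \<delta> * x\<^sup>2"
      using \<eta> \<alpha> \<sigma>0 t \<delta> by auto
    moreover have "(x - y)\<^sup>2 / (4 * \<eta>) + (x - y - \<eta> * p)\<^sup>2 / (4 * \<alpha>) + (x - \<epsilon> * \<xi>)\<^sup>2 / (2 * \<alpha>)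
        + (t - s)\<^sup>2 / (2 * \<alpha>) + \<sigma> * t + E t + \<delta> * x\<^sup>2 \<le> Q"
      using upper[of x t y s \<xi> p] low \<eta> \<alpha> \<theta> calculation(1-3) unfolding Q by linarith
    ultimately show ?thesis using E0[of t] by linarith
  qed
  obtain x t y s \<xi> p where t: "0 \<le> t" "t \<le> T + 1" and s: "0 \<le> s" "s \<le> T + 2"
    and mx: "\<And>x' t' y' s' \<xi>' p'. 0 \<le> t' \<Longrightarrow> t' \<le> T + 1 \<Longrightarrow> 0 \<le> s' \<Longrightarrow> s' \<le> T + 2 \<Longrightarrow>
      \<Phi> x' t' y' s' \<xi>' p' \<le> \<Phi> x t y s \<xi> p"
    and low: "- M0 - 1 \<le> \<Phi> x t y s \<xi> p"
  proof -
    have \<Phi>0: "- M0 - 1 \<le> \<Phi> 0 0 0 0 0 0"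
    proof -
      have "\<epsilon> * v 0 0 \<le> \<epsilon> * M0" using v0[of 0] \<epsilon>0 by (intro mult_left_mono) auto
      also have "\<dots> \<le> 1 * M0" using \<epsilon>\<eta> \<eta> M00 by (intro mult_right_mono) auto
      moreover have "E 0 \<le> 1" using T N by (simp add: E_def mult_nonneg_nonpos)
      ultimately show ?thesis by (simp add: \<Phi>_def init)
    qed
    \<comment> \<open>\<rho>0 bounds x, y, \<epsilon> \<xi> and \<eta> p; division by \<epsilon>,
      the smaller of the two scales, bounds all four variables. Outside the box \<Phi> lies below
      its value at the origin, so the maximum over the compact box is global.\<close>
    define \<rho>0 where "\<rho>0 = (1 + Q / \<delta>) + (1 + 4 * \<eta> * Q) + (1 + 4 * \<alpha> * Q) + (1 + 2 * \<alpha> * Q)"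
    define \<rho> where "\<rho> = \<rho>0 / \<epsilon>"
    have \<rho>pos: "0 \<le> Q / \<delta>" "0 \<le> 4 * \<eta> * Q" "0 \<le> 4 * \<alpha> * Q" "0 \<le> 2 * \<alpha> * Q"
      using Q3 \<delta> \<eta> \<alpha> by auto
    have \<rho>: "0 \<le> \<rho>" "\<rho>0 \<le> \<rho>" "\<rho>0 \<le> \<epsilon> * \<rho>" "\<rho>0 \<le> \<eta> * \<rho>"
    proof -
      have "0 \<le> \<rho>0" using \<rho>pos by (simp add: \<rho>0_def)
      then show "0 \<le> \<rho>" using \<epsilon>0 by (simp add: \<rho>_def)
      show 1: "\<rho>0 \<le> \<epsilon> * \<rho>" using \<epsilon>0 by (simp add: \<rho>_def)
      also have "\<dots> \<le> \<eta> * \<rho>" using \<open>0 \<le> \<rho>\<close> \<epsilon>\<eta> by (intro mult_right_mono)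
      finally show "\<rho>0 \<le> \<eta> * \<rho>" .
      also have "\<dots> \<le> 1 * \<rho>" using \<open>0 \<le> \<rho>\<close> \<eta> by (intro mult_right_mono) auto
      finally show "\<rho>0 \<le> \<rho>" by simp
    qed
    have inbox: "\<bar>x\<bar> \<le> \<rho> \<and> \<bar>y\<bar> \<le> \<rho> \<and> \<bar>\<xi>\<bar> \<le> \<rho> \<and> \<bar>p\<bar> \<le> \<rho>"
      if "0 \<le> t" "t \<le> T + 1" "0 \<le> s" "s \<le> T + 2" "- M0 - 1 \<le> \<Phi> x t y s \<xi> p" for x t y s \<xi> p
    proof -
      have "x\<^sup>2 \<le> Q / \<delta>" "(x - y)\<^sup>2 \<le> 4 * \<eta> * Q" "(x - y - \<eta> * p)\<^sup>2 \<le> 4 * \<alpha> * Q" "(x - \<epsilon> * \<xi>)\<^sup>2 \<le> 2 * \<alpha> * Q"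
        using small[OF that] \<delta> \<eta> \<alpha> by (simp_all add: field_simps)
      then have b: "\<bar>x\<bar> \<le> 1 + Q / \<delta>" "\<bar>x - y\<bar> \<le> 1 + 4 * \<eta> * Q" "\<bar>x - y - \<eta> * p\<bar> \<le> 1 + 4 * \<alpha> * Q"
        "\<bar>x - \<epsilon> * \<xi>\<bar> \<le> 1 + 2 * \<alpha> * Q"
        using abs_le_1_plus_square[of x] abs_le_1_plus_square[of "x - y"]
          abs_le_1_plus_square[of "x - y - \<eta> * p"] abs_le_1_plus_square[of "x - \<epsilon> * \<xi>"] by linarith+
      have "\<bar>\<epsilon> * \<xi>\<bar> \<le> \<rho>0" "\<bar>\<eta> * p\<bar> \<le> \<rho>0"
        using b \<rho>pos unfolding \<rho>0_def by linarith+
      moreover have "\<bar>\<epsilon> * \<xi>\<bar> = \<epsilon> * \<bar>\<xi>\<bar>" "\<bar>\<eta> * p\<bar> = \<eta> * \<bar>p\<bar>" using \<epsilon>0 \<eta> by (simp_all add: abs_mult)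
      ultimately have "\<epsilon> * \<bar>\<xi>\<bar> \<le> \<epsilon> * \<rho>" "\<eta> * \<bar>p\<bar> \<le> \<eta> * \<rho>"
        using \<rho>(3,4) by linarith+
      then have "\<bar>\<xi>\<bar> \<le> \<rho>" "\<bar>p\<bar> \<le> \<rho>"
        by (simp_all only: mult_le_cancel_left_pos[OF \<epsilon>0] mult_le_cancel_left_pos[OF \<eta>(1)])
      moreover have "\<bar>x\<bar> \<le> \<rho>" "\<bar>y\<bar> \<le> \<rho>" using b \<rho>pos \<rho>(2) unfolding \<rho>0_def by linarith+
      ultimately show ?thesis by blast
    qed
    define S where "S = {-\<rho>..\<rho>} \<times> {0..T+1} \<times> {-\<rho>..\<rho>} \<times> {0..T+2} \<times> {-\<rho>..\<rho>} \<times> {-\<rho>..\<rho>}"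
    have "compact S" unfolding S_def by (intro compact_Times compact_Icc)
    moreover have S0: "(0, 0, 0, 0, 0, 0) \<in> S" using \<rho>(1) T by (simp add: S_def)
    then have "S \<noteq> {}" by blast
    moreover have "continuous_on S (\<lambda>(x, t, y, s, \<xi>, p). \<Phi> x t y s \<xi> p)"
    proof -
      have c1: "continuous_on S (\<lambda>z. U (fst z, fst (snd z)))"
        by (rule continuous_on_compose2[OF cU]) (auto simp: S_def intro!: continuous_intros)
      have c2: "continuous_on S (\<lambda>z. W (fst (snd (snd z)), fst (snd (snd (snd z)))))"
        by (rule continuous_on_compose2[OF cW]) (auto simp: S_def intro!: continuous_intros)
      have c3: "continuous_on S (\<lambda>z. v (snd (snd (snd (snd (snd z))))) (fst (snd (snd (snd (snd z))))))"
      proof -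
        have "continuous_on S (\<lambda>z. (snd (snd (snd (snd (snd z)))), fst (snd (snd (snd (snd z))))))"
          by (intro continuous_intros)
        from continuous_on_compose2[OF continuous_on_lipschitz_parameter[OF cv v1] this] show ?thesis by simp
      qed
      show ?thesis
        unfolding \<Phi>_def E_def case_prod_beta using \<eta> \<alpha> by (intro continuous_intros c1 c2 c3) auto
    qed
    ultimately obtain z where z: "z \<in> S" "\<And>z'. z' \<in> S \<Longrightarrow>
        (\<lambda>(x, t, y, s, \<xi>, p). \<Phi> x t y s \<xi> p) z' \<le> (\<lambda>(x, t, y, s, \<xi>, p). \<Phi> x t y s \<xi> p) z"
      using continuous_attains_sup by meson
    obtain x t y s \<xi> p where zeq: "z = (x, t, y, s, \<xi>, p)" by (cases z) auto
    have le0: "- M0 - 1 \<le> \<Phi> x t y s \<xi> p" using z(2)[OF S0] \<Phi>0 by (simp add: zeq)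
    show thesis
    proof (rule that[of t s x y \<xi> p])
      fix x' t' y' s' \<xi>' p' assume *: "0 \<le> t'" "t' \<le> T + 1" "0 \<le> s'" "s' \<le> T + 2"
      show "\<Phi> x' t' y' s' \<xi>' p' \<le> \<Phi> x t y s \<xi> p"
      proof (cases "- M0 - 1 \<le> \<Phi> x' t' y' s' \<xi>' p'")
        case True
        from inbox[OF * True] have "(x', t', y', s', \<xi>', p') \<in> S"
          using * by (auto simp: S_def abs_le_iff)
        from z(2)[OF this] show ?thesis by (simp add: zeq)
      qed (use le0 in simp)
    qed (use z(1) le0 in \<open>auto simp: zeq S_def\<close>)
  qed
  note sm = small[OF t s low]
  define m where "m = x - y - \<eta> * p"
  have ts2: "(t - s)\<^sup>2 \<le> 2 * \<alpha> * Q" using sm \<alpha> by (simp add: field_simps)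
  have ts: "\<bar>t - s\<bar> < 1"
    using ts2 a2 by (intro power2_less_imp_less[of "\<bar>t - s\<bar>" 1]) auto
  have x\<xi>: "\<bar>x - \<epsilon> * \<xi>\<bar> \<le> \<epsilon> * \<theta>"
  proof -
    have "(x - \<epsilon> * \<xi>)\<^sup>2 \<le> 2 * \<alpha> * Q" using sm \<alpha> by (simp add: field_simps)
    then have "\<bar>x - \<epsilon> * \<xi>\<bar>\<^sup>2 \<le> (\<epsilon> * \<theta>)\<^sup>2" using a1 by simp
    then show ?thesis by (rule power2_le_imp_le) (use \<epsilon>0 \<theta> in simp)
  qed
  have \<delta>x: "\<bar>2 * \<delta> * x\<bar> \<le> \<theta>"
  proof -
    have "\<bar>2 * \<delta> * x\<bar>\<^sup>2 = 4 * \<delta> * (\<delta> * x\<^sup>2)" by (simp add: power2_eq_square)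
    also have "\<dots> \<le> 4 * \<delta> * Q" using sm \<delta> by (intro mult_left_mono) auto
    finally have "\<bar>2 * \<delta> * x\<bar>\<^sup>2 \<le> \<theta>\<^sup>2" using d2 by simp
    then show ?thesis by (rule power2_le_imp_le) (use \<theta> in simp)
  qed
  have tT: "t < T + 1"
  proof (rule ccontr)
    assume "\<not> t < T + 1"
    then have "t = T + 1" using t by simp
    then have "E t = exp (N / 2)" by (simp add: E_def)
    then show False using sm e1 by simp
  qed
  have sT: "s < T + 2" using ts tT by linarith
  \<comment> \<open>The competitor (z0, t0, z0, t0, z0/\<epsilon>, 0) makes all four coupling
    penalties vanish.\<close>
  have lower: "U (z0, t0) - W (z0, t0) \<le> \<Phi> x t y s \<xi> p + \<eta> * M0 + T * \<sigma> + 2 * \<theta>"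
  proof -
    have "\<Phi> z0 t0 z0 t0 (z0 / \<epsilon>) 0 \<le> \<Phi> x t y s \<xi> p" using t0 by (intro mx) auto
    moreover have "\<epsilon> * v 0 (z0 / \<epsilon>) \<le> \<eta> * M0"
    proof -
      have "\<epsilon> * v 0 (z0 / \<epsilon>) \<le> \<epsilon> * M0" using v0[of "z0 / \<epsilon>"] \<epsilon>0 by (intro mult_left_mono) auto
      also have "\<dots> \<le> \<eta> * M0" using \<epsilon>\<eta> M00 by (rule mult_right_mono)
      finally show ?thesis .
    qed
    moreover have "\<sigma> * t0 \<le> T * \<sigma>" using t0 \<sigma>0 by (simp add: mult.commute)
    moreover have "E t0 \<le> \<theta>"
    proof -
      have "N * (t0 - T - 1 / 2) \<le> N * (- (1 / 2))" using N t0 by (intro mult_left_mono) auto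
      then have "E t0 \<le> exp (- (N / 2))" by (simp add: E_def)
      then show ?thesis using e2 by simp
    qed
    moreover have "\<Phi> z0 t0 z0 t0 (z0 / \<epsilon>) 0 = U (z0, t0) - W (z0, t0) - \<epsilon> * v 0 (z0 / \<epsilon>) - \<sigma> * t0 - E t0 - \<delta> * z0\<^sup>2"
      using \<epsilon>0 by (simp add: \<Phi>_def)
    ultimately show ?thesis using d1 by linarith
  qed
  have "\<Phi> x t y s \<xi> p \<le> \<eta> * (L\<^sup>2 + M0 + 1) + 2 * \<theta>"
  proof (cases "t = 0 \<or> s = 0")
    case True
    \<comment> \<open>Whichever time vanishes, the square of the other is at most 2 \<alpha> Q, so
      the corresponding function is still \<theta>-close to g. The remaining half of the penalty for
      x - y then absorbs L |x - y| and leaves \<eta> L^2.\<close>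
    have "U (x, t) - W (y, s) \<le> g x - g y + \<theta>"
      using True
    proof
      assume "t = 0"
      then have "s\<^sup>2 \<le> 2 * \<alpha> * Q" using ts2 by simp
      then show ?thesis using a3(2)[OF s, of y] \<open>t = 0\<close> init(1)[of x] by (simp add: abs_le_iff)
    next
      assume "s = 0"
      then have "t\<^sup>2 \<le> 2 * \<alpha> * Q" "t \<le> T + 2" using ts2 t by auto
      then show ?thesis using a3(1)[OF t(1), of x] \<open>s = 0\<close> init(2)[of y] by (simp add: abs_le_iff)
    qed
    also have "g x - g y \<le> L * \<bar>x - y\<bar>" using gL[of x y] by simp
    also have "L * \<bar>x - y\<bar> \<le> (x - y)\<^sup>2 / (4 * \<eta>) + \<eta> * L\<^sup>2"
      using mult_le_square_young[OF \<eta>(1), of L "\<bar>x - y\<bar>"] by simp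
    finally have "U (x, t) - W (y, s) \<le> (x - y)\<^sup>2 / (4 * \<eta>) + \<eta> * L\<^sup>2 + \<theta>" by simp
    moreover have "0 \<le> (x - y - \<eta> * p)\<^sup>2 / (4 * \<alpha>)"
      "0 \<le> (x - \<epsilon> * \<xi>)\<^sup>2 / (2 * \<alpha>)" "0 \<le> (t - s)\<^sup>2 / (2 * \<alpha>)" "0 \<le> \<sigma> * t" "0 \<le> \<delta> * x\<^sup>2"
      using \<eta> \<alpha> \<sigma>0 t \<delta> by auto
    ultimately have "\<Phi> x t y s \<xi> p \<le> \<eta> * L\<^sup>2 + \<theta> + (\<eta> * M0 + \<eta> + \<alpha>)"
      using upper[of x t y s \<xi> p] E0[of t] by linarith
    then show ?thesis using \<alpha> by (simp add: algebra_simps)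
  next
    case False
    then have tpos: "0 < t" and spos: "0 < s" using t s by auto
    \<comment> \<open>Only the corrector term, \<epsilon>-Lipschitz in p with \<epsilon> = \<eta>^2,
      and the parabola in m depend on p.\<close>
    have m\<eta>: "\<bar>m\<bar> \<le> \<alpha> * \<eta>"
    proof (rule parabola_kink_slope[OF \<alpha>(1) \<eta>(1)])
      fix h
      have "\<Phi> x t y s \<xi> (p + h) \<le> \<Phi> x t y s \<xi> p" using t s by (intro mx) auto
      moreover have "x - y - \<eta> * (p + h) = m - \<eta> * h" by (simp add: m_def algebra_simps)
      ultimately have "m\<^sup>2 / (2 * \<alpha>) \<le> \<epsilon> * v (p + h) \<xi> - \<epsilon> * v p \<xi> + (m - \<eta> * h)\<^sup>2 / (2 * \<alpha>)"
        by (simp add: \<Phi>_def m_def)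
      moreover have "v (p + h) \<xi> - v p \<xi> \<le> \<bar>h\<bar>" using v1[of "p + h" \<xi> p] by simp
      then have "\<epsilon> * (v (p + h) \<xi> - v p \<xi>) \<le> \<epsilon> * \<bar>h\<bar>" using \<epsilon>0 by (intro mult_left_mono) auto
      ultimately show "m\<^sup>2 / (2 * \<alpha>) \<le> \<eta>\<^sup>2 * \<bar>h\<bar> + (m - \<eta> * h)\<^sup>2 / (2 * \<alpha>)"
        using \<epsilon> by (simp add: algebra_simps)
    qed
    \<comment> \<open>\<open>q\<close>, \<open>r1\<close>, \<open>r2\<close> are the slopes of the
      three spatial couplings. The first two are under control, |q - p| \<le> \<alpha> and |r1|
      \<le> \<eta>; \<open>r2\<close> is never estimated.\<close>
    define q where "q = (x - y) / \<eta>"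
    define r1 where "r1 = m / \<alpha>"
    define r2 where "r2 = (x - \<epsilon> * \<xi>) / \<alpha>"
    have r1: "\<bar>r1\<bar> \<le> \<eta>" using m\<eta> \<alpha> by (simp add: r1_def field_simps)
    have qp: "\<bar>q - p\<bar> \<le> \<alpha>"
    proof -
      have "q - p = m / \<eta>" using \<eta> by (simp add: q_def m_def field_simps)
      then show ?thesis using m\<eta> \<eta> by (simp add: pos_divide_le_eq)
    qed
    have x\<xi>': "\<bar>\<xi> - x / \<epsilon>\<bar> \<le> \<theta>"
    proof -
      have "\<xi> - x / \<epsilon> = - ((x - \<epsilon> * \<xi>) / \<epsilon>)" using \<epsilon>0 by (simp add: field_simps)
      then show ?thesis using x\<xi> \<epsilon>0 by (simp add: field_simps)
    qed
    have subU: "(t - s) / \<alpha> + \<sigma> + N * E t + H (x / \<epsilon>) (q + r1 + r2 + 2 * \<delta> * x) \<le> 0"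
    proof -
      define a where "a x' = (x' - y)\<^sup>2 / (2 * \<eta>) + (x' - y - \<eta> * p)\<^sup>2 / (2 * \<alpha>) + (x' - \<epsilon> * \<xi>)\<^sup>2 / (2 * \<alpha>) + \<delta> * x'\<^sup>2" for x'
      define a' where "a' x' = (x' - y) / \<eta> + (x' - y - \<eta> * p) / \<alpha> + (x' - \<epsilon> * \<xi>) / \<alpha> + 2 * \<delta> * x'" for x'
      define b where "b t' = (t' - s)\<^sup>2 / (2 * \<alpha>) + \<sigma> * t' + E t'" for t'
      define b' where "b' t' = (t' - s) / \<alpha> + \<sigma> + N * E t'" for t'
      have "(a has_real_derivative a' z) (at z)" for z
        unfolding a_def a'_def using \<eta> \<alpha> by (auto intro!: derivative_eq_intros simp: field_simps)
      moreover have "continuous_on UNIV a'" unfolding a'_def using \<eta> \<alpha> by (intro continuous_intros) auto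
      moreover have "(b has_real_derivative b' z) (at z)" for z
        unfolding b_def b'_def E_def using \<alpha> by (auto intro!: derivative_eq_intros simp: field_simps)
      moreover have "continuous_on UNIV b'" unfolding b'_def E_def using \<alpha> by (intro continuous_intros) auto
      ultimately have C: "C1_test (UNIV \<times> {0<..}) (\<lambda>z. a (fst z) + b (snd z)) (\<lambda>z. (a' (fst z), b' (snd z)))"
        by (rule C1_test_separate)
      have "\<forall>\<^sub>F z in nhds (x, t). z \<in> UNIV \<times> {0<..<T+1}"
        using tpos tT by (intro eventually_nhds_in_open open_Times) auto
      then have "\<forall>\<^sub>F z in nhds (x, t). U z - (a (fst z) + b (snd z)) \<le> U (x, t) - (a (fst (x, t)) + b (snd (x, t)))"
      proof (rule eventually_mono)
        fix z :: "real \<times> real" assume "z \<in> UNIV \<times> {0<..<T+1}"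
        then have "\<Phi> (fst z) (snd z) y s \<xi> p \<le> \<Phi> x t y s \<xi> p" using s by (intro mx) auto
        then show "U z - (a (fst z) + b (snd z)) \<le> U (x, t) - (a (fst (x, t)) + b (snd (x, t)))"
          by (simp add: \<Phi>_def a_def b_def)
      qed
      then have "(\<lambda>(z, t) (dz, dt). dt + H (z / \<epsilon>) dz) (x, t) (a' (fst (x, t)), b' (snd (x, t))) \<le> 0"
        using U C tpos unfolding viscosity_subsolution_def by blast
      then show ?thesis by (simp add: a'_def b'_def q_def r1_def r2_def m_def)
    qed
    have supW: "0 \<le> (t - s) / \<alpha> + Hb (q + r1)"
    proof -
      define a where "a y' = - ((x - y')\<^sup>2 / (2 * \<eta>)) - (x - y' - \<eta> * p)\<^sup>2 / (2 * \<alpha>)" for y'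
      define a' where "a' y' = (x - y') / \<eta> + (x - y' - \<eta> * p) / \<alpha>" for y'
      define b where "b s' = - ((t - s')\<^sup>2 / (2 * \<alpha>))" for s'
      define b' where "b' s' = (t - s') / \<alpha>" for s'
      have "(a has_real_derivative a' z) (at z)" for z
        unfolding a_def a'_def using \<eta> \<alpha> by (auto intro!: derivative_eq_intros simp: field_simps)
      moreover have "continuous_on UNIV a'" unfolding a'_def using \<eta> \<alpha> by (intro continuous_intros) auto
      moreover have "(b has_real_derivative b' z) (at z)" for z
        unfolding b_def b'_def using \<alpha> by (auto intro!: derivative_eq_intros simp: field_simps)
      moreover have "continuous_on UNIV b'" unfolding b'_def using \<alpha> by (intro continuous_intros) auto
      ultimately have C: "C1_test (UNIV \<times> {0<..}) (\<lambda>z. a (fst z) + b (snd z)) (\<lambda>z. (a' (fst z), b' (snd z)))"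
        by (rule C1_test_separate)
      have "\<forall>\<^sub>F z in nhds (y, s). z \<in> UNIV \<times> {0<..<T+2}"
        using spos sT by (intro eventually_nhds_in_open open_Times) auto
      then have "\<forall>\<^sub>F z in nhds (y, s). W z - (a (fst z) + b (snd z)) \<ge> W (y, s) - (a (fst (y, s)) + b (snd (y, s)))"
      proof (rule eventually_mono)
        fix z :: "real \<times> real" assume "z \<in> UNIV \<times> {0<..<T+2}"
        then have "\<Phi> x t (fst z) (snd z) \<xi> p \<le> \<Phi> x t y s \<xi> p" using t by (intro mx) auto
        then show "W z - (a (fst z) + b (snd z)) \<ge> W (y, s) - (a (fst (y, s)) + b (snd (y, s)))"
          by (simp add: \<Phi>_def a_def b_def)
      qed
      then have "(\<lambda>(z, t) (dz, dt). dt + Hb dz) (y, s) (a' (fst (y, s)), b' (snd (y, s))) \<ge> 0"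
        using W C spos unfolding viscosity_supersolution_def by blast
      then show ?thesis by (simp add: a'_def b'_def q_def r1_def m_def)
    qed
    \<comment> \<open>Dividing the \<xi>-dependent terms of \<Phi> by \<epsilon> gives the parabola
      exactly the slope \<open>r2\<close> that also occurs in the inequality for U.\<close>
    have supv: "0 \<le> H \<xi> (p + r2) - Hb p"
    proof -
      have d: "((\<lambda>\<xi>'. - ((x - \<epsilon> * \<xi>')\<^sup>2 / (2 * \<alpha> * \<epsilon>))) has_real_derivative (x - \<epsilon> * \<xi>') / \<alpha>) (at \<xi>')" for \<xi>'
        using \<alpha> \<epsilon>0 by (auto intro!: derivative_eq_intros simp: field_simps)
      have c: "continuous_on UNIV (\<lambda>\<xi>'. (x - \<epsilon> * \<xi>') / \<alpha>)" using \<alpha> by (intro continuous_intros) auto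
      have "v p \<xi>' - - ((x - \<epsilon> * \<xi>')\<^sup>2 / (2 * \<alpha> * \<epsilon>)) \<ge> v p \<xi> - - ((x - \<epsilon> * \<xi>)\<^sup>2 / (2 * \<alpha> * \<epsilon>))" for \<xi>'
      proof -
        have "\<Phi> x t y s \<xi>' p \<le> \<Phi> x t y s \<xi> p" using t s by (intro mx) auto
        then have "\<epsilon> * v p \<xi> + (x - \<epsilon> * \<xi>)\<^sup>2 / (2 * \<alpha>) \<le> \<epsilon> * v p \<xi>' + (x - \<epsilon> * \<xi>')\<^sup>2 / (2 * \<alpha>)"
          by (simp add: \<Phi>_def)
        then have "(\<epsilon> * v p \<xi> + (x - \<epsilon> * \<xi>)\<^sup>2 / (2 * \<alpha>)) / \<epsilon> \<le> (\<epsilon> * v p \<xi>' + (x - \<epsilon> * \<xi>')\<^sup>2 / (2 * \<alpha>)) / \<epsilon>"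
          using \<epsilon>0 by (intro divide_right_mono) auto
        then show ?thesis using \<epsilon>0 by (simp add: add_divide_distrib)
      qed
      then show ?thesis
        unfolding r2_def by (intro viscosity_supersolutionD_real[OF vsup d c] always_eventually) blast
    qed
    \<comment> \<open>In the sum of the three inequalities (t - s)/\<alpha> cancels between U and W,
      Hb p between W and v up to K (\<alpha> + \<eta>), and \<open>r2\<close> between U and v. What
      remains is \<sigma> \<le> K (2 \<eta> + 4 \<theta>), contradicting the extra \<theta> in
      \<sigma>.\<close>
    have "Hb (q + r1) \<le> Hb p + K * (\<alpha> + \<eta>)"
    proof -
      have "\<bar>q + r1 - p\<bar> \<le> \<alpha> + \<eta>" using qp r1 by linarith
      then have "K * \<bar>q + r1 - p\<bar> \<le> K * (\<alpha> + \<eta>)" using K0 by (rule mult_left_mono)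
      then show ?thesis using Hb[of "q + r1" p] by linarith
    qed
    moreover have "H \<xi> (p + r2) \<le> H (x / \<epsilon>) (q + r1 + r2 + 2 * \<delta> * x) + K * (2 * \<theta> + \<alpha> + \<eta>)"
    proof -
      have "\<bar>\<xi> - x / \<epsilon>\<bar> + \<bar>p + r2 - (q + r1 + r2 + 2 * \<delta> * x)\<bar> \<le> 2 * \<theta> + \<alpha> + \<eta>"
        using x\<xi>' qp r1 \<delta>x by linarith
      then have "K * (\<bar>\<xi> - x / \<epsilon>\<bar> + \<bar>p + r2 - (q + r1 + r2 + 2 * \<delta> * x)\<bar>) \<le> K * (2 * \<theta> + \<alpha> + \<eta>)"
        using K0 by (rule mult_left_mono)
      then show ?thesis using K[of \<xi> "p + r2" "x / \<epsilon>" "q + r1 + r2 + 2 * \<delta> * x"] by linarith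
    qed
    moreover have "0 \<le> N * E t" using N E0[of t] by simp
    ultimately have "\<sigma> \<le> K * (\<alpha> + \<eta>) + K * (2 * \<theta> + \<alpha> + \<eta>)"
      using subU supW supv by linarith
    also have "\<dots> = K * (2 * \<eta> + 2 * \<theta> + 2 * \<alpha>)" by (simp add: algebra_simps)
    also have "\<dots> \<le> K * (2 * \<eta> + 4 * \<theta>)" using K0 \<alpha> by (intro mult_left_mono) auto
    finally show ?thesis using \<sigma> \<theta> by simp
  qed
  then show ?thesis using lower by (simp add: algebra_simps)
qed

text \<open>\<delta> depends on z0 and \<alpha> on the moduli of continuity of U and W, but neither
  survives in the bound; only a multiple of \<theta> does, and it is made smaller than an arbitrary
  e.\<close>

lemma homogenization_upper_bound:
  fixes H :: "real \<Rightarrow> real \<Rightarrow> real" and U W :: "real \<times> real \<Rightarrow> real"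
  assumes K: "\<And>x y d e. \<bar>H x d - H y e\<bar> \<le> K * (\<bar>x - y\<bar> + \<bar>d - e\<bar>)"
    and Hb: "\<And>d e. \<bar>Hb d - Hb e\<bar> \<le> K * \<bar>d - e\<bar>"
    and vsup: "\<And>p. viscosity_supersolution UNIV (\<lambda>y d. H y (p + d) - Hb p) (v p)"
    and cv: "\<And>p. continuous_on UNIV (v p)"
    and v1: "\<And>p q y. \<bar>v p y - v q y\<bar> \<le> \<bar>p - q\<bar>" and v0: "\<And>y. \<bar>v 0 y\<bar> \<le> M0"
    and gL: "\<And>x y. \<bar>g x - g y\<bar> \<le> L * \<bar>x - y\<bar>"
    and \<epsilon>: "0 < \<epsilon>" "\<epsilon> < 1" and T: "0 < T"
    and U: "viscosity_subsolution (UNIV \<times> {0<..}) (\<lambda>(z, t) (dz, dt). dt + H (z / \<epsilon>) dz) U"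
    and W: "viscosity_supersolution (UNIV \<times> {0<..}) (\<lambda>(z, t) (dz, dt). dt + Hb dz) W"
    and bU: "BUC_on (UNIV \<times> {0..T+2}) U" and bW: "BUC_on (UNIV \<times> {0..T+2}) W"
    and init: "\<And>z. U (z, 0) = g z" "\<And>z. W (z, 0) = g z"
    and t0: "0 \<le> t0" "t0 \<le> T"
  shows "U (z0, t0) - W (z0, t0) \<le> (L\<^sup>2 + 2 * M0 + 1 + 2 * K * T) * sqrt \<epsilon>"
proof (rule field_le_epsilon)
  fix e :: real assume e: "0 < e"
  define \<eta> where "\<eta> = sqrt \<epsilon>"
  have \<eta>: "0 < \<eta>" "\<eta> < 1" "\<epsilon> = \<eta>\<^sup>2" using \<epsilon> by (auto simp: \<eta>_def)
  have K0: "K \<ge> 0" using Hb[of 0 1] by simp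
  have M00: "M0 \<ge> 0" using v0[of 0] by linarith
  have cU: "continuous_on (UNIV \<times> {0..T+2}) U" and cW: "continuous_on (UNIV \<times> {0..T+2}) W"
    using bU bW by (auto simp: BUC_on_def uniformly_continuous_imp_continuous)
  obtain B1 where B1: "\<And>z. z \<in> UNIV \<times> {0..T+2} \<Longrightarrow> \<bar>U z\<bar> \<le> B1"
    using bU unfolding BUC_on_def bounded_iff by auto
  obtain B2 where B2: "\<And>z. z \<in> UNIV \<times> {0..T+2} \<Longrightarrow> \<bar>W z\<bar> \<le> B2"
    using bW unfolding BUC_on_def bounded_iff by auto
  define B where "B = max B1 B2"
  have B: "\<And>z t. 0 \<le> t \<Longrightarrow> t \<le> T + 2 \<Longrightarrow> \<bar>U (z, t)\<bar> \<le> B" "\<And>z t. 0 \<le> t \<Longrightarrow> t \<le> T + 2 \<Longrightarrow> \<bar>W (z, t)\<bar> \<le> B"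
    using B1 B2 by (fastforce simp: B_def max_def)+
  have B0: "B \<ge> 0" using B(1)[of 0 0] T by simp
  define Q where "Q = 2 * B + 2 * M0 + 3"
  have Q3: "Q \<ge> 3" using B0 M00 by (simp add: Q_def)
  \<comment> \<open>The coefficient of \<theta> in T \<sigma> + 4 \<theta>.\<close>
  define c where "c = T * (4 * K + 1) + 4"
  have c0: "c > 0" using T K0 by (simp add: c_def add_nonneg_pos)
  define \<theta> where "\<theta> = min (1 / 2) (e / c)"
  have \<theta>: "0 < \<theta>" "\<theta> < 1" "c * \<theta> \<le> e"
  proof -
    show "0 < \<theta>" "\<theta> < 1" using e c0 by (auto simp: \<theta>_def)
    have "c * \<theta> \<le> c * (e / c)" using c0 by (intro mult_left_mono) (auto simp: \<theta>_def)
    then show "c * \<theta> \<le> e" using c0 by simp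
  qed
  obtain d1 where d1: "d1 > 0" "\<And>z z'. z \<in> UNIV \<times> {0..T+2} \<Longrightarrow> z' \<in> UNIV \<times> {0..T+2} \<Longrightarrow> dist z' z < d1 \<Longrightarrow>
      dist (U z') (U z) < \<theta>"
    using bU \<theta>(1) unfolding BUC_on_def uniformly_continuous_on_def by blast
  obtain d2 where d2: "d2 > 0" "\<And>z z'. z \<in> UNIV \<times> {0..T+2} \<Longrightarrow> z' \<in> UNIV \<times> {0..T+2} \<Longrightarrow> dist z' z < d2 \<Longrightarrow>
      dist (W z') (W z) < \<theta>"
    using bW \<theta>(1) unfolding BUC_on_def uniformly_continuous_on_def by blast
  define d where "d = min d1 d2"
  have d: "d > 0" "d \<le> d1" "d \<le> d2" using d1 d2 by (auto simp: d_def)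
  define \<delta> where "\<delta> = min (\<theta> / (1 + z0\<^sup>2)) (\<theta>\<^sup>2 / (4 * Q))"
  have z0: "1 + z0\<^sup>2 > 0" by (rule add_pos_nonneg) auto
  have \<delta>0: "\<delta> > 0" using \<theta> Q3 z0 by (auto simp: \<delta>_def)
  have \<delta>z: "\<delta> * z0\<^sup>2 \<le> \<theta>"
  proof -
    have "\<delta> * z0\<^sup>2 \<le> \<delta> * (1 + z0\<^sup>2)" using \<delta>0 by (intro mult_left_mono) auto
    also have "\<dots> \<le> \<theta> / (1 + z0\<^sup>2) * (1 + z0\<^sup>2)" using z0 by (intro mult_right_mono) (auto simp: \<delta>_def)
    finally show ?thesis using z0 by simp
  qed
  have \<delta>Q: "4 * \<delta> * Q \<le> \<theta>\<^sup>2"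
  proof -
    have "4 * Q * \<delta> \<le> 4 * Q * (\<theta>\<^sup>2 / (4 * Q))" using Q3 by (intro mult_left_mono) (auto simp: \<delta>_def)
    then show ?thesis using Q3 by (simp add: mult.commute mult.left_commute)
  qed
  \<comment> \<open>This dominates 2 \<alpha> Q. Its entries yield, in order, |x - \<epsilon> \<xi>|
    \<le> \<epsilon> \<theta>, |t - s| < 1, and |s| < d for the modulus of continuity.\<close>
  define b where "b = min ((\<epsilon> * \<theta>)\<^sup>2) (min (1 / 2) (d\<^sup>2 / 2))"
  have b: "b > 0" "b \<le> (\<epsilon> * \<theta>)\<^sup>2" "b \<le> 1 / 2" "b \<le> d\<^sup>2 / 2" using \<epsilon> \<theta> d by (auto simp: b_def)
  define \<alpha> where "\<alpha> = min \<theta> (b / (2 * Q))"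
  have \<alpha>: "0 < \<alpha>" "\<alpha> \<le> \<theta>" using \<theta> b Q3 by (auto simp: \<alpha>_def)
  have \<alpha>Q: "2 * \<alpha> * Q \<le> b"
  proof -
    have "2 * Q * \<alpha> \<le> 2 * Q * (b / (2 * Q))" using Q3 by (intro mult_left_mono) (auto simp: \<alpha>_def)
    then show ?thesis using Q3 by (simp add: mult.commute mult.left_commute)
  qed
  have sd: "\<bar>s\<bar> < d" if "s\<^sup>2 \<le> 2 * \<alpha> * Q" for s
  proof -
    have "\<bar>s\<bar>\<^sup>2 < d\<^sup>2" using that \<alpha>Q b d by simp
    then show ?thesis by (rule power2_less_imp_less) (use d in simp)
  qed
  \<comment> \<open>One entry for exp(N/2) > Q, one for exp(-N/2) \<le> \<theta>.\<close>
  define N where "N = 2 * ln (max (Q + 1) (1 / \<theta>))"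
  have Nexp: "exp (N / 2) = max (Q + 1) (1 / \<theta>)" using Q3 by (simp add: N_def)
  have N0: "0 < N" using Q3 by (simp add: N_def)
  have e1: "Q < exp (N / 2)" using Nexp by simp
  have e2: "exp (- (N / 2)) \<le> \<theta>"
  proof -
    have "1 / \<theta> \<le> exp (N / 2)" using Nexp by simp
    then show ?thesis using \<theta> by (simp add: exp_minus field_simps)
  qed
  have "U (z0, t0) - W (z0, t0) \<le> \<eta> * (L\<^sup>2 + 2 * M0 + 1) + T * (K * (2 * \<eta> + 4 * \<theta>) + \<theta>) + 4 * \<theta>"
  proof (rule doubling_core[OF K Hb vsup cv v1 v0 gL \<eta> T U W cU cW B init t0 \<theta>(1,2) \<alpha> \<delta>0 N0 Q_def
        e1 e2 \<delta>z \<delta>Q _ _ _ _ refl])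
    show "2 * \<alpha> * Q \<le> (\<epsilon> * \<theta>)\<^sup>2" "2 * \<alpha> * Q < 1" using \<alpha>Q b by linarith+
    fix z s :: real assume s: "0 \<le> s" "s \<le> T + 2" "s\<^sup>2 \<le> 2 * \<alpha> * Q"
    have in1: "(z, 0) \<in> UNIV \<times> {0..T+2}" "(z, s) \<in> UNIV \<times> {0..T+2}" using s T by auto
    have "dist (z, s) (z, 0) < d" using sd[OF s(3)] by (simp add: dist_Pair_Pair dist_real_def)
    then have "dist (z, s) (z, 0) < d1" "dist (z, s) (z, 0) < d2" using d by auto
    from d1(2)[OF in1 this(1)] d2(2)[OF in1 this(2)]
    show "\<bar>U (z, s) - g z\<bar> \<le> \<theta>" "\<bar>W (z, s) - g z\<bar> \<le> \<theta>"
      by (auto simp: init dist_real_def)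
  qed
  also have "\<dots> = (L\<^sup>2 + 2 * M0 + 1 + 2 * K * T) * \<eta> + c * \<theta>" by (simp add: c_def algebra_simps)
  also have "\<dots> \<le> (L\<^sup>2 + 2 * M0 + 1 + 2 * K * T) * \<eta> + e" using \<theta>(3) by simp
  finally show "U (z0, t0) - W (z0, t0) \<le> (L\<^sup>2 + 2 * M0 + 1 + 2 * K * T) * sqrt \<epsilon> + e"
    by (simp add: \<eta>_def)
qed

text \<open>The other inequality is the upper bound for -U and -W, with Hamiltonians -H(y, -d) and
  -Hb(-d) and correctors -v(-p). When H is coercive the new Hamiltonian is not, so the upper bound
  has to be stated through Lipschitz bounds and correctors instead of coercivity.\<close>

lemma homogenization_error:
  fixes H :: "real \<Rightarrow> real \<Rightarrow> real" and U W :: "real \<times> real \<Rightarrow> real"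
  assumes K: "\<And>x y d e. \<bar>H x d - H y e\<bar> \<le> K * (\<bar>x - y\<bar> + \<bar>d - e\<bar>)"
    and Hb: "\<And>d e. \<bar>Hb d - Hb e\<bar> \<le> K * \<bar>d - e\<bar>"
    and vsol: "\<And>p. viscosity_solution UNIV (\<lambda>y d. H y (p + d) - Hb p) (v p)"
    and v1: "\<And>p q y. \<bar>v p y - v q y\<bar> \<le> \<bar>p - q\<bar>" and v0: "\<And>y. \<bar>v 0 y\<bar> \<le> M0"
    and gL: "\<And>x y. \<bar>g x - g y\<bar> \<le> L * \<bar>x - y\<bar>"
    and \<epsilon>: "0 < \<epsilon>" "\<epsilon> < 1" and T: "0 < T"
    and U: "cauchy_solution (\<lambda>z. H (z / \<epsilon>)) g U" and W: "cauchy_solution (\<lambda>z. Hb) g W"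
    and t0: "0 \<le> t0" "t0 \<le> T"
  shows "\<bar>U (z0, t0) - W (z0, t0)\<bar> \<le> (L\<^sup>2 + 2 * M0 + 1 + 2 * K * T) * sqrt \<epsilon>"
proof (rule abs_leI)
  have cv: "continuous_on UNIV (v p)" and vsub: "viscosity_subsolution UNIV (\<lambda>y d. H y (p + d) - Hb p) (v p)"
    and vsup: "viscosity_supersolution UNIV (\<lambda>y d. H y (p + d) - Hb p) (v p)" for p
    using vsol[of p] by (auto simp: viscosity_solution_def)
  have BUC: "BUC_on (UNIV \<times> {0..T+2}) U" "BUC_on (UNIV \<times> {0..T+2}) W"
    and init: "\<And>z. U (z, 0) = g z" "\<And>z. W (z, 0) = g z"
    and subU: "viscosity_subsolution (UNIV \<times> {0<..}) (\<lambda>(z, t) (dz, dt). dt + H (z / \<epsilon>) dz) U"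
    and supU: "viscosity_supersolution (UNIV \<times> {0<..}) (\<lambda>(z, t) (dz, dt). dt + H (z / \<epsilon>) dz) U"
    and subW: "viscosity_subsolution (UNIV \<times> {0<..}) (\<lambda>(z, t) (dz, dt). dt + Hb dz) W"
    and supW: "viscosity_supersolution (UNIV \<times> {0<..}) (\<lambda>(z, t) (dz, dt). dt + Hb dz) W"
    using U W T by (auto simp: cauchy_solution_def viscosity_solution_def)
  show "U (z0, t0) - W (z0, t0) \<le> (L\<^sup>2 + 2 * M0 + 1 + 2 * K * T) * sqrt \<epsilon>"
    by (rule homogenization_upper_bound[OF K Hb vsup cv v1 v0 gL \<epsilon> T subU supW BUC init t0])
  have BUC': "BUC_on S (\<lambda>x. - u x)" if "BUC_on S u" for S and u :: "real \<times> real \<Rightarrow> real"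
    using that bounded_uminus[of "u ` S"]
    by (auto simp: BUC_on_def image_image uniformly_continuous_on_minus)
  have "- U (z0, t0) - - W (z0, t0) \<le> (L\<^sup>2 + 2 * M0 + 1 + 2 * K * T) * sqrt \<epsilon>"
  proof (rule homogenization_upper_bound[of "\<lambda>y d. - H y (- d)" K "\<lambda>d. - Hb (- d)" "\<lambda>p y. - v (- p) y" M0 "\<lambda>x. - g x"])
    show "\<bar>- H x (- d) - - H y (- e)\<bar> \<le> K * (\<bar>x - y\<bar> + \<bar>d - e\<bar>)" for x y d e
      using K[of x "- d" y "- e"] by (simp add: abs_minus_commute)
    show "\<bar>- Hb (- d) - - Hb (- e)\<bar> \<le> K * \<bar>d - e\<bar>" for d e
      using Hb[of "- d" "- e"] by (simp add: abs_minus_commute)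
    show "viscosity_supersolution UNIV (\<lambda>y d. - H y (- (p + d)) - - Hb (- p)) (\<lambda>y. - v (- p) y)" for p
      using vsub[of "- p"] by (simp add: viscosity_subsolution_minus minus_diff_commute)
    show "continuous_on UNIV (\<lambda>y. - v (- p) y)" for p by (intro continuous_intros cv)
    show "\<bar>- v (- p) y - - v (- q) y\<bar> \<le> \<bar>p - q\<bar>" for p q y
      using v1[of "- p" y "- q"] by (simp add: abs_minus_commute)
    show "\<bar>- v (- 0) y\<bar> \<le> M0" for y using v0 by simp
    show "\<bar>- g x - - g y\<bar> \<le> L * \<bar>x - y\<bar>" for x y using gL[of x y] by (simp add: abs_minus_commute)
    show "viscosity_subsolution (UNIV \<times> {0<..}) (\<lambda>(z, t) (dz, dt). dt + - H (z / \<epsilon>) (- dz)) (\<lambda>x. - U x)"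
      using supU unfolding viscosity_supersolution_minus
      by (rule back_subst[of "\<lambda>F. viscosity_subsolution _ F _"]) (auto simp: fun_eq_iff)
    show "viscosity_supersolution (UNIV \<times> {0<..}) (\<lambda>(z, t) (dz, dt). dt + - Hb (- dz)) (\<lambda>x. - W x)"
      using subW unfolding viscosity_subsolution_minus
      by (rule back_subst[of "\<lambda>F. viscosity_supersolution _ F _"]) (auto simp: fun_eq_iff)
  qed (use \<epsilon> T BUC BUC' init t0 in auto)
  then show "- (U (z0, t0) - W (z0, t0)) \<le> (L\<^sup>2 + 2 * M0 + 1 + 2 * K * T) * sqrt \<epsilon>" by simp
qed

section \<open>Essential suprema and the assembly of the theorem\<close>

lemma Linf_norm_le:
  fixes f :: "'a::euclidean_space \<Rightarrow> real"
  assumes S: "S \<in> sets lebesgue" and f: "continuous_on S f" and le: "\<And>x. x \<in> S \<Longrightarrow> \<bar>f x\<bar> \<le> c"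
  shows "Linf_norm S f \<le> ereal c"
  unfolding Linf_norm_def
proof (rule esssup_I)
  have "f \<in> borel_measurable (lebesgue_on S)"
    by (rule continuous_imp_measurable_on_sets_lebesgue[OF f S])
  then show "(\<lambda>x. ereal \<bar>f x\<bar>) \<in> borel_measurable (lebesgue_on S)" by measurable
  show "AE x in lebesgue_on S. ereal \<bar>f x\<bar> \<le> ereal c" using le by (intro AE_I2) simp
qed

text \<open>The constant of the theorem may depend on g only through the norm of Dg, so the
  essential supremum itself must serve as Lipschitz constant, not an arbitrary
  \<open>K\<close>.\<close>

lemma Linf_norm_deriv_lipschitz:
  fixes g :: "real \<Rightarrow> real"
  assumes "K-lipschitz_on UNIV g" and L: "Linf_norm UNIV (deriv g) = ereal L"
  shows "\<bar>g x - g y\<bar> \<le> L * \<bar>x - y\<bar>"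
proof (rule lipschitz_AE_deriv_bound[OF assms(1)])
  have "AE x in lebesgue_on UNIV. ereal \<bar>deriv g x\<bar> \<le> Linf_norm UNIV (deriv g)"
    unfolding Linf_norm_def by (rule esssup_AE)
  then show "AE x in lebesgue. \<bar>deriv g x\<bar> \<le> L" by (simp add: L AE_restrict_space_iff)
qed

theorem theorem1p3:
  fixes H :: "real \<Rightarrow> real \<Rightarrow> real"
  assumes "continuous_on UNIV (\<lambda>(y, p). H y p)"
    and "\<And>y p. H (y + 1) p = H y p"
    and "coercive_snd H"
  shows
    "(\<exists>v :: real \<Rightarrow> real \<Rightarrow> real.
        (\<forall>p. cell_solution H p (effective_hamiltonian H p) (v p) \<and> v p 0 = 0) \<and>
        (\<forall>p q. p < q \<longrightarrow>
           (AE y in lebesgue_on {0..<1}.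
              v p differentiable (at y) \<and> v q differentiable (at y) \<and>
              p + deriv (v p) y \<le> q + deriv (v q) y)) \<and>
        (\<forall>p q. Linf_norm {0..<1} (\<lambda>y. v p y - v q y) \<le> ereal \<bar>p - q\<bar>)) \<and>
     ((\<exists>K. K-lipschitz_on UNIV (\<lambda>(y, p). H y p)) \<longrightarrow>
        (\<forall>T>0. \<forall>L. \<exists>C. \<forall>g :: real \<Rightarrow> real.
           BUC_on UNIV g \<and> (\<exists>K. K-lipschitz_on UNIV g) \<and> Linf_norm UNIV (deriv g) = ereal L \<longrightarrow>
           (\<forall>\<epsilon>\<in>{0<..<1}. \<forall>u\<epsilon> u.
              cauchy_solution (\<lambda>z. H (z / \<epsilon>)) g u\<epsilon> \<and>
              cauchy_solution (\<lambda>z. effective_hamiltonian H) g u \<longrightarrow>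
              Linf_norm (UNIV \<times> {0..T}) (\<lambda>x. u\<epsilon> x - u x) \<le> ereal (C * \<epsilon> powr (1/2)))))"
proof -
  interpret periodic_coercive_hamiltonian H
    using assms by unfold_locales
  obtain v where cell: "\<And>p. cell_solution H p (effective_hamiltonian H p) (v p)" and v0: "\<And>p. v p 0 = 0"
    and anti: "\<And>p q x y. p < q \<Longrightarrow> x \<le> y \<Longrightarrow> p * x + v p x - (q * x + v q x) \<ge> p * y + v p y - (q * y + v q y)"
    by (rule monotone_cell_solutions, rule that)
  have per: "v p (y + 1) = v p y" and vsol: "viscosity_solution UNIV (\<lambda>y d. H y (p + d) - effective_hamiltonian H p) (v p)" for p y
    using cell[of p] by (auto simp: cell_solution_def)
  have cv: "continuous_on UNIV (v p)" for p using vsol[of p] by (simp add: viscosity_solution_def)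
  have gap: "\<bar>v p y - v q y\<bar> \<le> \<bar>p - q\<bar>" for p q y
  proof (cases p q rule: linorder_cases)
    case less
    then show ?thesis using periodic_antimono_gap[OF less per v0 per v0 anti[OF less]] by simp
  next
    case greater
    then show ?thesis
      using periodic_antimono_gap[OF greater per v0 per v0 anti[OF greater]] by (simp add: abs_minus_commute)
  qed simp
  have diff: "AE y in lebesgue_on {0..<1}. v p differentiable (at y)" for p
  proof -
    obtain R where "R \<ge> 0" "\<And>x y. \<bar>v p x - v p y\<bar> \<le> R * \<bar>x - y\<bar>"
      by (rule cell_solution_lipschitz[OF cell[of p]], rule that)
    then have "R-lipschitz_on UNIV (v p)" by (auto intro!: lipschitz_onI simp: dist_real_def)
    then have "AE y in lebesgue. v p differentiable (at y)" by (rule lipschitz_AE_differentiable)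
    then show ?thesis by (subst AE_restrict_space_iff) (auto elim: eventually_mono)
  qed
  have deriv: "p + deriv (v p) y \<le> q + deriv (v q) y"
    if "p < q" "v p differentiable (at y)" "v q differentiable (at y)" for p q y
  proof -
    have "mono_on UNIV (\<lambda>x. q * x + v q x - (p * x + v p x))"
      using anti[OF that(1)] by (intro mono_onI) (simp add: algebra_simps)
    moreover have "((\<lambda>x. q * x + v q x - (p * x + v p x)) has_real_derivative
        (q + deriv (v q) y) - (p + deriv (v p) y)) (at y)"
      using that(2,3) by (auto intro!: derivative_eq_intros DERIV_deriv_iff_real_differentiable[THEN iffD2])
    ultimately have "0 \<le> (q + deriv (v q) y) - (p + deriv (v p) y)"
      by (rule mono_on_imp_deriv_nonneg) simp
    then show ?thesis by simp
  qed
  have part1: "AE y in lebesgue_on {0..<1}. v p differentiable (at y) \<and> v q differentiable (at y) \<and>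
      p + deriv (v p) y \<le> q + deriv (v q) y" if "p < q" for p q
    using diff[of p] diff[of q] by eventually_elim (simp add: deriv[OF that])
  have part2: "Linf_norm {0..<1} (\<lambda>y. v p y - v q y) \<le> ereal \<bar>p - q\<bar>" for p q
    by (intro Linf_norm_le gap continuous_intros continuous_on_subset[OF cv]) auto
  have part3: "\<exists>C. \<forall>g :: real \<Rightarrow> real.
           BUC_on UNIV g \<and> (\<exists>K. K-lipschitz_on UNIV g) \<and> Linf_norm UNIV (deriv g) = ereal L \<longrightarrow>
           (\<forall>\<epsilon>\<in>{0<..<1}. \<forall>u\<epsilon> u.
              cauchy_solution (\<lambda>z. H (z / \<epsilon>)) g u\<epsilon> \<and>
              cauchy_solution (\<lambda>z. effective_hamiltonian H) g u \<longrightarrow>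
              Linf_norm (UNIV \<times> {0..T}) (\<lambda>x. u\<epsilon> x - u x) \<le> ereal (C * \<epsilon> powr (1/2)))"
    if lipH: "K-lipschitz_on UNIV (\<lambda>(y, p). H y p)" and T: "T > 0" for K T L
  proof -
    have K0: "K \<ge> 0" by (rule lipschitz_on_nonneg[OF lipH])
    have K: "\<bar>H x d - H y e\<bar> \<le> K * (\<bar>x - y\<bar> + \<bar>d - e\<bar>)" for x y d e
    proof -
      have "\<bar>H x d - H y e\<bar> \<le> K * dist (x, d) (y, e)"
        using lipschitz_onD[OF lipH, of "(x, d)" "(y, e)"] by (simp add: dist_real_def)
      also have "dist (x, d) (y, e) \<le> \<bar>x - y\<bar> + \<bar>d - e\<bar>"
        unfolding dist_Pair_Pair dist_real_def using sqrt_sum_squares_le_sum_abs[of "x - y" "d - e"] by simp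
      finally show ?thesis using K0 by (simp add: mult_left_mono)
    qed
    have Hb: "\<bar>effective_hamiltonian H d - effective_hamiltonian H e\<bar> \<le> K * \<bar>d - e\<bar>" for d e
      by (rule effective_hamiltonian_lipschitz) (use K[of y d y e for y d e] in simp)
    obtain x where x: "\<And>y. \<bar>v 0 y\<bar> \<le> \<bar>v 0 x\<bar>"
    proof (rule periodic_attains_max[of "\<lambda>y. \<bar>v 0 y\<bar>"])
      show "\<bar>v 0 (y + 1)\<bar> = \<bar>v 0 y\<bar>" for y by (simp add: per)
      show "continuous_on UNIV (\<lambda>y. \<bar>v 0 y\<bar>)" by (intro continuous_intros cv)
    qed (rule that)
    \<comment> \<open>\<open>v\<close> is selected from H alone, and only its member for p = 0
      enters, through its maximum |v 0 x|. So \<open>C\<close> depends on H, L and T and not on g or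
      \<epsilon>.\<close>
    define C where "C = L\<^sup>2 + 2 * \<bar>v 0 x\<bar> + 1 + 2 * K * T"
    show ?thesis
    proof (intro exI[of _ C] allI impI ballI)
      fix g :: "real \<Rightarrow> real" and \<epsilon> :: real and U W :: "real \<times> real \<Rightarrow> real"
      assume g: "BUC_on UNIV g \<and> (\<exists>K. K-lipschitz_on UNIV g) \<and> Linf_norm UNIV (deriv g) = ereal L"
        and \<epsilon>: "\<epsilon> \<in> {0<..<1}"
        and UW: "cauchy_solution (\<lambda>z. H (z / \<epsilon>)) g U \<and> cauchy_solution (\<lambda>z. effective_hamiltonian H) g W"
      have gL: "\<bar>g x - g y\<bar> \<le> L * \<bar>x - y\<bar>" for x y
        using g Linf_norm_deriv_lipschitz by blast
      show "Linf_norm (UNIV \<times> {0..T}) (\<lambda>x. U x - W x) \<le> ereal (C * \<epsilon> powr (1/2))"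
      proof (rule Linf_norm_le)
        have "closed (UNIV \<times> {0..T} :: (real \<times> real) set)" by (intro closed_Times) auto
        then show "UNIV \<times> {0..T} \<in> sets (lebesgue :: (real \<times> real) measure)" by simp
        show "continuous_on (UNIV \<times> {0..T}) (\<lambda>x. U x - W x)"
          using UW T by (auto simp: cauchy_solution_def BUC_on_def
              intro!: continuous_intros uniformly_continuous_imp_continuous)
        fix z :: "real \<times> real" assume "z \<in> UNIV \<times> {0..T}"
        then obtain z0 t0 where z: "z = (z0, t0)" "0 \<le> t0" "t0 \<le> T" by auto
        have "\<bar>U (z0, t0) - W (z0, t0)\<bar> \<le> (L\<^sup>2 + 2 * \<bar>v 0 x\<bar> + 1 + 2 * K * T) * sqrt \<epsilon>"
          by (rule homogenization_error[OF K Hb vsol gap x gL _ _ T _ _ z(2,3)]) (use \<epsilon> UW in auto)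
        then show "\<bar>U z - W z\<bar> \<le> C * \<epsilon> powr (1/2)"
          using \<epsilon> by (simp add: z(1) C_def powr_half_sqrt)
      qed
    qed
  qed
  show ?thesis
    using cell v0 part1 part2 part3 by blast
qed

end
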